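(* Let $f:[1,\infty)\to(0,\infty)$ be a nondecreasing function such that $\limsup_{n\to\infty} f(b_n)/f(n)<\infty$ whenever $\limsup_{n\to\infty} b_n/n<\infty$. Let $\{a_n\}$ be a sequence of positive integer valued random variables such that for each $n$, $a_n$ is independent of the random variables $\{X_k\}$. Let $T_n^*=S_{n+a_n}-S_n$. (1) Let $0<\lambda\le\infty$. Assume $\limsup_{n\to\infty}a_n/n<\infty$ a.s. if $0<\lambda<\infty$, and $\limsup_{n\to\infty}a_n/\tau_1(n)<\infty$ a.s. if $\lambda=\infty$. Then, with probability one, $$\limsup_{n\to\infty}\frac{|T_n^*|}{B_n (f(n))^{1/\alpha_1}}=0 \iff \int_1^\infty \frac{dx}{x f(x)}<\infty,\qquad \limsup_{n\to\infty}\frac{|T_n^*|}{B_n (f(n))^{1/\alpha_1}}=\infty \iff \int_1^\infty \frac{dx}{x f(x)}=\infty .$$ (2) Let $\lambda=0$. Assume $\limsup_{n\to\infty}a_n/n<\infty$ a.s. and that for some $\mu>\frac{\alpha_2-\alpha_1}{\alpha_2}$ one has $\tau_1(n)<n^{\alpha_1/\alpha_2}(\log n)^{-\mu}$ for all sufficiently large $n$. Then, with probability one, $$\limsup_{n\to\infty}\frac{|T_n^*|}{B_n (f(n))^{1/\alpha_2}}=0 \iff \int_1^\infty \frac{dx}{x f(x)}<\infty,\qquad \limsup_{n\to\infty}\frac{|T_n^*|}{B_n (f(n))^{1/\alpha_2}}=\infty \iff \int_1^\infty \frac{dx}{x f(x)}=\infty .$$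
   Context: Let $0<\alpha_1<\alpha_2<2$. $\{X_n\}_{n\ge1}$ are independent random variables; $X_n$ has distribution function $F_n\in\{G_1,G_2\}$. For $j=1,2$, $G_j$ is in the domain of normal attraction of the (symmetric, non-normal) stable law with characteristic function $\varphi_j(t)=\exp(-\lambda_j|t|^{\alpha_j})$, $\lambda_j>0$, called the stable $(\alpha_j)$ law; in particular, for $x>0$, $1-G_j(x)=\frac{c_{j1}+\theta_j(x)}{x^{\alpha_j}}$ and $G_j(-x)=\frac{c_{j2}+\beta_j(-x)}{x^{\alpha_j}}$ with $c_{j1},c_{j2}>0$ and $\theta_j(x),\beta_j(-x)\to0$ as $x\to\infty$. $S_n=\sum_{k=1}^n X_k$. $\tau_j(n)$ is the number of $k\le n$ with $F_k=G_j$, so $\tau_1(n)+\tau_2(n)=n$; it is assumed that $\tau_j(n)\to\infty$ for $j=1,2$. Let $U_{\tau_1(n)}$ and $V_{\tau_2(n)}$ be the sums of those $X_k$, $k\le n$, with distribution function $G_1$ and $G_2$ respectively. With $B_j(m)=m^{1/\alpha_j}$, $(U_{\tau_1(n)}-d_1(\tau_1(n)))/B_1(\tau_1(n))$ and $(V_{\tau_2(n)}-d_2(\tau_2(n)))/B_2(\tau_2(n))$ converge in distribution to the stable $(\alpha_1)$ and stable $(\alpha_2)$ laws; the centering convention is that $d_1=d_2=0$ if $\alpha_1\ne1,\alpha_2\neq 1$, while $d_j(n)\sim n\log n$ if $\alpha_j=1$ (here $f_n\sim g_n$ means that $f_n/g_n$ converges to a constant in $(0,\infty)$). It is assumed that $(S_n-A_n)/B_n$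 converges in distribution to a proper random variable for suitable $A_n\in\mathbb{R}$, $B_n>0$; equivalently $\frac{(\tau_1(n))^{\alpha_2}}{(\tau_2(n))^{\alpha_1}}\to\lambda$ for some $\lambda\in[0,\infty]$. The limit law is stable $(\alpha_2)$ if $\lambda=0$, a composition (convolution) of the two stable laws if $0<\lambda<\infty$, and stable $(\alpha_1)$ if $\lambda=\infty$. The normalization is $B_n=(\tau_1(n))^{1/\alpha_1}$ if $\lambda=\infty$ and $B_n=(\tau_2(n))^{1/\alpha_2}$ (of exact order $n^{1/\alpha_2}$) if $0\le\lambda<\infty$. *)

theory Defs
  imports "HOL-Probability.Probability"
begin

text \<open>Sequences are indexed from 1, as in the mathematics: \<open>X 0\<close> is never used.\<close>

definition distr_fun :: "'a measure \<Rightarrow> (nat \<Rightarrow> 'a \<Rightarrow> real) \<Rightarrow> nat \<Rightarrow> real \<Rightarrow> real" where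
  "distr_fun M X k = cdf (distr M borel (X k))"

definition partial_sum :: "(nat \<Rightarrow> 'a \<Rightarrow> real) \<Rightarrow> nat \<Rightarrow> 'a \<Rightarrow> real" where
  "partial_sum X n \<omega> = (\<Sum>k=1..n. X k \<omega>)"

definition idx_of :: "'a measure \<Rightarrow> (nat \<Rightarrow> 'a \<Rightarrow> real) \<Rightarrow> (real \<Rightarrow> real) \<Rightarrow> nat \<Rightarrow> nat set" where
  "idx_of M X H n = {k \<in> {1..n}. distr_fun M X k = H}"

text \<open>\<open>tau M X (G j) n\<close> is \<open>\<tau>\<^sub>j(n)\<close>; \<open>sum_of M X (G j) n\<close> is \<open>U\<close> for \<open>j = 1\<close> and \<open>V\<close> for \<open>j = 2\<close>.\<close>

definition tau :: "'a measure \<Rightarrow> (nat \<Rightarrow> 'a \<Rightarrow> real) \<Rightarrow> (real \<Rightarrow> real) \<Rightarrow> nat \<Rightarrow> nat" where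
  "tau M X H n = card (idx_of M X H n)"

definition sum_of :: "'a measure \<Rightarrow> (nat \<Rightarrow> 'a \<Rightarrow> real) \<Rightarrow> (real \<Rightarrow> real) \<Rightarrow> nat \<Rightarrow> 'a \<Rightarrow> real" where
  "sum_of M X H n \<omega> = (\<Sum>k\<in>idx_of M X H n. X k \<omega>)"

text \<open>\<open>L\<close> is the symmetric stable law with characteristic function \<open>exp (- l \<bar>t\<bar>\<^sup>\<alpha>)\<close>.\<close>

definition sym_stable_law :: "real measure \<Rightarrow> real \<Rightarrow> real \<Rightarrow> bool" where
  "sym_stable_law L \<alpha> l \<longleftrightarrow> real_distribution L \<and>
     (\<forall>t. char L t = complex_of_real (exp (- l * \<bar>t\<bar> powr \<alpha>)))"

text \<open>Domain of normal attraction: for \<open>m\<close> independent variables with distribution function \<open>H\<close>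
  (the coordinates of the product of \<open>m\<close> copies of the law with distribution function \<open>H\<close>), the sum,
  normalized by a constant multiple of \<open>m\<close> to the power \<open>1/\<alpha>\<close> and suitably centered, converges in
  distribution to \<open>L\<close>.\<close>

definition normal_attraction :: "(real \<Rightarrow> real) \<Rightarrow> real \<Rightarrow> real measure \<Rightarrow> bool" where
  "normal_attraction H \<alpha> L \<longleftrightarrow>
     (\<exists>b > 0. \<exists>A :: nat \<Rightarrow> real.
        weak_conv_m (\<lambda>m. distr (\<Pi>\<^sub>M i\<in>{1..m}. interval_measure H) borel
                           (\<lambda>x. (\<Sum>i=1..m. x i) / (b * real m powr (1 / \<alpha>)) - A m)) L)"

text \<open>Convergence in distribution to a proper (finite, non-degenerate) random variable.\<close>

definition conv_to_proper :: "'a measure \<Rightarrow> (nat \<Rightarrow> 'a \<Rightarrow> real) \<Rightarrow> bool" where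
  "conv_to_proper M Y \<longleftrightarrow>
     (\<exists>N. real_distribution N \<and> (\<forall>c. measure N {c} < 1) \<and>
          weak_conv_m (\<lambda>n. distr M borel (Y n)) N)"

text \<open>The centering convention for \<open>d\<close>, one type of summand at a time.  For \<open>\<alpha> = 1\<close> the convention is
  that \<open>d(m) / (m log m)\<close> converges to a finite constant \<open>c\<close>.  The value \<open>c = 0\<close> is admitted along with
  \<open>c > 0\<close>: when the limit law is symmetric, \<open>d(2m)/(2m) - d(m)/m\<close> tends to 0, which forces
  \<open>c = 0\<close>, so demanding \<open>c > 0\<close> would make the case \<open>\<alpha> = 1\<close> void.\<close>

definition centering :: "real \<Rightarrow> (nat \<Rightarrow> real) \<Rightarrow> bool" where
  "centering \<alpha> d \<longleftrightarrow>
     (\<alpha> \<noteq> 1 \<longrightarrow> (\<forall>m. d m = 0)) \<and>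
     (\<alpha> = 1 \<longrightarrow> (\<exists>c\<ge>0. (\<lambda>m. d m / (real m * ln (real m))) \<longlonglongrightarrow> c))"

text \<open>The normalization \<open>B\<^sub>n\<close>; \<open>\<Lambda>\<close> is the limit of \<open>\<tau>\<^sub>1(n)\<close> to the power \<open>\<alpha>\<^sub>2\<close> over
  \<open>\<tau>\<^sub>2(n)\<close> to the power \<open>\<alpha>\<^sub>1\<close>.\<close>

definition norming ::
  "'a measure \<Rightarrow> (nat \<Rightarrow> 'a \<Rightarrow> real) \<Rightarrow> (nat \<Rightarrow> real \<Rightarrow> real) \<Rightarrow> (nat \<Rightarrow> real) \<Rightarrow> ereal \<Rightarrow> nat \<Rightarrow> real" where
  "norming M X G \<alpha> \<Lambda> n =
     (if \<Lambda> = \<infinity> then real (tau M X (G 1) n) powr (1 / \<alpha> 1)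
      else real (tau M X (G 2) n) powr (1 / \<alpha> 2))"

text \<open>\<open>a\<close> is independent of the whole family \<open>X 1, X 2, \<dots>\<close>, viewed as one random sequence.
  (The library's \<open>indep_var\<close> needs both variables to take values in the same type.)\<close>

definition indep_of_seq :: "'a measure \<Rightarrow> ('a \<Rightarrow> nat) \<Rightarrow> (nat \<Rightarrow> 'a \<Rightarrow> real) \<Rightarrow> bool" where
  "indep_of_seq M a X \<longleftrightarrow>
     prob_space.indep_set M
       {a -` A \<inter> space M | A. A \<in> sets (count_space UNIV)}
       {(\<lambda>\<omega>. \<lambda>k\<in>{1..}. X k \<omega>) -` A \<inter> space M | A. A \<in> sets (\<Pi>\<^sub>M k\<in>{1::nat..}. (borel :: real measure))}"

definition random_increment ::
  "(nat \<Rightarrow> 'a \<Rightarrow> real) \<Rightarrow> (nat \<Rightarrow> 'a \<Rightarrow> nat) \<Rightarrow> nat \<Rightarrow> 'a \<Rightarrow> real" where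
  "random_increment X a n \<omega> = partial_sum X (n + a n \<omega>) \<omega> - partial_sum X n \<omega>"

text \<open>The integral of \<open>1/(x f(x))\<close> over \<open>[1,\<infinity>)\<close>, with values in \<open>[0,\<infinity>]\<close>.\<close>

definition log_integral :: "(real \<Rightarrow> real) \<Rightarrow> ennreal" where
  "log_integral f = (\<integral>\<^sup>+x\<in>{1..}. ennreal (1 / (x * f x)) \<partial>lborel)"

definition growth_fun :: "(real \<Rightarrow> real) \<Rightarrow> bool" where
  "growth_fun f \<longleftrightarrow>
     (\<forall>x\<ge>1. 0 < f x) \<and> mono_on {1..} f \<and>
     (\<forall>b :: nat \<Rightarrow> real. (\<forall>n. 1 \<le> b n) \<longrightarrow>
        limsup (\<lambda>n. ereal (b n / real n)) < \<infinity> \<longrightarrow>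
        limsup (\<lambda>n. ereal (f (b n) / f (real n))) < \<infinity>)"

end

theory Submission
  imports Defs "HOL-Real_Asymp.Real_Asymp"
begin

text \<open>A sum of heavy-tailed variables is large essentially when one summand is large, and the two halves of
the dichotomy make this precise in opposite directions.  Let \<open>i\<close> be the type with the normalization
\<open>B\<^sub>n \<asymp> \<tau>\<^sub>i(n)\<^bsup>1/\<alpha>\<^sub>i\<^esup>\<close> (type 1 if \<open>\<Lambda> > 0\<close>, type 2 if \<open>\<Lambda> = 0\<close>).

The common tool is \<open>truncated_maximal_inequality\<close>: centre each summand at its mean truncated at
level \<open>x\<close>; then the largest of the centred partial sums exceeds \<open>x\<close> with probability at most a constant
times \<open>\<Sum>\<^sub>j \<tau>\<^sub>j x\<^bsup>-\<alpha>\<^sub>j\<^esup>\<close>, the order of the expected number of single summands that exceed \<open>x\<close>.  Truncated means are themselves of order \<open>x\<^bsup>1-\<alpha>\<^esup>\<close> for \<open>\<alpha> \<noteq> 1\<close>; for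
\<open>\<alpha> > 1\<close> this needs the mean to vanish, which follows from convergence in law without centering
(\<open>truncated_mean_tendsto_0\<close>).  For \<open>\<alpha> = 1\<close> they can grow, but at most logarithmically.

Convergent integral (\<open>eventually_small_increments\<close>).  Cut time where \<open>\<tau>\<^sub>i\<close> passes powers of 2.  In the
block of \<open>2\<^sup>k\<close> the level is \<open>x = \<delta> (2\<^sup>k f(2\<^sup>k))\<^bsup>1/\<alpha>\<^sub>i\<^esup>\<close>, and the maximal inequality bounds the
probability of leaving \<open>[-x, x]\<close> by a multiple of \<open>1 / f(2\<^sup>k)\<close>, plus \<open>k\<^bsup>-\<mu>\<^esup> f(2\<^sup>k)\<^bsup>-\<alpha>\<^sub>1/\<alpha>\<^sub>2\<^esup>\<close> from
the rare type 1 when \<open>\<Lambda> = 0\<close>.  The integral test turns \<open>\<integral> dx / (x f x) < \<infinity>\<close> into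
\<open>\<Sum> 1 / f(2\<^sup>k) < \<infinity>\<close>, which also forces \<open>k = o(f(2\<^sup>k))\<close>; hence both terms are summable (here
\<open>\<mu> + \<alpha>\<^sub>1/\<alpha>\<^sub>2 > 1\<close> enters), the logarithmic drift of the case \<open>\<alpha> = 1\<close> is negligible, and Borel-Cantelli applies.

Divergent integral (\<open>infinitely_often_large_increments\<close>).  Every \<open>T\<^sub>n\<^sup>*\<close> contains \<open>X\<^bsub>n+1\<^esub>\<close>.  With
\<open>y\<^sub>n = R (\<tau>\<^sub>i(n) f(n))\<^bsup>1/\<alpha>\<^sub>i\<^esup>\<close>, the events \<open>\<bar>X\<^sub>n\<bar> \<ge> 2 y\<^sub>n\<close> for \<open>n\<close> of type \<open>i\<close> are
independent with divergent probabilities \<open>\<asymp> 1 / (\<tau>\<^sub>i(n) f(n))\<close>.  The summands after \<open>n\<close> stay, after centering,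
within \<open>y\<^sub>n\<close> for all admissible lengths simultaneously, with a probability that is close to 1 for large \<open>R\<close>.
A first-passage argument (\<open>prob_UN_inter_ge\<close>) combines the two although the events for
different \<open>n\<close> are dependent.  What is left is the drift.  At most one type has \<open>\<alpha> = 1\<close>, so there is a
sign with which the total drift is nearly nonnegative (\<open>aligned_sign\<close>), and since both tails of
\<open>X\<^sub>n\<close> are heavy one may ask \<open>X\<^sub>n\<close> to jump in that direction; then nothing cancels the jump.

Both statements hold for all increment lengths up to a horizon, so they apply to
random lengths \<open>a\<^sub>n\<close> pathwise (\<open>increment_dichotomy\<close>).\<close>

section \<open>Maximal inequalities for independent summands\<close>

text \<open>First-passage decomposition: split the union of the \<open>A k\<close> according to the first index \<open>k\<close> at which it
happens.  That \<open>k\<close> is the first index is an event of the past, and \<open>D k\<close> will be an event of the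
future of \<open>k\<close>; the events \<open>D k\<close> for different \<open>k\<close> overlap and are far from independent.\<close>

lemma (in prob_space) prob_UN_inter_ge:
  fixes A D :: "nat \<Rightarrow> 'a set"
  assumes A [measurable]: "\<And>k. A k \<in> events"
    and D [measurable]: "\<And>k. D k \<in> events"
    and indep: "\<And>k. n \<le> k \<Longrightarrow> k \<le> N \<Longrightarrow>
      prob ((A k - (\<Union>i\<in>{n..<k}. A i)) \<inter> D k) = prob (A k - (\<Union>i\<in>{n..<k}. A i)) * prob (D k)"
    and \<delta>: "\<And>k. n \<le> k \<Longrightarrow> k \<le> N \<Longrightarrow> \<delta> \<le> prob (D k)"
  shows "\<delta> * prob (\<Union>k\<in>{n..N}. A k) \<le> prob (\<Union>k\<in>{n..N}. A k \<inter> D k)"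
proof -
  define E where "E k = A k - (\<Union>i\<in>{n..<k}. A i)" for k
  have [measurable]: "E k \<in> events" for k unfolding E_def by measurable
  have disj: "disjoint_family_on E {n..N}"
    unfolding disjoint_family_on_def E_def
    by (auto; metis atLeastLessThan_iff linorder_neqE_nat)
  have UE: "(\<Union>k\<in>{n..N}. A k) = (\<Union>k\<in>{n..N}. E k)"
  proof (intro equalityI subsetI)
    fix x assume "x \<in> (\<Union>k\<in>{n..N}. A k)"
    then obtain k where k: "n \<le> k" "k \<le> N" "x \<in> A k" by auto
    define l where "l = (LEAST l. n \<le> l \<and> x \<in> A l)"
    have l: "n \<le> l \<and> x \<in> A l" unfolding l_def by (rule LeastI[of _ k]) (use k in auto)
    have "l \<le> k" unfolding l_def by (rule Least_le) (use k in auto)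
    moreover have "x \<notin> A i" if "i \<in> {n..<l}" for i
      using not_less_Least[of i "\<lambda>l. n \<le> l \<and> x \<in> A l"] that by (auto simp: l_def)
    ultimately have "x \<in> E l" "l \<in> {n..N}" using l k by (auto simp: E_def)
    then show "x \<in> (\<Union>k\<in>{n..N}. E k)" by blast
  qed (auto simp: E_def)
  have "\<delta> * prob (\<Union>k\<in>{n..N}. A k) = \<delta> * (\<Sum>k\<in>{n..N}. prob (E k))"
    unfolding UE by (subst finite_measure_finite_Union) (use disj in auto)
  also have "\<dots> = (\<Sum>k\<in>{n..N}. prob (E k) * \<delta>)" by (simp add: sum_distrib_left mult.commute)
  also have "\<dots> \<le> (\<Sum>k\<in>{n..N}. prob (E k) * prob (D k))"
    by (intro sum_mono mult_left_mono \<delta>) auto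
  also have "\<dots> = (\<Sum>k\<in>{n..N}. prob (E k \<inter> D k))"
    by (intro sum.cong refl) (use indep in \<open>auto simp: E_def\<close>)
  also have "\<dots> = prob (\<Union>k\<in>{n..N}. E k \<inter> D k)"
    by (subst finite_measure_finite_Union) (use disj in \<open>auto simp: disjoint_family_on_def\<close>)
  also have "\<dots> \<le> prob (\<Union>k\<in>{n..N}. A k \<inter> D k)"
    by (intro finite_measure_mono) (auto simp: E_def)
  finally show ?thesis .
qed

text \<open>A predicate on sequences whose truth survives the restriction to \<open>J\<close> describes an event of the coordinates in
\<open>J\<close>; in this form the predicates can be written with \<open>X\<close> itself.\<close>

lemma (in prob_space) prob_indep_restrict:
  fixes X :: "nat \<Rightarrow> 'a \<Rightarrow> real"
  assumes ind: "indep_vars (\<lambda>_. borel) X I"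
    and JK: "J \<subseteq> I" "K \<subseteq> I" "J \<inter> K = {}"
    and P: "Measurable.pred (\<Pi>\<^sub>M i\<in>J. (borel :: real measure)) P"
    and R: "Measurable.pred (\<Pi>\<^sub>M i\<in>K. (borel :: real measure)) R"
    and PR: "\<And>z. P (restrict z J) \<longleftrightarrow> P z" "\<And>z. R (restrict z K) \<longleftrightarrow> R z"
  shows "prob ({\<omega>\<in>space M. P (\<lambda>i. X i \<omega>)} \<inter> {\<omega>\<in>space M. R (\<lambda>i. X i \<omega>)}) =
         prob {\<omega>\<in>space M. P (\<lambda>i. X i \<omega>)} * prob {\<omega>\<in>space M. R (\<lambda>i. X i \<omega>)}"
proof -
  have iv: "indep_var (PiM J (\<lambda>_. borel)) (\<lambda>\<omega>. restrict (\<lambda>i. X i \<omega>) J)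
        (PiM K (\<lambda>_. borel)) (\<lambda>\<omega>. restrict (\<lambda>i. X i \<omega>) K)"
    by (rule indep_var_restrict[OF ind]) (use JK in auto)
  define A where "A = {x \<in> space (PiM J (\<lambda>_. borel :: real measure)). P x}"
  define B where "B = {x \<in> space (PiM K (\<lambda>_. borel :: real measure)). R x}"
  have AB: "A \<in> sets (PiM J (\<lambda>_. borel))" "B \<in> sets (PiM K (\<lambda>_. borel))"
    unfolding A_def B_def using P R by (auto simp: pred_def)
  have sp: "restrict (\<lambda>i. X i \<omega>) J \<in> space (PiM J (\<lambda>_. borel :: real measure))"
    "restrict (\<lambda>i. X i \<omega>) K \<in> space (PiM K (\<lambda>_. borel :: real measure))" for \<omega>
    by (auto simp: space_PiM)
  show ?thesis
    using indep_varD[OF iv AB] sp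
    by (simp add: A_def B_def vimage_def Int_def conj_ac PR)
qed

text \<open>If a partial sum exceeds \<open>2 x\<close> and the rest of the sum, which is independent of the
first such passage, stays within \<open>x\<close> with probability at least one half, then the total still exceeds \<open>x\<close>.\<close>

lemma (in prob_space) levy_ottaviani:
  fixes Z :: "nat \<Rightarrow> 'a \<Rightarrow> real"
  assumes ind: "indep_vars (\<lambda>_. borel) Z {n<..N}"
    and x: "0 \<le> x"
    and half: "\<And>k. n \<le> k \<Longrightarrow> k \<le> N \<Longrightarrow> \<P>(\<omega> in M. x < \<bar>\<Sum>i\<in>{k<..N}. Z i \<omega>\<bar>) \<le> 1/2"
  shows "\<P>(\<omega> in M. \<exists>k\<in>{n..N}. 2 * x < \<bar>\<Sum>i\<in>{n<..k}. Z i \<omega>\<bar>)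
       \<le> 2 * \<P>(\<omega> in M. x < \<bar>\<Sum>i\<in>{n<..N}. Z i \<omega>\<bar>)"
proof -
  have Zm: "random_variable borel (Z i)" if "i \<in> {n<..N}" for i
    using ind that by (auto simp: indep_vars_def2)
  have Sm[measurable]: "random_variable borel (\<lambda>\<omega>. \<Sum>i\<in>I. Z i \<omega>)" if "I \<subseteq> {n<..N}" for I
    by (intro borel_measurable_sum Zm) (use that in auto)
  define A where "A k = (if k \<in> {n..N} then {\<omega>\<in>space M. 2 * x < \<bar>\<Sum>i\<in>{n<..k}. Z i \<omega>\<bar>} else {})" for k
  define D where "D k = (if k \<in> {n..N} then {\<omega>\<in>space M. \<bar>\<Sum>i\<in>{k<..N}. Z i \<omega>\<bar> \<le> x} else {})" for k
  have A: "A k \<in> events" for k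
  proof (cases "k \<in> {n..N}")
    case True
    then have [measurable]: "random_variable borel (\<lambda>\<omega>. \<Sum>i\<in>{n<..k}. Z i \<omega>)"
      by (intro Sm) auto
    show ?thesis unfolding A_def using True by simp
  qed (auto simp: A_def)
  have D: "D k \<in> events" for k
  proof (cases "k \<in> {n..N}")
    case True
    then have [measurable]: "random_variable borel (\<lambda>\<omega>. \<Sum>i\<in>{k<..N}. Z i \<omega>)"
      by (intro Sm) auto
    show ?thesis unfolding D_def using True by simp
  qed (auto simp: D_def)
  have "1/2 * prob (\<Union>k\<in>{n..N}. A k) \<le> prob (\<Union>k\<in>{n..N}. A k \<inter> D k)"
  proof (rule prob_UN_inter_ge[OF A D])
    fix k assume k: "n \<le> k" "k \<le> N"
    define P where "P z \<longleftrightarrow> 2 * x < \<bar>\<Sum>i\<in>{n<..k}. z i\<bar> \<and> (\<forall>j\<in>{n..<k}. \<not> 2 * x < \<bar>\<Sum>i\<in>{n<..j}. z i\<bar>)"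
      for z :: "nat \<Rightarrow> real"
    define R where "R z \<longleftrightarrow> \<bar>\<Sum>i\<in>{k<..N}. z i\<bar> \<le> x" for z :: "nat \<Rightarrow> real"
    have sum_meas: "(\<lambda>z. \<Sum>i\<in>I. z i) \<in> borel_measurable (\<Pi>\<^sub>M i\<in>J. (borel :: real measure))"
      if "I \<subseteq> J" for I J :: "nat set"
      by (intro borel_measurable_sum measurable_component_singleton) (use that in auto)
    have [measurable]: "Measurable.pred (\<Pi>\<^sub>M i\<in>{n<..k}. (borel :: real measure)) P"
      unfolding P_def
    proof (intro pred_intros_logic pred_intros_finite)
      have [measurable]: "(\<lambda>z. \<Sum>i\<in>{n<..k}. z i) \<in> borel_measurable (\<Pi>\<^sub>M i\<in>{n<..k}. (borel :: real measure))"
        by (rule sum_meas) auto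
      show "Measurable.pred (\<Pi>\<^sub>M i\<in>{n<..k}. (borel :: real measure)) (\<lambda>z. 2 * x < \<bar>\<Sum>i\<in>{n<..k}. z i\<bar>)"
        by measurable
      fix j assume "j \<in> {n..<k}"
      then have [measurable]: "(\<lambda>z. \<Sum>i\<in>{n<..j}. z i) \<in> borel_measurable (\<Pi>\<^sub>M i\<in>{n<..k}. (borel :: real measure))"
        by (intro sum_meas) auto
      show "Measurable.pred (\<Pi>\<^sub>M i\<in>{n<..k}. (borel :: real measure)) (\<lambda>z. 2 * x < \<bar>\<Sum>i\<in>{n<..j}. z i\<bar>)"
        by measurable
    qed auto
    have [measurable]: "Measurable.pred (\<Pi>\<^sub>M i\<in>{k<..N}. (borel :: real measure)) R"
      unfolding R_def using sum_meas[of "{k<..N}" "{k<..N}"] by measurable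
    have sum_restrict: "(\<Sum>i\<in>I. restrict z J i) = (\<Sum>i\<in>I. z i)" if "I \<subseteq> J" for I J :: "nat set" and z :: "nat \<Rightarrow> real"
      by (intro sum.cong) (use that in auto)
    have Pr: "P (restrict z {n<..k}) \<longleftrightarrow> P z" for z
      unfolding P_def by (intro conj_cong ball_cong refl) (simp_all add: sum_restrict)
    have Rr: "R (restrict z {k<..N}) \<longleftrightarrow> R z" for z
      unfolding R_def by (simp add: sum_restrict)
    have 1: "A k - (\<Union>i\<in>{n..<k}. A i) = {\<omega>\<in>space M. P (\<lambda>i. Z i \<omega>)}"
      using k by (auto simp: A_def P_def)
    have 2: "D k = {\<omega>\<in>space M. R (\<lambda>i. Z i \<omega>)}" using k by (auto simp: D_def R_def)
    show "prob ((A k - (\<Union>i\<in>{n..<k}. A i)) \<inter> D k) = prob (A k - (\<Union>i\<in>{n..<k}. A i)) * prob (D k)"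
      unfolding 1 2
    proof (rule prob_indep_restrict[OF ind, where J="{n<..k}" and K="{k<..N}"])
      show "P (restrict z {n<..k}) \<longleftrightarrow> P z" for z by (rule Pr)
      show "R (restrict z {k<..N}) \<longleftrightarrow> R z" for z by (rule Rr)
    qed (use k in auto)
    have "{\<omega>\<in>space M. x < \<bar>\<Sum>i\<in>{k<..N}. Z i \<omega>\<bar>} = space M - D k"
      using k by (auto simp: D_def)
    then show "1/2 \<le> prob (D k)" using half[OF k] prob_compl[OF D[of k]] by simp
  qed
  also have "\<dots> \<le> \<P>(\<omega> in M. x < \<bar>\<Sum>i\<in>{n<..N}. Z i \<omega>\<bar>)"
  proof (rule finite_measure_mono)
    show "(\<Union>k\<in>{n..N}. A k \<inter> D k) \<subseteq> {\<omega> \<in> space M. x < \<bar>\<Sum>i\<in>{n<..N}. Z i \<omega>\<bar>}"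
    proof safe
      fix k \<omega> assume k: "k \<in> {n..N}" and a: "\<omega> \<in> A k" "\<omega> \<in> D k"
      have "{n<..N} = {n<..k} \<union> {k<..N}" using k by auto
      then have "(\<Sum>i\<in>{n<..N}. Z i \<omega>) = (\<Sum>i\<in>{n<..k}. Z i \<omega>) + (\<Sum>i\<in>{k<..N}. Z i \<omega>)"
        by (simp add: sum.union_disjoint[symmetric] ivl_disj_int)
      moreover have "2 * x < \<bar>\<Sum>i\<in>{n<..k}. Z i \<omega>\<bar>" "\<bar>\<Sum>i\<in>{k<..N}. Z i \<omega>\<bar> \<le> x"
        using a k by (auto simp: A_def D_def)
      ultimately show "x < \<bar>\<Sum>i\<in>{n<..N}. Z i \<omega>\<bar>" by linarith
      show "\<omega> \<in> space M" using a sets.sets_into_space[OF A] by blast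
    qed
    show "{\<omega> \<in> space M. x < \<bar>\<Sum>i\<in>{n<..N}. Z i \<omega>\<bar>} \<in> events"
      using Sm[of "{n<..N}"] by measurable
  qed
  also have "(\<Union>k\<in>{n..N}. A k) = {\<omega>\<in>space M. \<exists>k\<in>{n..N}. 2 * x < \<bar>\<Sum>i\<in>{n<..k}. Z i \<omega>\<bar>}"
    by (auto simp: A_def)
  finally show ?thesis by simp
qed

lemma (in prob_space) second_moment_sum_indep:
  fixes Z :: "'i \<Rightarrow> 'a \<Rightarrow> real"
  assumes "finite I" "indep_vars (\<lambda>_. borel) Z I"
    and "\<And>i. i \<in> I \<Longrightarrow> integrable M (\<lambda>\<omega>. (Z i \<omega>)\<^sup>2)"
    and "\<And>i. i \<in> I \<Longrightarrow> expectation (Z i) = 0"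
  shows "integrable M (\<lambda>\<omega>. (\<Sum>i\<in>I. Z i \<omega>)\<^sup>2)
    \<and> expectation (\<lambda>\<omega>. (\<Sum>i\<in>I. Z i \<omega>)\<^sup>2) = (\<Sum>i\<in>I. expectation (\<lambda>\<omega>. (Z i \<omega>)\<^sup>2))"
  using assms
proof (induction I rule: finite_induct)
  case empty
  then show ?case by simp
next
  case (insert j I)
  let ?S = "\<lambda>\<omega>. \<Sum>i\<in>I. Z i \<omega>"
  have rv: "random_variable borel (Z i)" if "i \<in> insert j I" for i
    using insert.prems(1) that by (auto simp: indep_vars_def2)
  have IH: "integrable M (\<lambda>\<omega>. (?S \<omega>)\<^sup>2)"
    "expectation (\<lambda>\<omega>. (?S \<omega>)\<^sup>2) = (\<Sum>i\<in>I. expectation (\<lambda>\<omega>. (Z i \<omega>)\<^sup>2))"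
    using insert.IH[OF indep_vars_subset[OF insert.prems(1)]] insert.prems by auto
  have iZ: "integrable M (Z i)" if "i \<in> insert j I" for i
    by (rule square_integrable_imp_integrable[OF rv[OF that]]) (use insert.prems that in auto)
  have iS: "integrable M ?S" by (intro Bochner_Integration.integrable_sum iZ) auto
  have iv: "indep_var borel (Z j) borel ?S"
    by (rule indep_vars_sum) (use insert in auto)
  have cross: "integrable M (\<lambda>\<omega>. Z j \<omega> * ?S \<omega>)" "expectation (\<lambda>\<omega>. Z j \<omega> * ?S \<omega>) = 0"
    using indep_var_integrable[OF iv iZ iS] indep_var_lebesgue_integral[OF iv iZ iS] insert.prems(3)[of j]
    by auto
  have eq: "(\<Sum>i\<in>insert j I. Z i \<omega>)\<^sup>2 = (Z j \<omega>)\<^sup>2 + 2 * (Z j \<omega> * ?S \<omega>) + (?S \<omega>)\<^sup>2" for \<omega>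
    using insert.hyps by (simp add: power2_sum)
  show ?case
    unfolding eq using insert.prems(2)[of j] IH cross insert.hyps by simp
qed

text \<open>Kolmogorov's inequality up to a constant.  Chebyshev's inequality supplies the hypothesis of
\<open>levy_ottaviani\<close> when the bound is below one; otherwise there is nothing to prove.\<close>

lemma (in prob_space) maximal_inequality_L2:
  fixes Z :: "nat \<Rightarrow> 'a \<Rightarrow> real"
  assumes ind: "indep_vars (\<lambda>_. borel) Z {n<..N}"
    and sq: "\<And>i. i \<in> {n<..N} \<Longrightarrow> integrable M (\<lambda>\<omega>. (Z i \<omega>)\<^sup>2)"
    and mean: "\<And>i. i \<in> {n<..N} \<Longrightarrow> expectation (Z i) = 0"
    and var: "\<And>i. i \<in> {n<..N} \<Longrightarrow> expectation (\<lambda>\<omega>. (Z i \<omega>)\<^sup>2) \<le> v i"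
    and x: "0 < x"
  shows "\<P>(\<omega> in M. \<exists>k\<in>{n..N}. 2 * x < \<bar>\<Sum>i\<in>{n<..k}. Z i \<omega>\<bar>) \<le> 2 * (\<Sum>i\<in>{n<..N}. v i) / x\<^sup>2"
proof -
  define V where "V = (\<Sum>i\<in>{n<..N}. v i)"
  have v0: "0 \<le> v i" if "i \<in> {n<..N}" for i
    by (rule order_trans[OF _ var[OF that]]) auto
  have cheb: "\<P>(\<omega> in M. x < \<bar>\<Sum>i\<in>{k<..N}. Z i \<omega>\<bar>) \<le> V / x\<^sup>2" if k: "n \<le> k" for k
  proof -
    have sub: "{k<..N} \<subseteq> {n<..N}" using k by auto
    have rv: "random_variable borel (Z i)" if "i \<in> {k<..N}" for i
      using ind that sub by (auto simp: indep_vars_def2)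
    have m: "integrable M (\<lambda>\<omega>. (\<Sum>i\<in>{k<..N}. Z i \<omega>)\<^sup>2)"
      "expectation (\<lambda>\<omega>. (\<Sum>i\<in>{k<..N}. Z i \<omega>)\<^sup>2) = (\<Sum>i\<in>{k<..N}. expectation (\<lambda>\<omega>. (Z i \<omega>)\<^sup>2))"
      using second_moment_sum_indep[OF _ indep_vars_subset[OF ind sub]] sq mean subsetD[OF sub] by blast+
    have [measurable]: "random_variable borel (\<lambda>\<omega>. \<Sum>i\<in>{k<..N}. Z i \<omega>)"
      using rv by (intro borel_measurable_sum) auto
    have "\<P>(\<omega> in M. x < \<bar>\<Sum>i\<in>{k<..N}. Z i \<omega>\<bar>) \<le> \<P>(\<omega> in M. x\<^sup>2 \<le> (\<Sum>i\<in>{k<..N}. Z i \<omega>)\<^sup>2)"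
    proof (intro finite_measure_mono subsetI)
      fix \<omega> assume "\<omega> \<in> {\<omega>\<in>space M. x < \<bar>\<Sum>i\<in>{k<..N}. Z i \<omega>\<bar>}"
      then show "\<omega> \<in> {\<omega>\<in>space M. x\<^sup>2 \<le> (\<Sum>i\<in>{k<..N}. Z i \<omega>)\<^sup>2}"
        using power_mono[of x "\<bar>\<Sum>i\<in>{k<..N}. Z i \<omega>\<bar>" 2] x by simp
    qed measurable
    also have "\<dots> \<le> expectation (\<lambda>\<omega>. (\<Sum>i\<in>{k<..N}. Z i \<omega>)\<^sup>2) / x\<^sup>2"
      by (rule integral_Markov_inequality_measure[OF m(1)]) (use x in auto)
    also have "\<dots> \<le> V / x\<^sup>2"
      unfolding m(2) V_def
      by (intro divide_right_mono order_trans[OF sum_mono[OF var] sum_mono2])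
        (use sub v0 in auto)
    finally show ?thesis .
  qed
  show ?thesis
  proof (cases "V / x\<^sup>2 \<le> 1/2")
    case True
    have "\<P>(\<omega> in M. \<exists>k\<in>{n..N}. 2 * x < \<bar>\<Sum>i\<in>{n<..k}. Z i \<omega>\<bar>)
       \<le> 2 * \<P>(\<omega> in M. x < \<bar>\<Sum>i\<in>{n<..N}. Z i \<omega>\<bar>)"
      by (rule levy_ottaviani[OF ind]) (use x in simp, blast intro: order_trans[OF cheb True])
    then show ?thesis using cheb[of n] by (simp add: V_def)
  next
    case False
    have "\<P>(\<omega> in M. \<exists>k\<in>{n..N}. 2 * x < \<bar>\<Sum>i\<in>{n<..k}. Z i \<omega>\<bar>) \<le> 1" by simp
    also have "1 \<le> 2 * (\<Sum>i\<in>{n<..N}. v i) / x\<^sup>2"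
      using False by (simp add: V_def mult.commute)
    finally show ?thesis .
  qed
qed

definition trunc :: "real \<Rightarrow> real \<Rightarrow> real" where
  "trunc x y = (if \<bar>y\<bar> \<le> x then y else 0)"

lemma trunc_measurable [measurable]: "trunc x \<in> borel_measurable borel"
  unfolding trunc_def[abs_def] by measurable

lemma abs_trunc_le: "0 \<le> x \<Longrightarrow> \<bar>trunc x y\<bar> \<le> x"
  by (auto simp: trunc_def)

lemma (in prob_space) integrable_trunc:
  assumes "random_variable borel Y" "0 \<le> x"
  shows "integrable M (\<lambda>\<omega>. trunc x (Y \<omega>))"
  by (rule integrable_const_bound[where B=x]) (use assms abs_trunc_le in auto)

text \<open>Truncation at the level \<open>x\<close> of the deviation itself: the sums change only if some summand exceeds
\<open>x\<close> (cost \<open>\<Sum> w i\<close>), and the truncated summands have variances at most \<open>x\<^sup>2 w i\<close>, which the \<open>L\<^sup>2\<close>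
bound at level \<open>x/2\<close> turns into \<open>8 \<Sum> w i\<close>.\<close>

lemma (in prob_space) truncated_maximal_inequality:
  fixes X :: "nat \<Rightarrow> 'a \<Rightarrow> real"
  assumes ind: "indep_vars (\<lambda>_. borel) X {n<..N}"
    and x: "0 < x"
    and tail: "\<And>i. i \<in> {n<..N} \<Longrightarrow> \<P>(\<omega> in M. x < \<bar>X i \<omega>\<bar>) \<le> w i"
    and var: "\<And>i. i \<in> {n<..N} \<Longrightarrow> expectation (\<lambda>\<omega>. (trunc x (X i \<omega>))\<^sup>2) \<le> x\<^sup>2 * w i"
    and mean: "\<And>i. i \<in> {n<..N} \<Longrightarrow> \<mu> i = expectation (\<lambda>\<omega>. trunc x (X i \<omega>))"
  shows "\<P>(\<omega> in M. \<exists>k\<in>{n..N}. x < \<bar>\<Sum>i\<in>{n<..k}. (X i \<omega> - \<mu> i)\<bar>) \<le> 9 * (\<Sum>i\<in>{n<..N}. w i)"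
proof -
  define Z where "Z i \<omega> = trunc x (X i \<omega>) - \<mu> i" for i \<omega>
  have rv: "random_variable borel (X i)" if "i \<in> {n<..N}" for i
    using ind that by (auto simp: indep_vars_def2)
  have int: "integrable M (\<lambda>\<omega>. trunc x (X i \<omega>))" if "i \<in> {n<..N}" for i
    using integrable_trunc[OF rv[OF that]] x by simp
  have int2: "integrable M (\<lambda>\<omega>. (trunc x (X i \<omega>))\<^sup>2)" if "i \<in> {n<..N}" for i
    by (rule integrable_const_bound[where B="x\<^sup>2"])
      (use rv[OF that] x abs_trunc_le[of x] in \<open>auto simp: abs_le_square_iff[symmetric]\<close>)
  have indZ: "indep_vars (\<lambda>_. borel) Z {n<..N}"
    using indep_vars_compose2[OF ind, of "\<lambda>i y. trunc x y - \<mu> i" "\<lambda>_. borel"]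
    by (simp add: Z_def[abs_def])
  have sq: "(\<lambda>\<omega>. (Z i \<omega>)\<^sup>2) = (\<lambda>\<omega>. (trunc x (X i \<omega>))\<^sup>2 - 2 * \<mu> i * trunc x (X i \<omega>) + (\<mu> i)\<^sup>2)" for i
    by (auto simp: Z_def power2_diff)
  have Zmax: "\<P>(\<omega> in M. \<exists>k\<in>{n..N}. 2 * (x/2) < \<bar>\<Sum>i\<in>{n<..k}. Z i \<omega>\<bar>)
      \<le> 2 * (\<Sum>i\<in>{n<..N}. x\<^sup>2 * w i) / (x/2)\<^sup>2"
  proof (rule maximal_inequality_L2[OF indZ])
    fix i assume i: "i \<in> {n<..N}"
    show "integrable M (\<lambda>\<omega>. (Z i \<omega>)\<^sup>2)" unfolding sq using int[OF i] int2[OF i] by simp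
    show "expectation (Z i) = 0"
      using int[OF i] mean[OF i] by (simp add: Z_def[abs_def] prob_space)
    have "expectation (\<lambda>\<omega>. (Z i \<omega>)\<^sup>2) = expectation (\<lambda>\<omega>. (trunc x (X i \<omega>))\<^sup>2) - (\<mu> i)\<^sup>2"
      unfolding sq using int[OF i] int2[OF i] mean[OF i] by (simp add: prob_space power2_eq_square)
    also have "\<dots> \<le> x\<^sup>2 * w i" using var[OF i] by (smt (verit) zero_le_power2)
    finally show "expectation (\<lambda>\<omega>. (Z i \<omega>)\<^sup>2) \<le> x\<^sup>2 * w i" .
  qed (use x in auto)
  have eq8: "2 * (\<Sum>i\<in>{n<..N}. x\<^sup>2 * w i) / (x/2)\<^sup>2 = 8 * (\<Sum>i\<in>{n<..N}. w i)"
    using x by (simp add: sum_distrib_left[symmetric] power_divide)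
  define T where "T = (\<Union>i\<in>{n<..N}. {\<omega>\<in>space M. x < \<bar>X i \<omega>\<bar>})"
  define R where "R = {\<omega>\<in>space M. \<exists>k\<in>{n..N}. x < \<bar>\<Sum>i\<in>{n<..k}. Z i \<omega>\<bar>}"
  have Tm: "{\<omega>\<in>space M. x < \<bar>X i \<omega>\<bar>} \<in> events" if "i \<in> {n<..N}" for i
    using rv[OF that] by measurable
  then have T: "T \<in> events" unfolding T_def by auto
  have R: "R \<in> events"
  proof -
    have Sm: "random_variable borel (\<lambda>\<omega>. \<Sum>i\<in>{n<..k}. Z i \<omega>)" if "k \<in> {n..N}" for k
      using indZ that by (intro borel_measurable_sum) (auto simp: indep_vars_def2)
    have "R = (\<Union>k\<in>{n..N}. {\<omega>\<in>space M. x < \<bar>\<Sum>i\<in>{n<..k}. Z i \<omega>\<bar>})" by (auto simp: R_def)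
    also have "\<dots> \<in> events"
    proof (intro sets.finite_UN)
      fix k assume "k \<in> {n..N}"
      note [measurable] = Sm[OF this]
      show "{\<omega> \<in> space M. x < \<bar>\<Sum>i\<in>{n<..k}. Z i \<omega>\<bar>} \<in> events" by measurable
    qed auto
    finally show ?thesis .
  qed
  have "\<P>(\<omega> in M. \<exists>k\<in>{n..N}. x < \<bar>\<Sum>i\<in>{n<..k}. (X i \<omega> - \<mu> i)\<bar>) \<le> prob (T \<union> R)"
  proof (rule finite_measure_mono)
    show "{\<omega>\<in>space M. \<exists>k\<in>{n..N}. x < \<bar>\<Sum>i\<in>{n<..k}. (X i \<omega> - \<mu> i)\<bar>} \<subseteq> T \<union> R"
    proof safe
      fix \<omega> k assume a: "\<omega> \<in> space M" "k \<in> {n..N}" "x < \<bar>\<Sum>i\<in>{n<..k}. (X i \<omega> - \<mu> i)\<bar>" "\<omega> \<notin> R"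
      show "\<omega> \<in> T"
      proof (rule ccontr)
        assume "\<omega> \<notin> T"
        then have "X i \<omega> - \<mu> i = Z i \<omega>" if "i \<in> {n<..k}" for i
          using that a by (auto simp: T_def Z_def trunc_def not_less)
        then have "(\<Sum>i\<in>{n<..k}. (X i \<omega> - \<mu> i)) = (\<Sum>i\<in>{n<..k}. Z i \<omega>)" by (intro sum.cong) auto
        then show False using a by (auto simp: R_def)
      qed
    qed
  qed (use T R in auto)
  also have "\<dots> \<le> prob T + prob R" by (rule measure_Un_le[OF T R])
  also have "prob T \<le> (\<Sum>i\<in>{n<..N}. prob {\<omega>\<in>space M. x < \<bar>X i \<omega>\<bar>})"
    unfolding T_def by (rule finite_measure_subadditive_finite) (use Tm in auto)
  also have "\<dots> \<le> (\<Sum>i\<in>{n<..N}. w i)" by (intro sum_mono tail)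
  also have "prob R \<le> 8 * (\<Sum>i\<in>{n<..N}. w i)"
    using Zmax eq8 by (simp add: R_def)
  finally show ?thesis by simp
qed

section \<open>Truncated moments of variables with power tails\<close>

text \<open>Halving the truncation level costs at most \<open>x\<^sup>r P(\<bar>Y\<bar> > x/2)\<close>, a multiple of \<open>x\<^bsup>r-\<alpha>\<^esup>\<close>.  Since \<open>r > \<alpha>\<close>
these costs decrease geometrically along \<open>x, x/2, x/4, \<dots>\<close> and sum to the stated constant.\<close>

lemma (in prob_space) truncated_moment_bound:
  fixes Y :: "'a \<Rightarrow> real"
  assumes Y [measurable]: "random_variable borel Y"
    and tail: "\<And>t. 0 < t \<Longrightarrow> \<P>(\<omega> in M. t < \<bar>Y \<omega>\<bar>) \<le> Q * t powr - \<alpha>"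
    and \<alpha>: "\<alpha> < r" and r: "0 < r" and Q: "0 \<le> Q"
    and x: "0 < x"
  shows "expectation (\<lambda>\<omega>. \<bar>trunc x (Y \<omega>)\<bar> powr r)
    \<le> Q * 2 powr \<alpha> / (1 - 2 powr (\<alpha> - r)) * x powr (r - \<alpha>)"
proof -
  define m where "m x = expectation (\<lambda>\<omega>. \<bar>trunc x (Y \<omega>)\<bar> powr r)" for x
  define C where "C = Q * 2 powr \<alpha> / (1 - 2 powr (\<alpha> - r))"
  have den: "0 < 1 - 2 powr (\<alpha> - r)"
    using powr_less_mono[of "\<alpha> - r" 0 2] \<alpha> by simp
  have C0: "0 \<le> C" using den Q by (simp add: C_def)
  have "C * (1 - 2 powr (\<alpha> - r)) = Q * 2 powr \<alpha>"
    using den \<alpha> by (simp add: C_def)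
  then have Crec: "C * 2 powr (\<alpha> - r) + Q * 2 powr \<alpha> = C"
    by (simp add: algebra_simps)
  have bound: "\<bar>trunc x y\<bar> powr r \<le> x powr r" if "0 < x" for x y
    using that r by (intro powr_mono2) (auto simp: abs_trunc_le)
  have int: "integrable M (\<lambda>\<omega>. \<bar>trunc x (Y \<omega>)\<bar> powr r)" if "0 < x" for x
    by (rule integrable_const_bound[where B="x powr r"]) (use bound[OF that] in auto)
  have halve: "m x \<le> m (x/2) + Q * 2 powr \<alpha> * x powr (r - \<alpha>)" if x: "0 < x" for x
  proof -
    have "m x \<le> expectation (\<lambda>\<omega>. \<bar>trunc (x/2) (Y \<omega>)\<bar> powr r
        + x powr r * indicator {\<omega>\<in>space M. x/2 < \<bar>Y \<omega>\<bar>} \<omega>)"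
      unfolding m_def
    proof (rule integral_mono)
      show "integrable M (\<lambda>\<omega>. \<bar>trunc (x/2) (Y \<omega>)\<bar> powr r
        + x powr r * indicator {\<omega>\<in>space M. x/2 < \<bar>Y \<omega>\<bar>} \<omega>)"
        using int[of "x/2"] x by (intro Bochner_Integration.integrable_add) (auto simp: integrable_indicator_iff less_top[symmetric])
      fix \<omega> assume "\<omega> \<in> space M"
      then show "\<bar>trunc x (Y \<omega>)\<bar> powr r \<le> \<bar>trunc (x/2) (Y \<omega>)\<bar> powr r
        + x powr r * indicator {\<omega>\<in>space M. x/2 < \<bar>Y \<omega>\<bar>} \<omega>"
        using bound[OF x, of "Y \<omega>"] x
        by (cases "x/2 < \<bar>Y \<omega>\<bar>") (auto simp: trunc_def)
    qed (rule int[OF x])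
    also have "\<dots> = m (x/2) + x powr r * \<P>(\<omega> in M. x/2 < \<bar>Y \<omega>\<bar>)"
      unfolding m_def using int[of "x/2"] x
      by (subst Bochner_Integration.integral_add) (auto simp: integrable_indicator_iff less_top[symmetric])
    also have "\<dots> \<le> m (x/2) + x powr r * (Q * (x/2) powr - \<alpha>)"
      using tail[of "x/2"] x by (intro add_left_mono mult_left_mono) auto
    also have "x powr r * (Q * (x/2) powr - \<alpha>) = Q * 2 powr \<alpha> * x powr (r - \<alpha>)"
      using x by (simp add: powr_divide powr_diff powr_minus field_simps)
    finally show ?thesis .
  qed
  have iter: "m x \<le> C * x powr (r - \<alpha>) + (x / 2 ^ n) powr r" if x: "0 < x" for n x
    using x
  proof (induction n arbitrary: x)
    case 0
    have "m x \<le> expectation (\<lambda>_. x powr r)"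
      unfolding m_def by (intro integral_mono int 0 bound) auto
    moreover have "0 \<le> C * x powr (r - \<alpha>)" using C0 by simp
    ultimately show ?case by (simp add: prob_space)
  next
    case (Suc n)
    have "m x \<le> (C * (x/2) powr (r - \<alpha>) + (x / 2 / 2 ^ n) powr r) + Q * 2 powr \<alpha> * x powr (r - \<alpha>)"
      using halve[OF Suc.prems] Suc.IH[of "x/2"] Suc.prems by simp
    also have "C * (x/2) powr (r - \<alpha>) = C * 2 powr (\<alpha> - r) * x powr (r - \<alpha>)"
      using Suc.prems by (simp add: powr_divide powr_diff field_simps)
    also have "C * 2 powr (\<alpha> - r) * x powr (r - \<alpha>) + (x / 2 / 2 ^ n) powr r + Q * 2 powr \<alpha> * x powr (r - \<alpha>)
       = (C * 2 powr (\<alpha> - r) + Q * 2 powr \<alpha>) * x powr (r - \<alpha>) + (x / 2 ^ Suc n) powr r"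
      by (simp add: algebra_simps)
    finally show ?case unfolding Crec .
  qed
  have "(\<lambda>n. (x / 2 ^ n) powr r) \<longlonglongrightarrow> 0 powr r"
  proof (rule tendsto_powr')
    show "(\<lambda>n. x / 2 ^ n) \<longlonglongrightarrow> 0"
      using LIMSEQ_divide_realpow_zero[of 2 x] by simp
  qed (use r x in auto)
  then have "(\<lambda>n. C * x powr (r - \<alpha>) + (x / 2 ^ n) powr r) \<longlonglongrightarrow> C * x powr (r - \<alpha>) + 0"
    using r by (intro tendsto_intros) auto
  then have "m x \<le> C * x powr (r - \<alpha>) + 0"
    by (rule LIMSEQ_le_const) (use iter[OF x] in auto)
  then show ?thesis by (simp add: m_def C_def)
qed

lemma (in prob_space) truncated_mean_increment:
  fixes Y :: "'a \<Rightarrow> real"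
  assumes Y [measurable]: "random_variable borel Y" and xy: "0 < x" "x \<le> y"
  shows "\<bar>expectation (\<lambda>\<omega>. trunc y (Y \<omega>)) - expectation (\<lambda>\<omega>. trunc x (Y \<omega>))\<bar>
    \<le> y * \<P>(\<omega> in M. x < \<bar>Y \<omega>\<bar>)"
proof -
  note i = integrable_trunc[OF Y, of x] integrable_trunc[OF Y, of y]
  have "\<bar>expectation (\<lambda>\<omega>. trunc y (Y \<omega>)) - expectation (\<lambda>\<omega>. trunc x (Y \<omega>))\<bar>
     = \<bar>expectation (\<lambda>\<omega>. trunc y (Y \<omega>) - trunc x (Y \<omega>))\<bar>"
    using i xy by simp
  also have "\<dots> \<le> expectation (\<lambda>\<omega>. \<bar>trunc y (Y \<omega>) - trunc x (Y \<omega>)\<bar>)"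
    by (rule integral_abs_bound)
  also have "\<dots> \<le> expectation (\<lambda>\<omega>. y * indicator {\<omega>\<in>space M. x < \<bar>Y \<omega>\<bar>} \<omega>)"
  proof (rule integral_mono)
    fix \<omega> assume "\<omega> \<in> space M"
    then show "\<bar>trunc y (Y \<omega>) - trunc x (Y \<omega>)\<bar> \<le> y * indicator {\<omega>\<in>space M. x < \<bar>Y \<omega>\<bar>} \<omega>"
      using xy by (auto simp: trunc_def indicator_def)
  qed (use i xy in \<open>auto simp: integrable_indicator_iff less_top[symmetric]\<close>)
  also have "\<dots> = y * \<P>(\<omega> in M. x < \<bar>Y \<omega>\<bar>)" by simp
  finally show ?thesis .
qed

text \<open>For tail exponent 1 every halving of the level costs the same amount \<open>2 Q\<close>, and about \<open>log\<^sub>2 x\<close>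
halvings reach level 1.\<close>

lemma (in prob_space) truncated_mean_le_log:
  fixes Y :: "'a \<Rightarrow> real"
  assumes Y [measurable]: "random_variable borel Y"
    and tail: "\<And>t. 0 < t \<Longrightarrow> \<P>(\<omega> in M. t < \<bar>Y \<omega>\<bar>) \<le> Q * t powr - 1"
    and Q: "0 \<le> Q" and x: "1 \<le> x"
  shows "\<bar>expectation (\<lambda>\<omega>. trunc x (Y \<omega>))\<bar> \<le> (1 + 4 * Q) * (1 + ln x)"
proof -
  define m where "m x = expectation (\<lambda>\<omega>. trunc x (Y \<omega>))" for x
  have base: "\<bar>m x\<bar> \<le> x" if "0 < x" for x
  proof -
    have "\<bar>m x\<bar> \<le> expectation (\<lambda>\<omega>. \<bar>trunc x (Y \<omega>)\<bar>)" unfolding m_def by (rule integral_abs_bound)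
    also have "\<dots> \<le> expectation (\<lambda>_. x)"
      by (intro integral_mono) (use that abs_trunc_le integrable_trunc[OF Y, of x] in auto)
    finally show ?thesis by (simp add: prob_space)
  qed
  have iter: "\<bar>m x\<bar> \<le> 1 + 2 * Q * n" if "0 < x" "x \<le> 2 ^ n" for n x
    using that
  proof (induction n arbitrary: x)
    case 0
    then show ?case using base[of x] by simp
  next
    case (Suc n)
    have "\<bar>m x - m (x/2)\<bar> \<le> x * (Q * (x/2) powr - 1)"
      unfolding m_def using truncated_mean_increment[OF Y, of "x/2" x] tail[of "x/2"] Suc.prems
      by (smt (verit) field_sum_of_halves mult_left_mono)
    also have "\<dots> = 2 * Q" using Suc.prems by (simp add: powr_minus field_simps)
    finally show ?case using Suc.IH[of "x/2"] Suc.prems by (auto simp: algebra_simps abs_if split: if_splits)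
  qed
  define n where "n = nat \<lceil>log 2 x\<rceil>"
  have "x = 2 powr (log 2 x)" using x by simp
  also have "\<dots> \<le> 2 powr (real n)" unfolding n_def by (intro powr_mono) (auto, linarith)
  finally have "x \<le> 2 ^ n" by (simp add: powr_realpow)
  then have "\<bar>m x\<bar> \<le> 1 + 2 * Q * n" using iter x by simp
  also have "real n \<le> 1 + log 2 x" using x unfolding n_def by (simp add: of_nat_nat zero_le_log_cancel_iff) linarith
  then have "2 * Q * n \<le> 2 * Q * (1 + log 2 x)" using Q by (intro mult_left_mono) auto
  also have "log 2 x \<le> 1 + 2 * ln x"
  proof -
    have "1/2 \<le> ln (2::real)" using ln2_ge_two_thirds by simp
    have "ln x \<le> (2 * ln x) * ln 2"
      using mult_left_mono[OF \<open>1/2 \<le> ln 2\<close>, of "2 * ln x"] x by simp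
    then have "log 2 x \<le> 2 * ln x" unfolding log_def by (simp add: divide_le_eq)
    then show ?thesis by simp
  qed
  then have "2 * Q * (1 + log 2 x) \<le> 2 * Q * (2 + 2 * ln x)" using Q by (intro mult_left_mono) auto
  finally show ?thesis using x Q by (simp add: m_def algebra_simps) (smt (verit) ln_ge_zero mult_nonneg_nonneg)
qed

text \<open>For \<open>\<alpha> > 1\<close> the dyadic steps are summed upwards instead: the truncated mean at \<open>x\<close> is compared with the one
at \<open>2\<^sup>n x\<close>, which vanishes in the limit.\<close>

lemma (in prob_space) truncated_mean_le_of_tendsto_0:
  fixes Y :: "'a \<Rightarrow> real"
  assumes Y [measurable]: "random_variable borel Y"
    and tail: "\<And>t. 0 < t \<Longrightarrow> \<P>(\<omega> in M. t < \<bar>Y \<omega>\<bar>) \<le> Q * t powr - \<alpha>"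
    and lim: "((\<lambda>x. expectation (\<lambda>\<omega>. trunc x (Y \<omega>))) \<longlongrightarrow> 0) at_top"
    and \<alpha>: "1 < \<alpha>" and Q: "0 \<le> Q" and x: "0 < x"
  shows "\<bar>expectation (\<lambda>\<omega>. trunc x (Y \<omega>))\<bar> \<le> 2 * Q / (1 - 2 powr (1 - \<alpha>)) * x powr (1 - \<alpha>)"
proof -
  define m where "m x = expectation (\<lambda>\<omega>. trunc x (Y \<omega>))" for x
  define C where "C = 2 * Q / (1 - 2 powr (1 - \<alpha>))"
  have den: "0 < 1 - 2 powr (1 - \<alpha>)"
    using powr_less_mono[of "1 - \<alpha>" 0 2] \<alpha> by simp
  have C0: "0 \<le> C" using den Q by (simp add: C_def)
  have "C * (1 - 2 powr (1 - \<alpha>)) = 2 * Q"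
    using den \<alpha> by (simp add: C_def)
  then have Crec: "C * 2 powr (1 - \<alpha>) + 2 * Q = C"
    by (simp add: algebra_simps)
  have iter: "\<bar>m (2 ^ n * x) - m x\<bar> \<le> C * x powr (1 - \<alpha>)" if "0 < x" for n x
    using that
  proof (induction n arbitrary: x)
    case 0
    then show ?case using C0 by simp
  next
    case (Suc n)
    have "\<bar>m (2 * x) - m x\<bar> \<le> 2 * x * (Q * x powr - \<alpha>)"
      unfolding m_def using truncated_mean_increment[OF Y, of x "2 * x"] tail[of x] Suc.prems
      by (smt (verit) mult_left_mono)
    also have "\<dots> = 2 * Q * x powr (1 - \<alpha>)"
      using Suc.prems by (simp add: powr_diff powr_minus field_simps)
    finally have 1: "\<bar>m (2 * x) - m x\<bar> \<le> 2 * Q * x powr (1 - \<alpha>)" .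
    have "\<bar>m (2 ^ n * (2 * x)) - m (2 * x)\<bar> \<le> C * (2 * x) powr (1 - \<alpha>)"
      by (rule Suc.IH) (use Suc.prems in auto)
    also have "\<dots> = C * 2 powr (1 - \<alpha>) * x powr (1 - \<alpha>)"
      using Suc.prems by (simp add: powr_mult)
    finally have "\<bar>m (2 ^ n * (2 * x)) - m x\<bar> \<le> (C * 2 powr (1 - \<alpha>) + 2 * Q) * x powr (1 - \<alpha>)"
      using 1 by (simp add: algebra_simps)
    then show ?case unfolding Crec by (simp add: ac_simps)
  qed
  have "filterlim (\<lambda>n. 2 ^ n * x) at_top sequentially"
    using x by real_asymp
  then have "(\<lambda>n. m (2 ^ n * x)) \<longlonglongrightarrow> 0"
    using lim unfolding m_def by (rule filterlim_compose[rotated])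
  then have "(\<lambda>n. \<bar>m (2 ^ n * x) - m x\<bar>) \<longlonglongrightarrow> \<bar>0 - m x\<bar>"
    by (intro tendsto_intros)
  then have "\<bar>0 - m x\<bar> \<le> C * x powr (1 - \<alpha>)"
    by (rule LIMSEQ_le_const2) (use iter[OF x] in auto)
  then show ?thesis by (simp add: m_def C_def)
qed

text \<open>Convergence of distribution functions is known only at continuity points of the limit; as there are only
countably many others, such points exist near both ends of the line.\<close>

lemma weak_conv_m_tight:
  assumes wc: "weak_conv_m \<mu> L" and L: "real_distribution L" and \<eta>: "0 < \<eta>"
    and rd: "\<And>n. real_distribution (\<mu> n)"
  shows "\<exists>R. \<forall>\<^sub>F n in sequentially. measure (\<mu> n) {y. R < \<bar>y\<bar>} < \<eta>"
proof -
  interpret L: real_distribution L by fact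
  have "countable {a. \<not> isCont (cdf L) a}"
    using mono_ctble_discont[of "cdf L"] L.cdf_nondecreasing by (auto simp: mono_def)
  then have pick: "\<exists>a\<in>S. isCont (cdf L) a" if "uncountable S" for S
    using that by (metis (mono_tags, lifting) countable_subset mem_Collect_eq subsetI)
  have conv: "(\<lambda>n. cdf (\<mu> n) a) \<longlonglongrightarrow> cdf L a" if "isCont (cdf L) a" for a
    using wc that by (auto simp: weak_conv_m_def weak_conv_def)
  have "\<forall>\<^sub>F a in at_top. 1 - \<eta>/2 < cdf L a"
    by (rule order_tendstoD(1)[OF L.cdf_lim_at_top_prob]) (use \<eta> in auto)
  then obtain a0 where a0: "\<And>a. a0 \<le> a \<Longrightarrow> 1 - \<eta>/2 < cdf L a" by (auto simp: eventually_at_top_linorder)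
  obtain a where a: "a \<in> {a0<..<a0+1}" "isCont (cdf L) a"
    using pick[of "{a0<..<a0+1}"] by (auto simp: uncountable_open_interval)
  have "\<forall>\<^sub>F b in at_bot. cdf L b < \<eta>/2"
    by (rule order_tendstoD(2)[OF L.cdf_lim_at_bot]) (use \<eta> in auto)
  then obtain b0 where b0: "\<And>b. b \<le> b0 \<Longrightarrow> cdf L b < \<eta>/2" by (auto simp: eventually_at_bot_linorder)
  obtain b where b: "b \<in> {b0-1<..<b0}" "isCont (cdf L) b"
    using pick[of "{b0-1<..<b0}"] by (auto simp: uncountable_open_interval)
  have ev: "\<forall>\<^sub>F n in sequentially. 1 - \<eta>/2 < cdf (\<mu> n) a \<and> cdf (\<mu> n) b < \<eta>/2"
    using a0[of a] b0[of b] a b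
    by (intro eventually_conj order_tendstoD(1)[OF conv[OF a(2)]] order_tendstoD(2)[OF conv[OF b(2)]]) auto
  show ?thesis
  proof (intro exI[of _ "max \<bar>a\<bar> \<bar>b\<bar>"] eventually_mono[OF ev])
    fix n assume n: "1 - \<eta>/2 < cdf (\<mu> n) a \<and> cdf (\<mu> n) b < \<eta>/2"
    interpret N: real_distribution "\<mu> n" by (rule rd)
    have "measure (\<mu> n) {y. max \<bar>a\<bar> \<bar>b\<bar> < \<bar>y\<bar>} \<le> measure (\<mu> n) (- {..a} \<union> {..b})"
      by (intro N.finite_measure_mono) auto
    also have "\<dots> \<le> measure (\<mu> n) (- {..a}) + measure (\<mu> n) {..b}"
      by (intro measure_Un_le) auto
    also have "measure (\<mu> n) (- {..a}) = 1 - cdf (\<mu> n) a"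
      using N.prob_compl[of "{..a}"] by (simp add: cdf_def Compl_eq_Diff_UNIV)
    finally show "measure (\<mu> n) {y. max \<bar>a\<bar> \<bar>b\<bar> < \<bar>y\<bar>} < \<eta>" using n by (simp add: cdf_def)
  qed
qed

section \<open>From the hypotheses on the laws to tails and means\<close>

definition (in prob_space) power_tails :: "real \<Rightarrow> real \<Rightarrow> real \<Rightarrow> real \<Rightarrow> ('a \<Rightarrow> real) \<Rightarrow> bool" where
  "power_tails \<alpha> Q b x0 Y \<longleftrightarrow>
    (\<forall>x>0. \<P>(\<omega> in M. x < \<bar>Y \<omega>\<bar>) \<le> Q * x powr - \<alpha>) \<and>
    (\<forall>x\<ge>x0. b * x powr - \<alpha> \<le> \<P>(\<omega> in M. x \<le> Y \<omega>)) \<and>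
    (\<forall>x\<ge>x0. b * x powr - \<alpha> \<le> \<P>(\<omega> in M. Y \<omega> \<le> - x))"

text \<open>The bounds hold for every variable with distribution function \<open>H\<close>, with the same constants; this
uniformity is what the sums over many summands need.  Below the threshold \<open>x0\<close> the upper bound is the trivial
one, absorbed in the constant.\<close>

lemma (in prob_space) power_tail_bounds:
  fixes H \<theta> \<beta> :: "real \<Rightarrow> real"
  assumes \<alpha>: "0 < \<alpha>" and c: "0 < c1" "0 < c2"
    and right: "\<And>x. 0 < x \<Longrightarrow> 1 - H x = (c1 + \<theta> x) / x powr \<alpha>"
    and left: "\<And>x. 0 < x \<Longrightarrow> H (- x) = (c2 + \<beta> (- x)) / x powr \<alpha>"
    and \<theta>: "(\<theta> \<longlongrightarrow> 0) at_top" and \<beta>: "((\<lambda>x. \<beta> (- x)) \<longlongrightarrow> 0) at_top"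
  obtains Q b x0 where "0 < Q" "0 < b"
    and "\<And>Y. random_variable borel Y \<Longrightarrow> cdf (distr M borel Y) = H \<Longrightarrow> power_tails \<alpha> Q b x0 Y"
proof -
  define b where "b = min c1 c2 / 2"
  have b: "0 < b" using c by (simp add: b_def)
  have "\<forall>\<^sub>F x in at_top. \<bar>\<theta> x\<bar> < b \<and> \<bar>\<beta> (- x)\<bar> < b"
    using tendstoD[OF \<theta> b] tendstoD[OF \<beta> b] by eventually_elim simp
  then obtain z where z: "\<And>x. z \<le> x \<Longrightarrow> \<bar>\<theta> x\<bar> < b" "\<And>x. z \<le> x \<Longrightarrow> \<bar>\<beta> (- x)\<bar> < b"
    by (auto simp: eventually_at_top_linorder)
  define x0 where "x0 = max z 1"
  have x0: "0 < x0" by (simp add: x0_def)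
  define Q where "Q = max (c1 + c2 + 2 * b) (x0 powr \<alpha>)"
  have cdf: "prob {\<omega>\<in>space M. Y \<omega> \<le> x} = H x"
    if [measurable]: "random_variable borel Y" and "cdf (distr M borel Y) = H" for Y x
    using that(2)[symmetric] by (simp add: cdf_def measure_distr vimage_def Int_def conj_commute)
  have cdf': "prob {\<omega>\<in>space M. x < Y \<omega>} = 1 - H x"
    if Y [measurable]: "random_variable borel Y" and H: "cdf (distr M borel Y) = H" for Y x
  proof -
    have "{\<omega>\<in>space M. x < Y \<omega>} = space M - {\<omega>\<in>space M. Y \<omega> \<le> x}" by auto
    then show ?thesis by (simp add: prob_compl cdf[OF Y H])
  qed
  show ?thesis
  proof (rule that[OF _ b])
    show "0 < Q" using c b by (simp add: Q_def)
    fix Y :: "'a \<Rightarrow> real" assume Y [measurable]: "random_variable borel Y" and H: "cdf (distr M borel Y) = H"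
    show "power_tails \<alpha> Q b x0 Y"
      unfolding power_tails_def
    proof (intro conjI allI impI)
      fix x :: real
      assume x: "0 < x"
      show "\<P>(\<omega> in M. x < \<bar>Y \<omega>\<bar>) \<le> Q * x powr - \<alpha>"
      proof (cases "x0 \<le> x")
        case True
        have "\<P>(\<omega> in M. x < \<bar>Y \<omega>\<bar>) \<le> prob ({\<omega>\<in>space M. x < Y \<omega>} \<union> {\<omega>\<in>space M. Y \<omega> \<le> - x})"
          by (intro finite_measure_mono) auto
        also have "\<dots> \<le> prob {\<omega>\<in>space M. x < Y \<omega>} + prob {\<omega>\<in>space M. Y \<omega> \<le> - x}"
          by (intro measure_Un_le) auto
        also have "\<dots> = (c1 + \<theta> x + (c2 + \<beta> (- x))) * x powr - \<alpha>"
          using x by (simp add: cdf[OF Y H] cdf'[OF Y H] right left powr_minus_divide add_divide_distrib algebra_simps)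
        also have "\<dots> \<le> Q * x powr - \<alpha>"
          using z[of x] True unfolding Q_def x0_def by (intro mult_right_mono) (auto simp: abs_less_iff)
        finally show ?thesis .
      next
        case False
        have "\<P>(\<omega> in M. x < \<bar>Y \<omega>\<bar>) \<le> 1" by simp
        also have "1 = x powr \<alpha> * x powr - \<alpha>" using x by (simp add: powr_add[symmetric])
        also have "\<dots> \<le> Q * x powr - \<alpha>"
          using False x \<alpha> unfolding Q_def by (intro mult_right_mono max.coboundedI2 powr_mono2) auto
        finally show ?thesis .
      qed
    next
      fix x :: real
      assume x: "x0 \<le> x"
      have "b * x powr - \<alpha> \<le> (c1 + \<theta> x) * x powr - \<alpha>"
        using z(1)[of x] x c by (intro mult_right_mono) (auto simp: x0_def b_def abs_less_iff min_def split: if_splits)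
      also have "\<dots> = \<P>(\<omega> in M. x < Y \<omega>)"
        using right[of x] x x0 by (simp add: cdf'[OF Y H] powr_minus_divide)
      also have "\<dots> \<le> \<P>(\<omega> in M. x \<le> Y \<omega>)" by (intro finite_measure_mono) auto
      finally show "b * x powr - \<alpha> \<le> \<P>(\<omega> in M. x \<le> Y \<omega>)" .
    next
      fix x :: real
      assume x: "x0 \<le> x"
      have "b * x powr - \<alpha> \<le> (c2 + \<beta> (- x)) * x powr - \<alpha>"
        using z(2)[of x] x c by (intro mult_right_mono) (auto simp: x0_def b_def abs_less_iff min_def split: if_splits)
      also have "\<dots> = \<P>(\<omega> in M. Y \<omega> \<le> - x)"
        using left[of x] x x0 by (simp add: cdf[OF Y H] powr_minus_divide)
      finally show "b * x powr - \<alpha> \<le> \<P>(\<omega> in M. Y \<omega> \<le> - x)" .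
    qed
  qed
qed

text \<open>Convergence in law of the sums over \<open>J\<close>, normalized by \<open>m\<^bsup>1/\<alpha>\<^esup>\<close> without centering, forces
mean zero when \<open>\<alpha> > 1\<close>.  With \<open>m\<close> summands and \<open>x = \<epsilon> m\<close>, the sum is within \<open>x\<close> of \<open>m g(x)\<close> by the
maximal inequality and within \<open>x\<close> of 0 by tightness, each with probability above one half;
hence \<open>\<bar>g(\<epsilon> m)\<bar> \<le> 2 \<epsilon>\<close>.  The remaining levels lie between consecutive multiples of \<open>\<epsilon>\<close>.\<close>

lemma (in prob_space) truncated_mean_tendsto_0:
  fixes X :: "nat \<Rightarrow> 'a \<Rightarrow> real" and J :: "nat set"
  defines "I \<equiv> \<lambda>n. {k\<in>{1..n}. k \<in> J}"
  assumes ind: "indep_vars (\<lambda>_. borel) X {1..}"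
    and top: "filterlim (\<lambda>n. card (I n)) at_top sequentially"
    and tail: "\<And>k t. 1 \<le> k \<Longrightarrow> k \<in> J \<Longrightarrow> 0 < t \<Longrightarrow> \<P>(\<omega> in M. t < \<bar>X k \<omega>\<bar>) \<le> Q * t powr - \<alpha>"
    and \<alpha>: "1 < \<alpha>" and Q: "0 < Q"
    and var: "\<And>k t. 1 \<le> k \<Longrightarrow> k \<in> J \<Longrightarrow> 0 < t \<Longrightarrow>
      expectation (\<lambda>\<omega>. (trunc t (X k \<omega>))\<^sup>2) \<le> Q * t powr (2 - \<alpha>)"
    and mean: "\<And>k t. 1 \<le> k \<Longrightarrow> k \<in> J \<Longrightarrow> 0 < t \<Longrightarrow> expectation (\<lambda>\<omega>. trunc t (X k \<omega>)) = g t"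
    and wc: "weak_conv_m (\<lambda>n. distr M borel (\<lambda>\<omega>. (\<Sum>k\<in>I n. X k \<omega>) / real (card (I n)) powr (1 / \<alpha>))) L"
    and L: "real_distribution L"
  shows "(g \<longlongrightarrow> 0) at_top"
proof -
  define c where "c n = card (I n)" for n
  define U where "U n \<omega> = (\<Sum>k\<in>I n. X k \<omega>)" for n \<omega>
  have ctop: "filterlim c at_top sequentially" using top by (simp add: c_def[abs_def])
  have rctop: "filterlim (\<lambda>n. real (c n)) at_top sequentially"
    by (rule filterlim_compose[OF filterlim_real_sequentially ctop])
  have rvX: "random_variable borel (X k)" if "1 \<le> k" for k
    using ind that by (auto simp: indep_vars_def2)
  have [measurable]: "random_variable borel (U n)" for n
    unfolding U_def[abs_def] I_def by (intro borel_measurable_sum rvX) auto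
  have c_Suc: "c (Suc n) \<le> Suc (c n)" for n
  proof -
    have "I (Suc n) \<subseteq> insert (Suc n) (I n)" unfolding I_def by (auto simp: le_Suc_eq)
    then have "c (Suc n) \<le> card (insert (Suc n) (I n))" unfolding c_def by (intro card_mono) (auto simp: I_def)
    also have "\<dots> \<le> Suc (c n)" unfolding c_def by (rule card_insert_le_m1) auto
    finally show ?thesis .
  qed
  have c_mono: "mono c"
    unfolding c_def[abs_def] I_def by (intro monoI card_mono) auto
  obtain R where R: "\<forall>\<^sub>F n in sequentially.
      measure (distr M borel (\<lambda>\<omega>. U n \<omega> / real (c n) powr (1 / \<alpha>))) {y. R < \<bar>y\<bar>} < 1/2"
  proof -
    have "real_distribution (distr M borel (\<lambda>\<omega>. U n \<omega> / real (c n) powr (1 / \<alpha>)))" for n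
      by (intro real_distribution_distr) measurable
    from weak_conv_m_tight[OF wc[folded c_def U_def] L _ this, of "1/2"] that show ?thesis by auto
  qed
  have mean_grid: "\<forall>\<^sub>F n in sequentially. \<bar>g (\<epsilon> * real (c n))\<bar> \<le> 2 * \<epsilon>" if \<epsilon>: "0 < \<epsilon>" for \<epsilon>
  proof -
    have "((\<lambda>z. 9 * (Q * (z * (\<epsilon> * z) powr - \<alpha>))) \<longlongrightarrow> 0) at_top" using \<alpha> \<epsilon> by real_asymp
    from order_tendstoD(2)[OF filterlim_compose[OF this rctop], of "1/2"]
    have e1: "\<forall>\<^sub>F n in sequentially. 9 * (Q * (real (c n) * (\<epsilon> * real (c n)) powr - \<alpha>)) < 1/2" by simp
    have "\<forall>\<^sub>F z in at_top. R * z powr (1 / \<alpha>) \<le> \<epsilon> * z" using \<alpha> \<epsilon> by real_asymp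
    from eventually_compose_filterlim[OF this rctop]
    have e2: "\<forall>\<^sub>F n in sequentially. R * real (c n) powr (1 / \<alpha>) \<le> \<epsilon> * real (c n)" .
    have e3: "\<forall>\<^sub>F n in sequentially. 1 \<le> c n" using ctop by (simp add: filterlim_at_top)
    show ?thesis using e1 e2 e3 R
    proof eventually_elim
      case (elim n)
      define x where "x = \<epsilon> * real (c n)"
      have x: "0 < x" using elim \<epsilon> by (simp add: x_def)
      define Y where "Y k \<omega> = (if k \<in> J then X k \<omega> else 0)" for k \<omega>
      define A where "A = {\<omega>\<in>space M. \<exists>m\<in>{0..n}. x < \<bar>\<Sum>k\<in>{0<..m}. (Y k \<omega> - (if k \<in> J then g x else 0))\<bar>}"
      define A' where "A' = {\<omega>\<in>space M. x < \<bar>U n \<omega>\<bar>}"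
      have sumI: "(\<Sum>k\<in>{0<..n}. if k \<in> J then h k else 0) = (\<Sum>k\<in>I n. h k)" for h :: "nat \<Rightarrow> real"
        unfolding I_def by (rule sum.mono_neutral_cong_right) auto
      have "prob A \<le> 9 * (\<Sum>k\<in>{0<..n}. if k \<in> J then Q * x powr - \<alpha> else 0)"
        unfolding A_def
      proof (rule truncated_maximal_inequality[OF _ x])
        have "indep_vars (\<lambda>_. borel) (\<lambda>k \<omega>. (if k \<in> J then X k \<omega> else 0)) {1..}"
          using indep_vars_compose2[OF ind, of "\<lambda>k y. if k \<in> J then y else 0" "\<lambda>_. borel"] by simp
        then show "indep_vars (\<lambda>_. borel) Y {0<..n}"
          unfolding Y_def[abs_def] by (rule indep_vars_subset) auto
        fix k assume "k \<in> {0<..n}"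
        then have k: "1 \<le> k" by auto
        show "\<P>(\<omega> in M. x < \<bar>Y k \<omega>\<bar>) \<le> (if k \<in> J then Q * x powr - \<alpha> else 0)"
          using tail[OF k _ x] x by (auto simp: Y_def)
        show "expectation (\<lambda>\<omega>. (trunc x (Y k \<omega>))\<^sup>2) \<le> x\<^sup>2 * (if k \<in> J then Q * x powr - \<alpha> else 0)"
        proof (cases "k \<in> J")
          case True
          then show ?thesis
            using var[OF k True x] x by (simp add: Y_def powr_diff powr_minus field_simps)
        qed (simp add: Y_def trunc_def)
        show "(if k \<in> J then g x else 0) = expectation (\<lambda>\<omega>. trunc x (Y k \<omega>))"
        proof (cases "k \<in> J")
          case True
          then show ?thesis using mean[OF k True x] by (simp add: Y_def)
        qed (simp add: Y_def trunc_def)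
      qed
      also have "\<dots> = 9 * (Q * (real (c n) * x powr - \<alpha>))"
        unfolding sumI by (simp add: c_def)
      also have "\<dots> < 1/2" using elim by (simp add: x_def)
      finally have PA: "prob A < 1/2" .
      have "A' \<subseteq> {\<omega>\<in>space M. R < \<bar>U n \<omega> / real (c n) powr (1 / \<alpha>)\<bar>}"
      proof
        fix \<omega> assume "\<omega> \<in> A'"
        then have "R * real (c n) powr (1 / \<alpha>) < \<bar>U n \<omega>\<bar>" "\<omega> \<in> space M"
          using elim by (auto simp: A'_def x_def)
        then show "\<omega> \<in> {\<omega>\<in>space M. R < \<bar>U n \<omega> / real (c n) powr (1 / \<alpha>)\<bar>}"
          using elim by (simp add: abs_divide less_divide_eq)
      qed
      then have "prob A' \<le> prob {\<omega>\<in>space M. R < \<bar>U n \<omega> / real (c n) powr (1 / \<alpha>)\<bar>}"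
        by (intro finite_measure_mono) auto
      also have "\<dots> = measure (distr M borel (\<lambda>\<omega>. U n \<omega> / real (c n) powr (1 / \<alpha>))) {y. R < \<bar>y\<bar>}"
        by (subst measure_distr) (auto intro!: arg_cong[where f=prob])
      finally have PA': "prob A' < 1/2" using elim by simp
      have Am: "A \<in> events" "A' \<in> events"
      proof -
        have [measurable]: "random_variable borel (\<lambda>\<omega>. \<Sum>k\<in>{0<..m}. (Y k \<omega> - (if k \<in> J then g x else 0)))" for m
        proof (intro borel_measurable_sum borel_measurable_diff)
          fix k assume "k \<in> {0<..m}"
          then show "random_variable borel (Y k)"
            using rvX[of k] by (cases "k \<in> J") (auto simp: Y_def[abs_def])
        qed auto
        show "A \<in> events" unfolding A_def by measurable
        show "A' \<in> events" unfolding A'_def by measurable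
      qed
      have "prob (A \<union> A') < 1" using measure_Un_le[OF Am] PA PA' by linarith
      then have "A \<union> A' \<noteq> space M" using prob_space by auto
      moreover have "A \<union> A' \<subseteq> space M" by (auto simp: A_def A'_def)
      ultimately obtain \<omega> where \<omega>: "\<omega> \<in> space M" "\<omega> \<notin> A" "\<omega> \<notin> A'" by blast
      have "\<bar>\<Sum>k\<in>{0<..n}. (Y k \<omega> - (if k \<in> J then g x else 0))\<bar> \<le> x"
        using \<omega> by (auto simp: A_def not_less)
      also have "(\<Sum>k\<in>{0<..n}. (Y k \<omega> - (if k \<in> J then g x else 0))) = U n \<omega> - real (c n) * g x"
        by (simp add: sum_subtractf Y_def sumI U_def c_def)
      finally have "\<bar>U n \<omega> - real (c n) * g x\<bar> \<le> x" .
      moreover have "\<bar>U n \<omega>\<bar> \<le> x" using \<omega> by (auto simp: A'_def not_less)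
      ultimately have "\<bar>real (c n) * g x\<bar> \<le> 2 * x" by linarith
      then have "real (c n) * \<bar>g x\<bar> \<le> real (c n) * (2 * \<epsilon>)" by (simp add: abs_mult x_def ac_simps)
      then show ?case using elim by (simp add: x_def)
    qed
  qed
  show ?thesis
  proof (rule tendstoI)
    fix r :: real assume r: "0 < r"
    define \<epsilon> where "\<epsilon> = r / 4"
    have \<epsilon>: "0 < \<epsilon>" using r by (simp add: \<epsilon>_def)
    obtain n0 where n0: "\<And>n. n0 \<le> n \<Longrightarrow> \<bar>g (\<epsilon> * real (c n))\<bar> \<le> 2 * \<epsilon>"
      using mean_grid[OF \<epsilon>] by (auto simp: eventually_sequentially)
    have hit: "\<bar>g (\<epsilon> * real m)\<bar> \<le> 2 * \<epsilon>" if m: "c n0 < m" for m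
    proof -
      have ex: "\<exists>n. m \<le> c n" using ctop by (auto simp: filterlim_at_top eventually_sequentially)
      define n where "n = (LEAST n. m \<le> c n)"
      have n: "m \<le> c n" unfolding n_def by (rule LeastI_ex[OF ex])
      have "n0 < n" using n m monoD[OF c_mono, of n n0] by linarith
      then obtain n' where n': "n = Suc n'" by (cases n) auto
      then have "\<not> m \<le> c n'" using not_less_Least[of n' "\<lambda>n. m \<le> c n"] by (simp add: n_def)
      then have "c n = m" using n c_Suc[of n'] n' by simp
      then show ?thesis using n0[of n] \<open>n0 < n\<close> by simp
    qed
    obtain k where k: "1 \<le> k" "k \<in> J"
    proof -
      obtain n where "1 \<le> c n" using ctop by (auto simp: filterlim_at_top eventually_sequentially)
      then have "I n \<noteq> {}" by (auto simp: c_def)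
      then show ?thesis using that by (auto simp: I_def)
    qed
    have "((\<lambda>y. 2 * Q * y powr (1 - \<alpha>)) \<longlongrightarrow> 0) at_top" using \<alpha> by real_asymp
    then have "\<forall>\<^sub>F y in at_top. 2 * Q * y powr (1 - \<alpha>) < \<epsilon>" by (rule order_tendstoD(2)) (rule \<epsilon>)
    then show "\<forall>\<^sub>F y in at_top. dist (g y) 0 < r"
      using eventually_gt_at_top[of "\<epsilon> * (real (c n0) + 1)"] eventually_ge_at_top[of \<epsilon>]
    proof eventually_elim
      case (elim y)
      have y: "0 < y" using elim \<epsilon> by simp
      define m where "m = nat \<lceil>y / \<epsilon>\<rceil>"
      have m: "real m = of_int \<lceil>y / \<epsilon>\<rceil>" unfolding m_def using y \<epsilon> by simp
      have "y / \<epsilon> \<le> real m" "real m \<le> y / \<epsilon> + 1" unfolding m by linarith+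
      then have ym: "y \<le> \<epsilon> * real m" "\<epsilon> * real m \<le> y + \<epsilon>" using \<epsilon> by (simp_all add: field_simps)
      have "\<epsilon> * (real (c n0) + 1) < \<epsilon> * real m" using elim(2) ym(1) by linarith
      then have "c n0 < m" using \<epsilon> by simp
      then have 1: "\<bar>g (\<epsilon> * real m)\<bar> \<le> 2 * \<epsilon>" by (rule hit)
      have "\<bar>g (\<epsilon> * real m) - g y\<bar> \<le> \<epsilon> * real m * \<P>(\<omega> in M. y < \<bar>X k \<omega>\<bar>)"
        using truncated_mean_increment[OF rvX[OF k(1)] y ym(1)] mean[OF k] y ym by simp
      also have "\<dots> \<le> (2 * y) * (Q * y powr - \<alpha>)"
      proof (rule mult_mono)
        show "\<epsilon> * real m \<le> 2 * y" using ym elim(3) by linarith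
        show "\<P>(\<omega> in M. y < \<bar>X k \<omega>\<bar>) \<le> Q * y powr - \<alpha>" by (rule tail[OF k y])
      qed (use y in auto)
      also have "\<dots> = 2 * Q * y powr (1 - \<alpha>)"
        using y by (simp add: powr_diff powr_minus field_simps)
      finally have "\<bar>g (\<epsilon> * real m) - g y\<bar> \<le> \<epsilon>" using elim(1) by linarith
      then have "\<bar>g y\<bar> \<le> 3 * \<epsilon>" using 1 by linarith
      then show ?case using r by (simp add: \<epsilon>_def)
    qed
  qed
qed

section \<open>Summability along powers of two\<close>

text \<open>Of the terms up to \<open>k\<close>, all but a fixed number lie in a tail of the series with small sum, and each of them
is at least \<open>u k\<close>.\<close>

lemma decseq_summable_imp_linear_decay:
  fixes u :: "nat \<Rightarrow> real"
  assumes dec: "decseq u" and pos: "\<And>k. 0 \<le> u k" and sum: "summable u"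
  shows "(\<lambda>k. real (Suc k) * u k) \<longlonglongrightarrow> 0"
proof (rule LIMSEQ_I)
  fix r :: real assume r: "0 < r"
  obtain n0 where n0: "\<And>m n. n0 \<le> m \<Longrightarrow> norm (sum u {m..<n}) < r/2"
    using summable_Cauchy[THEN iffD1, OF sum, rule_format, of "r/2"] r by auto
  have "(\<lambda>k. real n0 * u k) \<longlonglongrightarrow> real n0 * 0"
    by (intro tendsto_intros summable_LIMSEQ_zero[OF sum])
  then have "\<forall>\<^sub>F k in sequentially. real n0 * u k < r/2"
    by (rule order_tendstoD(2)) (use r in simp)
  then obtain n1 where n1: "\<And>k. n1 \<le> k \<Longrightarrow> real n0 * u k < r/2" by (auto simp: eventually_sequentially)
  show "\<exists>no. \<forall>k\<ge>no. norm (real (Suc k) * u k - 0) < r"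
  proof (intro exI[of _ "max n0 n1"] allI impI)
    fix k assume k: "max n0 n1 \<le> k"
    have "real (Suc k - n0) * u k = (\<Sum>l\<in>{n0..<Suc k}. u k)" by simp
    also have "\<dots> \<le> (\<Sum>l\<in>{n0..<Suc k}. u l)"
      by (intro sum_mono decseqD[OF dec]) auto
    also have "\<dots> < r/2" using n0[of n0 "Suc k"] by (simp add: abs_less_iff)
    finally have "real (Suc k) * u k < r/2 + real n0 * u k"
      using k by (simp add: of_nat_diff algebra_simps)
    then show "norm (real (Suc k) * u k - 0) < r"
      using n1[of k] k pos[of k] by (simp add: abs_mult)
  qed
qed

text \<open>Up to constants, the weights \<open>w k\<close> bound the probabilities in the Borel-Cantelli sum; the two limits control a
logarithmic drift at level \<open>2\<^sup>k F k\<close>.  In the first case \<open>w k \<le> 1 / F k\<close>; in the second,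
\<open>F k \<ge> k + 1\<close> eventually and \<open>w k\<close> is dominated by the convergent series \<open>\<Sum> k\<^bsup>-(\<mu>+r)\<^esup>\<close>.\<close>

lemma dyadic_weights:
  fixes F :: "nat \<Rightarrow> real"
  assumes pos: "\<And>k. 0 < F k" and inc: "incseq F" and sum: "summable (\<lambda>k. 1 / F k)"
    and r: "0 < r" and \<mu>: "0 \<le> \<mu>"
    and cases: "(1 \<le> r \<and> \<mu> = 0) \<or> 1 < \<mu> + r"
  defines "w \<equiv> \<lambda>k. real (Suc k) powr - \<mu> * F k powr - r"
  shows "summable w" and "(\<lambda>k. real (Suc k) * w k) \<longlonglongrightarrow> 0" and "(\<lambda>k. ln (F k) * w k) \<longlonglongrightarrow> 0"
proof -
  have dec: "decseq (\<lambda>k. 1 / F k)"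
    using inc pos by (auto simp: decseq_def incseq_def intro!: divide_left_mono mult_pos_pos)
  have lin: "(\<lambda>k. real (Suc k) * (1 / F k)) \<longlonglongrightarrow> 0"
    by (rule decseq_summable_imp_linear_decay[OF dec _ sum]) (use pos in \<open>auto intro: less_imp_le\<close>)
  have ev: "\<forall>\<^sub>F k in sequentially. real (Suc k) \<le> F k"
    using order_tendstoD(2)[OF lin zero_less_one] by eventually_elim (use pos in \<open>auto simp: field_simps\<close>)
  have top: "filterlim F at_top sequentially"
    by (rule filterlim_at_top_mono[OF _ ev]) real_asymp
  have w0: "0 \<le> w k" for k by (simp add: w_def)
  have "summable w \<and> (\<lambda>k. real (Suc k) * w k) \<longlonglongrightarrow> 0"
    using cases
  proof
    assume c: "1 \<le> r \<and> \<mu> = 0"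
    have le: "\<forall>\<^sub>F k in sequentially. w k \<le> 1 / F k"
      using ev
    proof eventually_elim
      case (elim k)
      have "F k powr - r \<le> F k powr - 1" using elim c by (intro powr_mono) auto
      then show ?case using c pos[of k] by (simp add: w_def powr_minus_divide)
    qed
    have "summable w"
      by (rule summable_comparison_test_ev[OF _ sum]) (use le w0 in \<open>auto elim: eventually_mono\<close>)
    moreover have "(\<lambda>k. real (Suc k) * w k) \<longlonglongrightarrow> 0"
    proof (rule tendsto_sandwich[OF _ _ tendsto_const lin])
      show "\<forall>\<^sub>F k in sequentially. real (Suc k) * w k \<le> real (Suc k) * (1 / F k)"
        using le by eventually_elim (intro mult_left_mono, auto)
    qed (use w0 in auto)
    ultimately show ?thesis ..
  next
    assume c: "1 < \<mu> + r"
    have le: "\<forall>\<^sub>F k in sequentially. w k \<le> real (Suc k) powr - (\<mu> + r)"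
      using ev
    proof eventually_elim
      case (elim k)
      have "F k powr - r \<le> real (Suc k) powr - r"
        using elim r by (intro powr_mono2') auto
      then have "w k \<le> real (Suc k) powr - \<mu> * real (Suc k) powr - r"
        unfolding w_def by (intro mult_left_mono) auto
      then show ?case by (simp add: powr_add[symmetric])
    qed
    have "summable (\<lambda>k. real k powr - (\<mu> + r))" using c by (subst summable_real_powr_iff) auto
    then have s: "summable (\<lambda>k. real (Suc k) powr - (\<mu> + r))" by (subst summable_Suc_iff)
    have "summable w"
      by (rule summable_comparison_test_ev[OF _ s]) (use le w0 in \<open>auto elim: eventually_mono\<close>)
    moreover have "(\<lambda>k. real (Suc k) * w k) \<longlonglongrightarrow> 0"
    proof (rule tendsto_sandwich[OF _ _ tendsto_const])
      show "\<forall>\<^sub>F k in sequentially. real (Suc k) * w k \<le> real (Suc k) * real (Suc k) powr - (\<mu> + r)"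
        using le by eventually_elim (intro mult_left_mono, auto)
      show "(\<lambda>k. real (Suc k) * real (Suc k) powr - (\<mu> + r)) \<longlonglongrightarrow> 0"
        using c by real_asymp
    qed (use w0 in auto)
    ultimately show ?thesis ..
  qed
  then show "summable w" "(\<lambda>k. real (Suc k) * w k) \<longlonglongrightarrow> 0" by auto
  have "((\<lambda>x. ln x * x powr - r) \<longlongrightarrow> 0) at_top" using r by real_asymp
  then have lim: "(\<lambda>k. ln (F k) * F k powr - r) \<longlonglongrightarrow> 0"
    by (rule filterlim_compose[OF _ top])
  show "(\<lambda>k. ln (F k) * w k) \<longlonglongrightarrow> 0"
  proof (rule tendsto_sandwich[OF _ _ tendsto_const lim])
    show "\<forall>\<^sub>F k in sequentially. 0 \<le> ln (F k) * w k"
      using ev by eventually_elim (use w0 in auto)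
    show "\<forall>\<^sub>F k in sequentially. ln (F k) * w k \<le> ln (F k) * F k powr - r"
      using ev
    proof eventually_elim
      case (elim k)
      have "real (Suc k) powr - \<mu> \<le> 1" using powr_mono[of "- \<mu>" 0 "real (Suc k)"] \<mu> by simp
      then have "w k \<le> F k powr - r" unfolding w_def by (simp add: mult_left_le_one_le)
      then show ?case using elim by (intro mult_left_mono) auto
    qed
  qed
qed

section \<open>Sequences with two kinds of power tails\<close>

text \<open>Upper bounds on the summands with one constant \<open>Q\<close> for all of them; the matching lower bounds on the tails
concern only the divergent case and are hypotheses there.  \<open>ty k\<close> is the type of \<open>X k\<close>, and \<open>drift j\<close> is the truncated mean common to the summands of type \<open>j\<close>.  The bound on
the drift is the usual \<open>x\<^bsup>1-\<alpha>\<^esup>\<close> except at the exponent 1.\<close>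

locale two_type_sequence = prob_space M for M :: "'a measure" +
  fixes X :: "nat \<Rightarrow> 'a \<Rightarrow> real" and ty :: "nat \<Rightarrow> nat" and \<alpha> :: "nat \<Rightarrow> real"
    and drift :: "nat \<Rightarrow> real \<Rightarrow> real" and Q :: real
  assumes indep: "indep_vars (\<lambda>_. borel) X {1..}"
    and ty: "\<And>k. 1 \<le> k \<Longrightarrow> ty k \<in> {1, 2}"
    and \<alpha>_pos: "\<And>j. j \<in> {1, 2} \<Longrightarrow> 0 < \<alpha> j"
    and \<alpha>_neq: "\<alpha> 1 \<noteq> \<alpha> 2"
    and Q_pos: "0 < Q"
    and tail: "\<And>k x. 1 \<le> k \<Longrightarrow> 0 < x \<Longrightarrow> \<P>(\<omega> in M. x < \<bar>X k \<omega>\<bar>) \<le> Q * x powr - \<alpha> (ty k)"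
    and var: "\<And>k x. 1 \<le> k \<Longrightarrow> 0 < x \<Longrightarrow>
      expectation (\<lambda>\<omega>. (trunc x (X k \<omega>))\<^sup>2) \<le> Q * x powr (2 - \<alpha> (ty k))"
    and drift: "\<And>k x. 1 \<le> k \<Longrightarrow> 0 < x \<Longrightarrow> expectation (\<lambda>\<omega>. trunc x (X k \<omega>)) = drift (ty k) x"
    and drift_le: "\<And>j x. j \<in> {1, 2} \<Longrightarrow> \<alpha> j \<noteq> 1 \<Longrightarrow> 0 < x \<Longrightarrow> \<bar>drift j x\<bar> \<le> Q * x powr (1 - \<alpha> j)"
    and drift_le_ln: "\<And>j x. j \<in> {1, 2} \<Longrightarrow> \<alpha> j = 1 \<Longrightarrow> 1 \<le> x \<Longrightarrow> \<bar>drift j x\<bar> \<le> Q * (1 + ln x)"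
begin

definition cnt :: "nat \<Rightarrow> nat \<Rightarrow> nat" where
  "cnt j n = card {k \<in> {1..n}. ty k = j}"

lemma cnt_0 [simp]: "cnt j 0 = 0" by (simp add: cnt_def)

lemma cnt_Suc: "cnt j (Suc n) = cnt j n + (if ty (Suc n) = j then 1 else 0)"
proof -
  have "{k \<in> {1..Suc n}. ty k = j} = (if ty (Suc n) = j then {Suc n} else {}) \<union> {k \<in> {1..n}. ty k = j}"
    by (auto simp: le_Suc_eq)
  then show ?thesis by (simp add: cnt_def)
qed

lemma mono_cnt: "mono (cnt j)"
  by (rule monoI, rule lift_Suc_mono_le) (auto simp: cnt_Suc)

lemma cnt_le: "cnt j n \<le> n"
  by (induction n) (auto simp: cnt_Suc)

lemma rv [measurable]: "1 \<le> k \<Longrightarrow> random_variable borel (X k)"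
  using indep by (auto simp: indep_vars_def2)

lemma sum_by_type:
  fixes g :: "nat \<Rightarrow> real"
  assumes "n \<le> m"
  shows "(\<Sum>i\<in>{n<..m}. g (ty i)) = (\<Sum>j\<in>{1, 2}. (real (cnt j m) - real (cnt j n)) * g j)"
  using assms
proof (induction m rule: dec_induct)
  case (step m)
  have "{n<..Suc m} = insert (Suc m) {n<..m}" using step by auto
  then show ?case using step ty[of "Suc m"] by (auto simp: cnt_Suc algebra_simps)
qed simp

lemma maximal_deviation:
  assumes x: "0 < x"
  shows "\<P>(\<omega> in M. \<exists>m\<in>{n..N}. x < \<bar>\<Sum>i\<in>{n<..m}. (X i \<omega> - drift (ty i) x)\<bar>)
    \<le> 9 * Q * (\<Sum>j\<in>{1, 2}. real (cnt j N) * x powr - \<alpha> j)"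
proof (cases "n \<le> N")
  case True
  have "\<P>(\<omega> in M. \<exists>m\<in>{n..N}. x < \<bar>\<Sum>i\<in>{n<..m}. (X i \<omega> - drift (ty i) x)\<bar>)
     \<le> 9 * (\<Sum>i\<in>{n<..N}. Q * x powr - \<alpha> (ty i))"
  proof (rule truncated_maximal_inequality[OF _ x])
    fix i assume "i \<in> {n<..N}"
    then have i: "1 \<le> i" by auto
    show "expectation (\<lambda>\<omega>. (trunc x (X i \<omega>))\<^sup>2) \<le> x\<^sup>2 * (Q * x powr - \<alpha> (ty i))"
      using var[OF i x] x by (simp add: powr_diff powr_minus field_simps)
  qed (use x tail drift in \<open>auto intro!: indep_vars_subset[OF indep]\<close>)
  also have "(\<Sum>i\<in>{n<..N}. Q * x powr - \<alpha> (ty i)) = Q * (\<Sum>i\<in>{n<..N}. x powr - \<alpha> (ty i))"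
    by (simp add: sum_distrib_left)
  also have "(\<Sum>i\<in>{n<..N}. x powr - \<alpha> (ty i)) = (\<Sum>j\<in>{1, 2}. (real (cnt j N) - real (cnt j n)) * x powr - \<alpha> j)"
    by (rule sum_by_type[OF True, of "\<lambda>j. x powr - \<alpha> j"])
  also have "\<dots> \<le> (\<Sum>j\<in>{1, 2}. real (cnt j N) * x powr - \<alpha> j)"
    by (intro sum_mono mult_right_mono) auto
  finally show ?thesis using Q_pos by simp
next
  case False
  then show ?thesis using Q_pos by (auto intro!: mult_nonneg_nonneg add_nonneg_nonneg)
qed

lemma deviation_measurable [measurable]:
  "{\<omega>\<in>space M. \<exists>m\<in>{n..N}. x < \<bar>\<Sum>i\<in>{n<..m}. (X i \<omega> - b i)\<bar>} \<in> events"
proof -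
  have "random_variable borel (\<lambda>\<omega>. \<Sum>i\<in>{n<..m}. (X i \<omega> - b i))" for m
    by (intro borel_measurable_sum borel_measurable_diff) auto
  note [measurable] = this
  show ?thesis by measurable
qed

end

lemma type_cases: "1 \<in> {1, 2::nat}" "2 \<in> {1, 2::nat}"
  by auto

context two_type_sequence
begin

text \<open>The half-open range \<open>{0<..n}\<close> makes increments of \<open>S\<close> sums over \<open>{n<..m}\<close>, the form in which the maximal
inequality is stated.\<close>

definition S :: "nat \<Rightarrow> 'a \<Rightarrow> real" where
  "S n \<omega> = (\<Sum>i\<in>{0<..n}. X i \<omega>)"

text \<open>Blocks of time between these indices, rather than between powers of two, keep \<open>cnt i\<close> constant up to a factor 2 even when type \<open>i\<close> is rare.\<close>

definition entry :: "nat \<Rightarrow> nat \<Rightarrow> nat" where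
  "entry i k = (LEAST n. 2 ^ k \<le> cnt i n)"

context
  fixes i assumes top: "filterlim (cnt i) at_top sequentially"
begin

lemma entry_props: "2 ^ k \<le> cnt i (entry i k)" "n < entry i k \<Longrightarrow> cnt i n < 2 ^ k"
proof -
  have ex: "\<exists>n. 2 ^ k \<le> cnt i n"
    using top by (auto simp: filterlim_at_top eventually_sequentially)
  show "2 ^ k \<le> cnt i (entry i k)"
    unfolding entry_def by (rule LeastI_ex[OF ex])
  show "n < entry i k \<Longrightarrow> cnt i n < 2 ^ k"
    unfolding entry_def using not_less_Least by force
qed

lemma entry_pos: "0 < entry i k"
  using entry_props(1)[of k] by (cases "entry i k") auto

lemma cnt_entry: "cnt i (entry i k) = 2 ^ k"
proof -
  have "cnt i (Suc (entry i k - 1)) \<le> cnt i (entry i k - 1) + 1" by (simp add: cnt_Suc)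
  then show ?thesis
    using entry_props(1)[of k] entry_props(2)[of "entry i k - 1" k] entry_pos[of k] by simp
qed

lemma entry_ge: "2 ^ k \<le> entry i k"
  using cnt_entry[of k] cnt_le[of i "entry i k"] by simp

lemma less_entry: "cnt i n < 2 ^ k \<Longrightarrow> n < entry i k"
  using cnt_entry[of k] monoD[OF mono_cnt, of "entry i k" n i] by linarith

lemma filterlim_entry: "filterlim (entry i) at_top sequentially"
proof (rule filterlim_at_top_mono)
  show "\<forall>\<^sub>F k in sequentially. k \<le> entry i k"
    by (intro always_eventually allI) (metis entry_ge less_exp less_imp_le_nat order_trans)
qed (rule filterlim_ident)

end

lemma S_diff:
  assumes "n \<le> m"
  shows "S m \<omega> - S n \<omega> = (\<Sum>i\<in>{n<..m}. X i \<omega>)"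
proof -
  have "{0<..m} = {0<..n} \<union> {n<..m}" using assms by auto
  then show ?thesis by (simp add: S_def sum.union_disjoint ivl_disj_int)
qed

lemma sum_minus_drift:
  assumes "n \<le> m"
  shows "(\<Sum>i\<in>{n<..m}. (X i \<omega> - drift (ty i) x))
    = S m \<omega> - S n \<omega> - (\<Sum>j\<in>{1, 2}. (real (cnt j m) - real (cnt j n)) * drift j x)"
  using sum_by_type[OF assms, of "\<lambda>j. drift j x"] by (simp add: sum_subtractf S_diff[OF assms])

section \<open>Convergent case\<close>

text \<open>The horizon \<open>N n\<close> is the last index that an increment starting at \<open>n\<close> may reach.  The hypothesis on \<open>cnt j (N n)\<close> says
that up to the horizon the type-\<open>j\<close> summands contribute at most the order \<open>(cnt i n)\<^bsup>1/\<alpha>\<^sub>i\<^esup>\<close> of the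
normalization, less a power of the logarithm where \<open>\<alpha>\<^sub>j < \<alpha>\<^sub>i\<close>.  On each block it suffices to
bound all sums \<open>S m\<close> from the origin, because \<open>\<bar>S m - S n\<bar> \<le> \<bar>S m\<bar> + \<bar>S n\<bar>\<close>.\<close>

theorem eventually_small_increments:
  fixes f :: "real \<Rightarrow> real" and N :: "nat \<Rightarrow> nat" and \<mu> :: "nat \<Rightarrow> real"
  assumes i: "i \<in> {1, 2}" and top: "filterlim (cnt i) at_top sequentially"
    and N: "mono N" and C: "0 < C"
    and cnt_N: "\<And>j. j \<in> {1, 2} \<Longrightarrow> \<forall>\<^sub>F n in sequentially.
      real (cnt j (N n)) \<le> C * real (cnt i n) powr (\<alpha> j / \<alpha> i) * ln (real n) powr - \<mu> j"
    and \<mu>: "\<And>j. j \<in> {1, 2} \<Longrightarrow> 0 \<le> \<mu> j"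
    and \<mu>_cases: "\<And>j. j \<in> {1, 2} \<Longrightarrow> (\<alpha> i \<le> \<alpha> j \<and> \<mu> j = 0) \<or> 1 < \<mu> j + \<alpha> j / \<alpha> i"
    and f_pos: "\<And>x. 1 \<le> x \<Longrightarrow> 0 < f x" and f_mono: "mono_on {1..} f"
    and f_sum: "summable (\<lambda>k. 1 / f (2 ^ k))"
    and \<epsilon>: "0 < \<epsilon>"
  shows "AE \<omega> in M. \<forall>\<^sub>F n in sequentially. \<forall>m\<in>{n..N n}.
    \<bar>S m \<omega> - S n \<omega>\<bar> \<le> \<epsilon> * (real (cnt i n) * f (real n)) powr (1 / \<alpha> i)"
proof -
  define p where "p = \<alpha> i"
  have p: "0 < p" using \<alpha>_pos[OF i] by (simp add: p_def)
  \<comment> \<open>each of \<open>S m\<close> and \<open>S n\<close> is a deviation of at most \<open>x\<close> plus a drift of at most \<open>x\<close>\<close>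
  define \<delta> where "\<delta> = \<epsilon> / 4"
  have \<delta>: "0 < \<delta>" using \<epsilon> by (simp add: \<delta>_def)
  define F where "F k = f (2 ^ k)" for k :: nat
  have F: "0 < F k" for k unfolding F_def by (rule f_pos) simp
  have F_inc: "incseq F"
    unfolding F_def incseq_def by (auto intro!: mono_onD[OF f_mono] power_increasing)
  define x where "x k = \<delta> * (2 ^ k * F k) powr (1 / p)" for k
  have x: "0 < x k" for k using \<delta> F[of k] by (simp add: x_def)
  define w where "w j k = real (Suc k) powr - \<mu> j * F k powr - (\<alpha> j / p)" for j k
  have W: "summable (w j)" "(\<lambda>k. real (Suc k) * w j k) \<longlonglongrightarrow> 0" "(\<lambda>k. ln (F k) * w j k) \<longlonglongrightarrow> 0"
    if j: "j \<in> {1, 2}" for j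
  proof -
    have "(1 \<le> \<alpha> j / p \<and> \<mu> j = 0) \<or> 1 < \<mu> j + \<alpha> j / p"
      using \<mu>_cases[OF j] p by (auto simp: p_def)
    note dyadic_weights[OF F F_inc f_sum[folded F_def] _ \<mu>[OF j] this]
    then show "summable (w j)" "(\<lambda>k. real (Suc k) * w j k) \<longlonglongrightarrow> 0" "(\<lambda>k. ln (F k) * w j k) \<longlonglongrightarrow> 0"
      unfolding w_def using \<alpha>_pos[OF j] p by auto
  qed
  have w0: "0 \<le> w j k" for j k by (simp add: w_def)

  let ?e = "entry i"
  note e_ge = cnt_entry[OF top] and e_ge2 = entry_ge[OF top]
  have e_top: "filterlim (\<lambda>k. ?e (Suc k)) at_top sequentially"
    by (rule filterlim_compose[OF filterlim_entry[OF top] filterlim_Suc])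
  define c where "c j = C * 2 powr (\<alpha> j / p) * ln 2 powr - \<mu> j" for j
  have c0: "0 \<le> c j" for j using C by (simp add: c_def)
  have cnt_le_w: "\<forall>\<^sub>F k in sequentially.
      real (cnt j (N (?e (Suc k)))) * x k powr - \<alpha> j \<le> c j * \<delta> powr - \<alpha> j * w j k"
    if j: "j \<in> {1, 2}" for j
    using eventually_compose_filterlim[OF cnt_N[OF j] e_top]
  proof eventually_elim
    case (elim k)
    have "real (cnt i (?e (Suc k))) \<le> 2 ^ Suc k" by (simp add: e_ge)
    then have "real (cnt i (?e (Suc k))) powr (\<alpha> j / p) \<le> (2 ^ Suc k) powr (\<alpha> j / p)"
      using \<alpha>_pos[OF j] p by (intro powr_mono2) auto
    also have "\<dots> = 2 powr (\<alpha> j / p) * (2 ^ k) powr (\<alpha> j / p)" by (simp add: powr_mult)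
    finally have 1: "real (cnt i (?e (Suc k))) powr (\<alpha> j / p) \<le> 2 powr (\<alpha> j / p) * (2 ^ k) powr (\<alpha> j / p)" .
    have "real (Suc k) * ln 2 = ln (2 ^ Suc k)" by (simp only: ln_realpow)
    also have "\<dots> \<le> ln (real (?e (Suc k)))"
      using e_ge2[of "Suc k"] entry_pos[OF top, of "Suc k"] by (subst ln_le_cancel_iff) (auto, metis of_nat_le_iff of_nat_numeral of_nat_power of_nat_mult power_Suc)
    finally have "ln (real (?e (Suc k))) powr - \<mu> j \<le> (real (Suc k) * ln 2) powr - \<mu> j"
      using \<mu>[OF j] by (intro powr_mono2') auto
    also have "\<dots> = ln 2 powr - \<mu> j * real (Suc k) powr - \<mu> j" by (simp add: powr_mult)
    finally have 2: "ln (real (?e (Suc k))) powr - \<mu> j \<le> ln 2 powr - \<mu> j * real (Suc k) powr - \<mu> j" .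
    have "real (cnt j (N (?e (Suc k)))) \<le> C * real (cnt i (?e (Suc k))) powr (\<alpha> j / p) * ln (real (?e (Suc k))) powr - \<mu> j"
      using elim by (simp add: p_def)
    also have "\<dots> \<le> C * (2 powr (\<alpha> j / p) * (2 ^ k) powr (\<alpha> j / p)) * (ln 2 powr - \<mu> j * real (Suc k) powr - \<mu> j)"
      using C by (intro mult_mono 1 2 mult_left_mono) auto
    also have "\<dots> = c j * ((2 ^ k) powr (\<alpha> j / p) * real (Suc k) powr - \<mu> j)" by (simp add: c_def)
    finally have "real (cnt j (N (?e (Suc k)))) * x k powr - \<alpha> j
        \<le> c j * ((2 ^ k) powr (\<alpha> j / p) * real (Suc k) powr - \<mu> j) * x k powr - \<alpha> j"
      by (intro mult_right_mono) auto
    also have "\<dots> = c j * \<delta> powr - \<alpha> j * w j k * ((2 ^ k) powr (\<alpha> j / p) * (2 ^ k) powr - (\<alpha> j / p))"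
      using \<delta> F[of k] by (simp add: x_def w_def powr_mult powr_powr)
    also have "(2 ^ k) powr (\<alpha> j / p) * (2 ^ k :: real) powr - (\<alpha> j / p) = 1"
      by (simp add: powr_add[symmetric])
    finally show ?case by simp
  qed

  define E where "E k = {\<omega>\<in>space M. \<exists>m\<in>{0..N (?e (Suc k))}.
      x k < \<bar>\<Sum>i\<in>{0<..m}. (X i \<omega> - drift (ty i) (x k))\<bar>}" for k
  have E_ev: "AE \<omega> in M. \<forall>\<^sub>F k in sequentially. \<omega> \<in> space M - E k"
  proof (rule borel_cantelli_AE1)
    show "E k \<in> events" for k unfolding E_def by measurable
    show "emeasure M (E k) < \<infinity>" for k by (simp add: less_top[symmetric])
    have "summable (\<lambda>k. 9 * Q * (\<Sum>j\<in>{1, 2}. c j * \<delta> powr - \<alpha> j * w j k))"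
      by (intro summable_mult summable_sum W)
    moreover have "\<forall>\<^sub>F k in sequentially. norm (prob (E k)) \<le> 9 * Q * (\<Sum>j\<in>{1, 2}. c j * \<delta> powr - \<alpha> j * w j k)"
      using cnt_le_w[OF type_cases(1)] cnt_le_w[OF type_cases(2)]
    proof eventually_elim
      case (elim k)
      have "prob (E k) \<le> 9 * Q * (\<Sum>j\<in>{1, 2}. real (cnt j (N (?e (Suc k)))) * x k powr - \<alpha> j)"
        unfolding E_def by (rule maximal_deviation[OF x])
      also have "\<dots> \<le> 9 * Q * (\<Sum>j\<in>{1, 2}. c j * \<delta> powr - \<alpha> j * w j k)"
        using elim Q_pos by (intro mult_left_mono sum_mono) auto
      finally show ?case by simp
    qed
    ultimately show "summable (\<lambda>k. prob (E k))" by (rule summable_comparison_test_ev[rotated])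
  qed
  have drift_small: "\<forall>\<^sub>F k in sequentially. real (cnt j (N (?e (Suc k)))) * \<bar>drift j (x k)\<bar> \<le> x k / 2"
    if j: "j \<in> {1, 2}" for j
  proof (cases "\<alpha> j = 1")
    case False
    have "(\<lambda>k. Q * (c j * \<delta> powr - \<alpha> j * w j k)) \<longlonglongrightarrow> Q * (c j * \<delta> powr - \<alpha> j * 0)"
      by (intro tendsto_intros summable_LIMSEQ_zero W j)
    then have "\<forall>\<^sub>F k in sequentially. Q * (c j * \<delta> powr - \<alpha> j * w j k) < 1/2"
      by (rule order_tendstoD(2)) simp
    with cnt_le_w[OF j] show ?thesis
    proof eventually_elim
      case (elim k)
      have "real (cnt j (N (?e (Suc k)))) * \<bar>drift j (x k)\<bar> \<le> real (cnt j (N (?e (Suc k)))) * (Q * x k powr (1 - \<alpha> j))"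
        by (intro mult_left_mono drift_le j False x) auto
      also have "\<dots> = x k * (Q * (real (cnt j (N (?e (Suc k)))) * x k powr - \<alpha> j))"
        using x[of k] by (simp add: powr_diff powr_minus field_simps)
      also have "\<dots> \<le> x k * (Q * (c j * \<delta> powr - \<alpha> j * w j k))"
        using elim x[of k] Q_pos by (intro mult_left_mono) auto
      also have "\<dots> \<le> x k * (1/2)" using elim x[of k] by (intro mult_left_mono) auto
      finally show ?case by simp
    qed
  next
    case True
    have lnx: "ln (x k) = ln \<delta> + (real k * ln 2 + ln (F k)) / p" for k
      using \<delta> F[of k] by (simp add: x_def ln_mult ln_powr ln_realpow)
    have w_lim: "w j \<longlonglongrightarrow> 0" by (rule summable_LIMSEQ_zero[OF W(1)[OF j]])
    define G where "G k = w j k * (1 + ln \<delta>)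
      + ((real (Suc k) * w j k - w j k) * ln 2 + ln (F k) * w j k) / p" for k
    have G: "G k = w j k * (1 + ln (x k))" for k
      unfolding G_def lnx using p by (simp add: field_simps)
    have "(\<lambda>k. Q * (c j * \<delta> powr - \<alpha> j) * G k) \<longlonglongrightarrow>
       Q * (c j * \<delta> powr - \<alpha> j) * (0 * (1 + ln \<delta>) + ((0 - 0) * ln 2 + 0) / p)"
      unfolding G_def using p by (intro tendsto_intros W[OF j] w_lim) auto
    then have "\<forall>\<^sub>F k in sequentially. Q * (c j * \<delta> powr - \<alpha> j) * G k < 1/2"
      by (rule order_tendstoD(2)) simp
    moreover have "\<forall>\<^sub>F k in sequentially. 1 \<le> x k"
    proof -
      have "\<forall>\<^sub>F k in sequentially. 1 \<le> \<delta> * (2 ^ k * F 0) powr (1 / p)"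
        using \<delta> p F[of 0] by real_asymp
      then show ?thesis
      proof eventually_elim
        case (elim k)
        have "F 0 \<le> F k" using F_inc by (auto simp: incseq_def)
        then have "\<delta> * (2 ^ k * F 0) powr (1 / p) \<le> x k"
          unfolding x_def using \<delta> p F[of 0] by (intro mult_left_mono powr_mono2) auto
        with elim show ?case by simp
      qed
    qed
    ultimately show ?thesis using cnt_le_w[OF j]
    proof eventually_elim
      case (elim k)
      have "real (cnt j (N (?e (Suc k)))) * \<bar>drift j (x k)\<bar> \<le> real (cnt j (N (?e (Suc k)))) * (Q * (1 + ln (x k)))"
        by (intro mult_left_mono drift_le_ln j True elim) auto
      also have "\<dots> = x k * (Q * (1 + ln (x k)) * (real (cnt j (N (?e (Suc k)))) * x k powr - \<alpha> j))"
        using x[of k] True by (simp add: powr_minus field_simps)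
      also have "\<dots> \<le> x k * (Q * (1 + ln (x k)) * (c j * \<delta> powr - \<alpha> j * w j k))"
        using elim x[of k] Q_pos by (intro mult_left_mono) auto
      also have "\<dots> = x k * (Q * (c j * \<delta> powr - \<alpha> j) * G k)" by (simp add: G ac_simps)
      also have "\<dots> \<le> x k * (1/2)" using elim x[of k] by (intro mult_left_mono) auto
      finally show ?case by simp
    qed
  qed
  from E_ev show ?thesis
  proof eventually_elim
    case (elim \<omega>)
    then have "\<forall>\<^sub>F k in sequentially. \<forall>m\<in>{0..N (?e (Suc k))}. \<bar>S m \<omega>\<bar> \<le> 2 * x k"
      using drift_small[OF type_cases(1)] drift_small[OF type_cases(2)]
    proof eventually_elim
      case (elim k)
      show ?case
      proof
        fix m assume m: "m \<in> {0..N (?e (Suc k))}"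
        have "\<bar>\<Sum>i\<in>{0<..m}. (X i \<omega> - drift (ty i) (x k))\<bar> \<le> x k"
          using elim(1) m by (auto simp: E_def not_less)
        then have "\<bar>S m \<omega> - (\<Sum>j\<in>{1, 2}. real (cnt j m) * drift j (x k))\<bar> \<le> x k"
          using sum_minus_drift[of 0 m \<omega> "x k"] by (simp add: S_def)
        moreover have "\<bar>real (cnt j m) * drift j (x k)\<bar> \<le> x k / 2" if "j \<in> {1, 2}" for j
        proof -
          have "real (cnt j m) * \<bar>drift j (x k)\<bar> \<le> real (cnt j (N (?e (Suc k)))) * \<bar>drift j (x k)\<bar>"
            using monoD[OF mono_cnt, of m "N (?e (Suc k))" j] m by (intro mult_right_mono) auto
          then show ?thesis using elim that by (auto simp: abs_mult)
        qed
        from this[of 1] this[of 2] have "\<bar>\<Sum>j\<in>{1, 2}. real (cnt j m) * drift j (x k)\<bar> \<le> x k"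
          by simp
        ultimately show "\<bar>S m \<omega>\<bar> \<le> 2 * x k" by linarith
      qed
    qed
    then obtain k0 where k0: "\<And>k m. k0 \<le> k \<Longrightarrow> m \<le> N (?e (Suc k)) \<Longrightarrow> \<bar>S m \<omega>\<bar> \<le> 2 * x k"
      unfolding eventually_sequentially by fastforce
    have "\<forall>\<^sub>F n in sequentially. 2 ^ k0 \<le> cnt i n"
      using top by (auto simp: filterlim_at_top)
    then show ?case
    proof eventually_elim
      case (elim n)
      have "1 \<le> cnt i n" using elim by (metis one_le_numeral one_le_power order_trans)
      then obtain k where k: "2 ^ k \<le> cnt i n" "cnt i n < 2 ^ Suc k"
        using ex_power_ivl1[of 2 "cnt i n"] by auto
      have "k0 < Suc k" using elim k by (metis le_less_trans one_less_numeral_iff power_less_imp_less_exp semiring_norm(76))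
      have "n < ?e (Suc k)"
        by (rule less_entry[OF top k(2)])
      have Nn: "N n \<le> N (?e (Suc k))" using \<open>n < ?e (Suc k)\<close> by (intro monoD[OF N]) auto
      have n2: "2 ^ k \<le> n" using k(1) cnt_le[of i n] by simp
      show ?case
      proof
        fix m assume m: "m \<in> {n..N n}"
        have "\<bar>S m \<omega>\<bar> \<le> 2 * x k" "\<bar>S n \<omega>\<bar> \<le> 2 * x k"
          using m Nn \<open>k0 < Suc k\<close> by (auto intro!: k0)
        then have "\<bar>S m \<omega> - S n \<omega>\<bar> \<le> 4 * x k" by linarith
        also have "\<dots> = \<epsilon> * (2 ^ k * F k) powr (1 / p)" by (simp add: x_def \<delta>_def)
        also have "\<dots> \<le> \<epsilon> * (real (cnt i n) * f (real n)) powr (1 / p)"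
        proof (intro mult_left_mono powr_mono2 mult_mono)
          show "2 ^ k \<le> real (cnt i n)" using k(1) by (metis of_nat_le_iff of_nat_numeral of_nat_power)
          have kn: "(2 ^ k :: real) \<le> real n" using n2 by (metis of_nat_le_iff of_nat_numeral of_nat_power)
          have k1: "(1::real) \<le> 2 ^ k" by simp
          show "F k \<le> f (real n)"
            unfolding F_def by (rule mono_onD[OF f_mono _ _ kn]) (use k1 order_trans[OF k1 kn] in auto)
        qed (use \<epsilon> p F[of k] in auto)
        finally show "\<bar>S m \<omega> - S n \<omega>\<bar> \<le> \<epsilon> * (real (cnt i n) * f (real n)) powr (1 / \<alpha> i)"
          by (simp add: p_def)
      qed
    qed
  qed
qed

end

section \<open>Divergent case\<close>

lemma summable_dyadic_of_summable_sparse: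
  fixes g :: "nat \<Rightarrow> real"
  assumes dec: "decseq g" and pos: "\<And>l. 0 \<le> g l" and q: "0 < q"
    and sum: "summable (\<lambda>k. g (q * Suc k))"
  shows "summable g"
proof -
  have le: "(\<Sum>l\<in>{k * q..<k * q + q}. g l) \<le> q * g (q * k)" for k
  proof -
    have "(\<Sum>l\<in>{k * q..<k * q + q}. g l) \<le> (\<Sum>l\<in>{k * q..<k * q + q}. g (q * k))"
      by (intro sum_mono decseqD[OF dec]) (auto simp: mult.commute)
    then show ?thesis by simp
  qed
  have "summable (\<lambda>k. g (q * k))"
    using sum by (subst (asm) summable_Suc_iff[of "\<lambda>k. g (q * k)"])
  then have sq: "summable (\<lambda>k. q * g (q * k))" by (rule summable_mult)
  show ?thesis
  proof (rule summableI_nonneg_bounded[OF pos])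
    fix n
    have "(\<Sum>l<n. g l) \<le> (\<Sum>l<n * q. g l)"
      using q pos by (intro sum_mono2) (auto intro: less_le_trans)
    also have "\<dots> = (\<Sum>k<n. \<Sum>l\<in>{k * q..<k * q + q}. g l)" by (rule sum.nat_group[symmetric])
    also have "\<dots> \<le> (\<Sum>k<n. q * g (q * k))" by (intro sum_mono le)
    also have "\<dots> \<le> (\<Sum>k. q * g (q * k))"
      by (rule sum_le_suminf[OF sq]) (use pos in auto)
    finally show "(\<Sum>l<n. g l) \<le> (\<Sum>k. q * g (q * k))" .
  qed
qed

context two_type_sequence
begin

text \<open>Only a type of exponent 1 can have a drift above the order \<open>y\<^bsup>1-\<alpha>\<^esup>\<close>, and there is at most one.  Its
sign is taken for \<open>s\<close>.\<close>

lemma aligned_sign: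
  assumes y: "0 < y"
  obtains s :: real where "s \<in> {1, -1}"
    and "\<And>j. j \<in> {1, 2} \<Longrightarrow> - (Q * y powr (1 - \<alpha> j)) \<le> s * drift j y"
proof -
  have *: "- (Q * y powr (1 - \<alpha> j)) \<le> s * drift j y"
    if "j \<in> {1, 2}" "\<alpha> j \<noteq> 1" "s \<in> {1, -1}" for j and s :: real
    using drift_le[OF that(1,2) y] that(3) by (auto simp: abs_le_iff)
  define s :: "nat \<Rightarrow> real" where "s j = (if 0 \<le> drift j y then 1 else -1)" for j
  have s: "s j \<in> {1, -1}" "- (Q * y powr (1 - \<alpha> j)) \<le> s j * drift j y" for j
  proof -
    have "- (Q * y powr (1 - \<alpha> j)) \<le> 0" using Q_pos by simp
    also have "0 \<le> s j * drift j y" by (simp add: s_def)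
    finally show "- (Q * y powr (1 - \<alpha> j)) \<le> s j * drift j y" .
  qed (simp add: s_def)
  show ?thesis
  proof (cases "\<alpha> 1 = 1")
    case True
    then have "\<alpha> 2 \<noteq> 1" using \<alpha>_neq by simp
    then show ?thesis using that[OF s(1)[of 1]] s(2)[of 1] *[of 2 "s 1"] s(1)[of 1] by blast
  next
    case False
    then show ?thesis using that[OF s(1)[of 2]] s(2)[of 2] *[of 1 "s 2"] s(1)[of 2] by blast
  qed
qed

text \<open>Between the entry times of \<open>2\<^sup>k\<close> and \<open>2\<^bsup>k+1\<^esup>\<close> there are \<open>2\<^sup>k\<close> indices of type \<open>i\<close>, each
contributing at least \<open>2\<^bsup>-k-1\<^esup> / f(entry i (k+1))\<close>.  Polynomial growth places the entry time below
\<open>2\<^bsup>q(k+1)\<^esup>\<close>, and for monotone \<open>f\<close> passing from all powers of two to every \<open>q\<close>-th one preserves divergence.\<close>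

lemma reciprocal_sum_diverges:
  fixes f :: "real \<Rightarrow> real"
  assumes top: "filterlim (cnt i) at_top sequentially"
    and poly: "\<forall>\<^sub>F n in sequentially. n \<le> cnt i n ^ q"
    and f_pos: "\<And>x. 1 \<le> x \<Longrightarrow> 0 < f x" and f_mono: "mono_on {1..} f"
    and div: "\<not> summable (\<lambda>k. 1 / f (2 ^ k))"
  shows "\<not> summable (\<lambda>n. if 0 < n \<and> ty n = i then 1 / (real (cnt i n) * f (real n)) else 0)"
proof
  define u where "u n = (if 0 < n \<and> ty n = i then 1 / (real (cnt i n) * f (real n)) else 0)" for n
  assume "summable (\<lambda>n. if 0 < n \<and> ty n = i then 1 / (real (cnt i n) * f (real n)) else 0)"
  then have sum_u: "summable u" by (simp add: u_def[abs_def])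
  have u0: "0 \<le> u n" for n using f_pos[of "real n"] by (auto simp: u_def intro: less_imp_le)
  define U where "U n = (\<Sum>l<Suc n. u l)" for n
  let ?e = "entry i"
  have step: "(real (cnt i m) - real (cnt i n)) * c \<le> U m - U n"
    if "n \<le> m" and c: "\<And>l. l \<le> m \<Longrightarrow> 0 < l \<Longrightarrow> ty l = i \<Longrightarrow> c \<le> u l" for n m c
    using that
  proof (induction m rule: dec_induct)
    case (step m)
    have "(real (cnt i m) - real (cnt i n)) * c \<le> U m - U n" using step by auto
    moreover have "U (Suc m) = U m + u (Suc m)" by (simp add: U_def)
    ultimately show ?case using step.prems[of "Suc m"] u0[of "Suc m"]
      by (auto simp: cnt_Suc algebra_simps)
  qed simp
  have blk: "1 / f (?e (Suc k)) \<le> 2 * (U (?e (Suc k)) - U (?e k))" for k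
  proof -
    have e1: "1 \<le> real (?e (Suc k))" using entry_pos[OF top, of "Suc k"] by linarith
    define c where "c = 1 / (2 ^ Suc k * f (?e (Suc k)))"
    have "(real (cnt i (?e (Suc k))) - real (cnt i (?e k))) * c \<le> U (?e (Suc k)) - U (?e k)"
    proof (rule step)
      show "?e k \<le> ?e (Suc k)" by (rule less_imp_le, rule less_entry[OF top]) (simp add: cnt_entry[OF top])
      fix l assume l: "l \<le> ?e (Suc k)" "0 < l" "ty l = i"
      have "cnt i l \<le> 2 ^ Suc k" using monoD[OF mono_cnt l(1), of i] by (simp add: cnt_entry[OF top])
      then have 1: "real (cnt i l) \<le> 2 ^ Suc k" by (metis of_nat_le_iff of_nat_numeral of_nat_power)
      have "cnt i (Suc (l - 1)) = cnt i (l - 1) + 1" using l by (subst cnt_Suc) auto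
      then have 2: "0 < real (cnt i l)" using l by simp
      have 3: "f (real l) \<le> f (?e (Suc k))" using l by (intro mono_onD[OF f_mono]) auto
      have 4: "0 < f (real l)" using l by (intro f_pos) auto
      have "c \<le> 1 / (real (cnt i l) * f (real l))"
        unfolding c_def using 1 2 3 4 by (intro divide_left_mono mult_mono mult_pos_pos) auto
      then show "c \<le> u l" using l by (simp add: u_def)
    qed
    then show ?thesis using f_pos[OF e1] by (simp add: cnt_entry[OF top] c_def field_simps)
  qed
  have s1: "summable (\<lambda>k. 1 / f (?e (Suc k)))"
  proof (rule summableI_nonneg_bounded)
    fix n
    show "0 \<le> 1 / f (?e (Suc n))" using entry_pos[OF top, of "Suc n"] f_pos[of "?e (Suc n)"] by (auto intro: less_imp_le)
    have "(\<Sum>k<n. 1 / f (?e (Suc k))) \<le> (\<Sum>k<n. 2 * (U (?e (Suc k)) - U (?e k)))" by (intro sum_mono blk)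
    also have "\<dots> = 2 * (U (?e n) - U (?e 0))"
      unfolding sum_distrib_left[symmetric] by (subst sum_lessThan_telescope) (rule refl)
    also have "\<dots> \<le> 2 * suminf u"
    proof -
      have "U (?e n) \<le> suminf u" unfolding U_def by (rule sum_le_suminf[OF sum_u]) (use u0 in auto)
      moreover have "0 \<le> U (?e 0)" unfolding U_def by (intro sum_nonneg u0)
      ultimately show ?thesis by simp
    qed
    finally show "(\<Sum>k<n. 1 / f (?e (Suc k))) \<le> 2 * suminf u" .
  qed
  have ev: "\<forall>\<^sub>F k in sequentially. ?e (Suc k) \<le> 2 ^ (q * Suc k)"
    using eventually_compose_filterlim[OF poly filterlim_compose[OF filterlim_entry[OF top] filterlim_Suc]]
    by eventually_elim (simp add: cnt_entry[OF top] power_mult[symmetric] mult.commute power_add)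
  have q: "0 < q"
  proof (rule ccontr)
    assume "\<not> 0 < q"
    then have "\<forall>\<^sub>F n::nat in sequentially. n \<le> 1" using poly by simp
    with eventually_gt_at_top[of 1] have "\<forall>\<^sub>F n::nat in sequentially. False" by eventually_elim simp
    then show False by simp
  qed
  have "summable (\<lambda>k. 1 / f (2 ^ (q * Suc k)))"
  proof (rule summable_comparison_test_ev[OF _ s1])
    show "\<forall>\<^sub>F k in sequentially. norm (1 / f (2 ^ (q * Suc k))) \<le> 1 / f (?e (Suc k))"
      using ev
    proof eventually_elim
      case (elim k)
      have e1: "1 \<le> real (?e (Suc k))" using entry_pos[OF top, of "Suc k"] by linarith
      have "real (?e (Suc k)) \<le> 2 ^ (q * Suc k)" using elim by (metis of_nat_le_iff of_nat_numeral of_nat_power)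
      then have "f (?e (Suc k)) \<le> f (2 ^ (q * Suc k))"
        using e1 by (intro mono_onD[OF f_mono]) auto
      then show ?case using f_pos[OF e1] by (simp add: divide_left_mono)
    qed
  qed
  then have "summable (\<lambda>k. 1 / f (2 ^ k))"
  proof (rule summable_dyadic_of_summable_sparse[rotated 3])
    show "decseq (\<lambda>l. 1 / f (2 ^ l))"
      using f_mono by (auto simp: decseq_def intro!: divide_left_mono mult_pos_pos f_pos mono_onD[OF f_mono] power_increasing)
    show "0 \<le> 1 / f (2 ^ l)" for l using f_pos[of "2 ^ l"] by (auto intro: less_imp_le)
  qed (rule q)
  then show False using div by simp
qed

text \<open>The finite form of the second Borel-Cantelli lemma, from \<open>1 - p \<le> exp (- p)\<close>.\<close>

lemma prob_UN_indep_ge: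
  fixes B :: "nat \<Rightarrow> real set"
  assumes B [measurable]: "\<And>k. B k \<in> sets borel" and n: "1 \<le> n"
  shows "1 - exp (- (\<Sum>k\<in>{n..N}. \<P>(\<omega> in M. X k \<omega> \<in> B k)))
     \<le> prob (\<Union>k\<in>{n..N}. {\<omega>\<in>space M. X k \<omega> \<in> B k})"
proof (cases "n \<le> N")
  case True
  have [measurable]: "{\<omega>\<in>space M. X k \<omega> \<in> B k} \<in> events" if "k \<in> {n..N}" for k
  proof -
    have "1 \<le> k" using that n by auto
    note [measurable] = rv[OF this]
    show ?thesis by measurable
  qed
  have U: "(\<Union>k\<in>{n..N}. {\<omega>\<in>space M. X k \<omega> \<in> B k}) \<in> events" by auto
  have "prob (space M - (\<Union>k\<in>{n..N}. {\<omega>\<in>space M. X k \<omega> \<in> B k}))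
      = prob (\<Inter>k\<in>{n..N}. X k -` (- B k) \<inter> space M)"
    using True by (intro arg_cong[where f=prob]) auto
  also have "\<dots> = (\<Prod>k\<in>{n..N}. prob (X k -` (- B k) \<inter> space M))"
    by (rule indep_varsD[OF indep]) (use True n in auto)
  also have "\<dots> \<le> (\<Prod>k\<in>{n..N}. exp (- \<P>(\<omega> in M. X k \<omega> \<in> B k)))"
  proof (rule prod_mono, intro conjI)
    fix k assume k: "k \<in> {n..N}"
    have "X k -` (- B k) \<inter> space M = space M - {\<omega>\<in>space M. X k \<omega> \<in> B k}" by auto
    then have "prob (X k -` (- B k) \<inter> space M) = 1 - \<P>(\<omega> in M. X k \<omega> \<in> B k)"
      using k by (simp add: prob_compl)
    then show "prob (X k -` (- B k) \<inter> space M) \<le> exp (- \<P>(\<omega> in M. X k \<omega> \<in> B k))"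
      using exp_ge_add_one_self[of "- \<P>(\<omega> in M. X k \<omega> \<in> B k)"] by simp
  qed simp
  also have "\<dots> = exp (- (\<Sum>k\<in>{n..N}. \<P>(\<omega> in M. X k \<omega> \<in> B k)))"
    by (simp add: exp_sum[symmetric] sum_negf)
  finally show ?thesis using prob_compl[OF U] by simp
qed simp

text \<open>The increments start at \<open>n - 1\<close>, so that the jump \<open>X n\<close> is their first summand, and \<open>m\<close> ranges over all of
\<open>{n..N n}\<close>: one jump makes the increments of all lengths large at once.  The probability
of seeing such an index beyond \<open>n0\<close> is shown to exceed \<open>1 - \<eta>\<close> for every \<open>\<eta>\<close>, by taking the factor
\<open>R\<close> in the size of the jump large in terms of \<open>\<eta>\<close>; a larger jump only helps.\<close>

theorem infinitely_often_large_increments: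
  fixes f :: "real \<Rightarrow> real" and N :: "nat \<Rightarrow> nat"
  assumes i: "i \<in> {1, 2}" and top: "filterlim (cnt i) at_top sequentially"
    and C: "0 < C"
    and cnt_N: "\<And>j. j \<in> {1, 2} \<Longrightarrow> \<forall>\<^sub>F n in sequentially.
      real (cnt j (N n)) \<le> C * real (cnt i n) powr (\<alpha> j / \<alpha> i)"
    and poly: "\<forall>\<^sub>F n in sequentially. n \<le> cnt i n ^ q"
    and b: "0 < b"
    and upper_tail: "\<And>k x. 1 \<le> k \<Longrightarrow> ty k = i \<Longrightarrow> x0 \<le> x \<Longrightarrow> b * x powr - \<alpha> i \<le> \<P>(\<omega> in M. x \<le> X k \<omega>)"
    and lower_tail: "\<And>k x. 1 \<le> k \<Longrightarrow> ty k = i \<Longrightarrow> x0 \<le> x \<Longrightarrow> b * x powr - \<alpha> i \<le> \<P>(\<omega> in M. X k \<omega> \<le> - x)"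
    and f_pos: "\<And>x. 1 \<le> x \<Longrightarrow> 0 < f x" and f_mono: "mono_on {1..} f"
    and div: "\<not> summable (\<lambda>k. 1 / f (2 ^ k))"
    and K: "0 < K"
  shows "AE \<omega> in M. \<exists>\<^sub>F n in sequentially. \<forall>m\<in>{n..N n}.
    K * (real (cnt i n) * f (real n)) powr (1 / \<alpha> i) \<le> \<bar>S m \<omega> - S (n - 1) \<omega>\<bar>"
proof -
  define p where "p = \<alpha> i"
  have p: "0 < p" using \<alpha>_pos[OF i] by (simp add: p_def)
  define t where "t n = (real (cnt i n) * f (real n)) powr (1 / p)" for n
  define Gd where "Gd n = {\<omega>\<in>space M. \<forall>m\<in>{n..N n}. K * t n \<le> \<bar>S m \<omega> - S (n - 1) \<omega>\<bar>}" for n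
  have Sm [measurable]: "random_variable borel (S n)" for n
    unfolding S_def[abs_def] by (intro borel_measurable_sum) auto
  have Gd [measurable]: "Gd n \<in> events" for n unfolding Gd_def by measurable
  have main: "1 - \<eta> \<le> prob (\<Union>n\<in>{n0..}. Gd n)" if \<eta>: "0 < \<eta>" "\<eta> < 1" for \<eta> n0
  proof -
    \<comment> \<open>up to a constant factor, \<open>v j R\<close> bounds the expected number of type-\<open>j\<close> summands above level \<open>y n\<close> up to the horizon\<close>
    define v where "v j R = C * R powr - \<alpha> j * f 1 powr - (\<alpha> j / p)" for j R
    have v_lim: "((\<lambda>R. v j R) \<longlongrightarrow> 0) at_top" if "j \<in> {1, 2}" for j
      unfolding v_def using \<alpha>_pos[OF that] by real_asymp
    have "((\<lambda>R. 9 * Q * (\<Sum>j\<in>{1, 2}. v j R)) \<longlongrightarrow> 9 * Q * (\<Sum>j\<in>{1, 2::nat}. 0)) at_top"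
      by (intro tendsto_intros v_lim)
    then have ev1: "\<forall>\<^sub>F R in at_top. 9 * Q * (\<Sum>j\<in>{1, 2}. v j R) < \<eta> / 2"
      by (rule order_tendstoD(2)) (use \<eta> in simp)
    have ev2: "\<forall>\<^sub>F R in at_top. Q * v j R < 1 / 4" if "j \<in> {1, 2}" for j
    proof -
      have "((\<lambda>R. Q * v j R) \<longlongrightarrow> Q * 0) at_top" by (intro tendsto_intros v_lim that)
      then show ?thesis by (rule order_tendstoD(2)) simp
    qed
    have "\<forall>\<^sub>F R in at_top. 9 * Q * (\<Sum>j\<in>{1, 2}. v j R) < \<eta> / 2 \<and> Q * v 1 R < 1 / 4 \<and> Q * v 2 R < 1 / 4 \<and> 2 * K \<le> R"
      using ev1 ev2[OF type_cases(1)] ev2[OF type_cases(2)] eventually_ge_at_top[of "2 * K"] by eventually_elim auto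
    then obtain R where R: "9 * Q * (\<Sum>j\<in>{1, 2}. v j R) < \<eta> / 2" "Q * v 1 R < 1 / 4" "Q * v 2 R < 1 / 4" "2 * K \<le> R"
      by (auto simp: eventually_at_top_linorder)
    have R0: "0 < R" using R K by simp
    define y where "y n = R * t n" for n
    have f1: "0 < f 1" using f_pos by simp
    have "\<forall>\<^sub>F n in sequentially. x0 \<le> R * (real (cnt i n) * f 1) powr (1 / p)"
    proof -
      have "filterlim (\<lambda>z. R * (z * f 1) powr (1 / p)) at_top at_top"
        using R0 f1 p by real_asymp
      from filterlim_compose[OF this filterlim_compose[OF filterlim_real_sequentially top]]
      show ?thesis by (simp add: filterlim_at_top)
    qed
    moreover have "\<forall>\<^sub>F n in sequentially. 1 \<le> cnt i n" using top by (auto simp: filterlim_at_top)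
    ultimately have "\<forall>\<^sub>F n in sequentially. x0 \<le> R * (real (cnt i n) * f 1) powr (1 / p)
        \<and> 1 \<le> cnt i n \<and> (\<forall>j\<in>{1, 2}. real (cnt j (N n)) \<le> C * real (cnt i n) powr (\<alpha> j / p)) \<and> n0 \<le> n \<and> 1 \<le> n"
      using cnt_N[OF type_cases(1)] cnt_N[OF type_cases(2)] eventually_ge_at_top[of n0] eventually_ge_at_top[of 1]
      unfolding p_def by eventually_elim auto
    then obtain n1 where n1_all: "\<forall>n\<ge>n1. x0 \<le> R * (real (cnt i n) * f 1) powr (1 / p)
        \<and> 1 \<le> cnt i n \<and> (\<forall>j\<in>{1, 2}. real (cnt j (N n)) \<le> C * real (cnt i n) powr (\<alpha> j / p)) \<and> n0 \<le> n \<and> 1 \<le> n"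
      unfolding eventually_sequentially by blast
    have n1: "x0 \<le> R * (real (cnt i n) * f 1) powr (1 / p)" "1 \<le> cnt i n"
        "\<And>j. j \<in> {1, 2} \<Longrightarrow> real (cnt j (N n)) \<le> C * real (cnt i n) powr (\<alpha> j / p)" "n0 \<le> n" "1 \<le> n"
      if "n1 \<le> n" for n
      using n1_all that by blast+
    have f1_le: "f 1 \<le> f (real n)" if "n1 \<le> n" for n
      using n1(5)[OF that] by (intro mono_onD[OF f_mono]) auto
    have t0: "0 < t n" and y0: "0 < y n" if "n1 \<le> n" for n
      using n1(2)[OF that] f1_le[OF that] f1 R0 by (auto simp: t_def y_def)
    have y_ge: "x0 \<le> y n" if "n1 \<le> n" for n
    proof -
      have "R * (real (cnt i n) * f 1) powr (1 / p) \<le> y n"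
        unfolding y_def t_def using R0 p f1 f1_le[OF that]
        by (intro mult_left_mono powr_mono2) auto
      then show ?thesis using n1(1)[OF that] by simp
    qed
    have cnt_v: "real (cnt j (N n)) * y n powr - \<alpha> j \<le> v j R" if n: "n1 \<le> n" and j: "j \<in> {1, 2}" for n j
    proof -
      have c: "0 < real (cnt i n)" using n1(2)[OF n] by simp
      have "real (cnt j (N n)) * y n powr - \<alpha> j \<le> C * real (cnt i n) powr (\<alpha> j / p) * y n powr - \<alpha> j"
        by (intro mult_right_mono n1(3) n j) auto
      also have "\<dots> = C * R powr - \<alpha> j * f (real n) powr - (\<alpha> j / p)
          * (real (cnt i n) powr (\<alpha> j / p) * real (cnt i n) powr - (\<alpha> j / p))"
        using R0 f1 f1_le[OF n] by (simp add: y_def t_def powr_mult powr_powr)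
      also have "real (cnt i n) powr (\<alpha> j / p) * real (cnt i n) powr - (\<alpha> j / p) = 1"
        using c by (simp add: powr_add[symmetric])
      also have "C * R powr - \<alpha> j * f (real n) powr - (\<alpha> j / p) * 1 \<le> v j R"
        unfolding v_def using C f1 f1_le[OF n] \<alpha>_pos[OF j] p by (auto intro!: mult_left_mono powr_mono2')
      finally show ?thesis .
    qed
    have "\<exists>s. s \<in> {1, -1} \<and> (\<forall>j\<in>{1, 2}. - (Q * y n powr (1 - \<alpha> j)) \<le> s * drift j (y n))" if n: "n1 \<le> n" for n
      using aligned_sign[OF y0[OF n]] by metis
    then obtain s :: "nat \<Rightarrow> real" where s: "\<And>n. n1 \<le> n \<Longrightarrow> s n \<in> {1, -1}"
        "\<And>n j. n1 \<le> n \<Longrightarrow> j \<in> {1, 2} \<Longrightarrow> - (Q * y n powr (1 - \<alpha> j)) \<le> s n * drift j (y n)"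
      by metis
    \<comment> \<open>jumps are asked for in the direction \<open>s n\<close> of the drift\<close>
    define B where "B n = (if ty n = i then {z. 2 * y n \<le> s n * z} else {})" for n
    have B [measurable]: "B n \<in> sets borel" for n unfolding B_def by auto
    define A where "A n = (if 1 \<le> n then {\<omega>\<in>space M. X n \<omega> \<in> B n} else {})" for n
    have A: "A n \<in> events" for n
    proof (cases "1 \<le> n")
      case True
      note [measurable] = rv[OF this]
      show ?thesis unfolding A_def using True by simp
    qed (simp add: A_def)
    define D where "D n = space M - {\<omega>\<in>space M. \<exists>m\<in>{n..N n}. y n < \<bar>\<Sum>i\<in>{n<..m}. (X i \<omega> - drift (ty i) (y n))\<bar>}" for n
    have D: "D n \<in> events" for n unfolding D_def by measurable
    have PD: "1 - \<eta> / 2 \<le> prob (D n)" if n: "n1 \<le> n" for n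
    proof -
      have "\<P>(\<omega> in M. \<exists>m\<in>{n..N n}. y n < \<bar>\<Sum>i\<in>{n<..m}. (X i \<omega> - drift (ty i) (y n))\<bar>)
          \<le> 9 * Q * (\<Sum>j\<in>{1, 2}. real (cnt j (N n)) * y n powr - \<alpha> j)"
        by (rule maximal_deviation[OF y0[OF n]])
      also have "\<dots> \<le> 9 * Q * (\<Sum>j\<in>{1, 2}. v j R)"
        using Q_pos by (intro mult_left_mono sum_mono cnt_v[OF n]) auto
      also have "\<dots> \<le> \<eta> / 2" using R by simp
      finally show ?thesis unfolding D_def by (subst prob_compl) auto
    qed
    have sub: "A n \<inter> D n \<subseteq> Gd n" if n: "n1 \<le> n" for n
    proof
      fix \<omega> assume \<omega>: "\<omega> \<in> A n \<inter> D n"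
      have sp: "\<omega> \<in> space M" using \<omega> by (auto simp: D_def)
      have big: "2 * y n \<le> s n * X n \<omega>" using \<omega> by (auto simp: A_def B_def split: if_splits)
      have "K * t n \<le> \<bar>S m \<omega> - S (n - 1) \<omega>\<bar>" if m: "m \<in> {n..N n}" for m
      proof -
        let ?d = "\<Sum>j\<in>{1, 2}. (real (cnt j m) - real (cnt j n)) * drift j (y n)"
        have nm: "n \<le> m" using m by simp
        have "S n \<omega> - S (n - 1) \<omega> = (\<Sum>i\<in>{n - 1<..n}. X i \<omega>)" by (rule S_diff) simp
        also have "{n - 1<..n} = {n}" using n1(5)[OF n] by auto
        finally have 1: "S n \<omega> - S (n - 1) \<omega> = X n \<omega>" by simp
        have 2: "\<bar>S m \<omega> - S n \<omega> - ?d\<bar> \<le> y n"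
        proof -
          have "\<bar>\<Sum>i\<in>{n<..m}. (X i \<omega> - drift (ty i) (y n))\<bar> \<le> y n"
            using \<omega> m by (auto simp: D_def not_less)
          then show ?thesis unfolding sum_minus_drift[OF nm] .
        qed
        have 3: "- (y n / 4) \<le> s n * ((real (cnt j m) - real (cnt j n)) * drift j (y n))" if j: "j \<in> {1, 2}" for j
        proof -
          let ?c = "real (cnt j m) - real (cnt j n)"
          have c: "0 \<le> ?c" "?c \<le> real (cnt j (N n))"
            using monoD[OF mono_cnt nm, of j] monoD[OF mono_cnt, of m "N n" j] m by auto
          have "?c * (Q * y n powr (1 - \<alpha> j)) \<le> real (cnt j (N n)) * (Q * y n powr (1 - \<alpha> j))"
            using c Q_pos by (intro mult_right_mono) auto
          also have "\<dots> = y n * (Q * (real (cnt j (N n)) * y n powr - \<alpha> j))"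
            using y0[OF n] by (simp add: powr_diff powr_minus field_simps)
          also have "\<dots> \<le> y n * (Q * v j R)"
            using y0[OF n] Q_pos cnt_v[OF n j] by (intro mult_left_mono) auto
          also have "\<dots> \<le> y n * (1 / 4)"
            using y0[OF n] R j by (intro mult_left_mono) auto
          finally have "?c * (Q * y n powr (1 - \<alpha> j)) \<le> y n / 4" by simp
          moreover have "?c * - (Q * y n powr (1 - \<alpha> j)) \<le> ?c * (s n * drift j (y n))"
            by (intro mult_left_mono s(2) n j c)
          ultimately show ?thesis by (simp add: algebra_simps)
        qed
        have 4: "- (y n / 2) \<le> s n * ?d"
          using 3[of 1] 3[of 2] by (simp add: algebra_simps)
        have sa: "\<bar>s n * z\<bar> = \<bar>z\<bar>" for z using s(1)[OF n] by (auto simp: abs_mult)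
        have "- y n \<le> s n * (S m \<omega> - S n \<omega> - ?d)" using 2 sa[of "S m \<omega> - S n \<omega> - ?d"] by linarith
        moreover have "s n * (S m \<omega> - S (n - 1) \<omega>) = s n * X n \<omega> + s n * (S m \<omega> - S n \<omega> - ?d) + s n * ?d"
          using 1 by (simp add: algebra_simps)
        ultimately have "y n / 2 \<le> s n * (S m \<omega> - S (n - 1) \<omega>)" using big 4 by linarith
        also have "\<dots> \<le> \<bar>S m \<omega> - S (n - 1) \<omega>\<bar>" using sa[of "S m \<omega> - S (n - 1) \<omega>"] by linarith
        finally have "y n / 2 \<le> \<bar>S m \<omega> - S (n - 1) \<omega>\<bar>" .
        moreover have "K * t n \<le> y n / 2" using R t0[OF n] by (simp add: y_def)
        ultimately show ?thesis by linarith
      qed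
      then show "\<omega> \<in> Gd n" using sp by (simp add: Gd_def)
    qed
    define pA where "pA k = \<P>(\<omega> in M. X k \<omega> \<in> B k)" for k
    define u where "u n = (if 0 < n \<and> ty n = i then 1 / (real (cnt i n) * f (real n)) else 0)" for n
    define c where "c = b * (2 * R) powr - p"
    have c: "0 < c" using b R0 by (simp add: c_def)
    have pA_ge: "c * u k \<le> pA k" if k: "n1 \<le> k" for k
    proof (cases "ty k = i")
      case True
      have x0: "x0 \<le> 2 * y k" using y_ge[OF k] y0[OF k] by simp
      have "c * u k = b * (2 * y k) powr - p"
        using True n1(2,5)[OF k] f1 f1_le[OF k] p R0
        by (simp add: u_def c_def y_def t_def powr_mult powr_powr powr_minus_divide)
      also have "\<dots> \<le> pA k"
        using s(1)[OF k]
      proof safe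
        assume "s k = 1"
        then show ?thesis using upper_tail[OF n1(5)[OF k] True x0] True by (simp add: pA_def B_def p_def)
      next
        assume "s k = - 1"
        then show ?thesis using lower_tail[OF n1(5)[OF k] True x0] True
          by (simp add: pA_def B_def p_def le_minus_iff)
      qed
      finally show ?thesis .
    qed (simp add: u_def pA_def)
    have "\<exists>n2. ln (2 / \<eta>) / c \<le> (\<Sum>k\<in>{n1..n2}. u k)"
    proof (rule ccontr)
      assume neg: "\<not> ?thesis"
      have u0: "0 \<le> u k" for k using f_pos[of "real k"] by (auto simp: u_def intro: less_imp_le)
      have "summable u"
      proof (rule summableI_nonneg_bounded[OF u0])
        fix n
        have "(\<Sum>k<n. u k) \<le> (\<Sum>k\<in>{..<n1} \<union> {n1..n}. u k)"
          using u0 by (intro sum_mono2) auto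
        also have "\<dots> = (\<Sum>k<n1. u k) + (\<Sum>k\<in>{n1..n}. u k)"
          by (rule sum.union_disjoint) auto
        also have "\<dots> \<le> (\<Sum>k<n1. u k) + ln (2 / \<eta>) / c" using neg by (meson add_left_mono linear)
        finally show "(\<Sum>k<n. u k) \<le> (\<Sum>k<n1. u k) + ln (2 / \<eta>) / c" .
      qed
      then show False
        using reciprocal_sum_diverges[OF top poly f_pos f_mono div] by (simp add: u_def[abs_def])
    qed
    then obtain n2 where n2: "ln (2 / \<eta>) / c \<le> (\<Sum>k\<in>{n1..n2}. u k)" by blast
    have "ln (2 / \<eta>) \<le> c * (\<Sum>k\<in>{n1..n2}. u k)" using n2 c by (simp add: divide_le_eq mult.commute)
    also have "\<dots> \<le> (\<Sum>k\<in>{n1..n2}. pA k)" unfolding sum_distrib_left by (intro sum_mono pA_ge) auto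
    finally have "- (\<Sum>k\<in>{n1..n2}. pA k) \<le> ln (\<eta> / 2)" using \<eta> by (simp add: ln_div)
    then have "exp (- (\<Sum>k\<in>{n1..n2}. pA k)) \<le> \<eta> / 2" using \<eta> by (simp add: ln_ge_iff)
    then have "1 - \<eta> / 2 \<le> 1 - exp (- (\<Sum>k\<in>{n1..n2}. pA k))" by simp
    also have "\<dots> \<le> prob (\<Union>k\<in>{n1..n2}. {\<omega>\<in>space M. X k \<omega> \<in> B k})"
      unfolding pA_def by (rule prob_UN_indep_ge[OF B]) (rule n1(5), simp)
    also have "(\<Union>k\<in>{n1..n2}. {\<omega>\<in>space M. X k \<omega> \<in> B k}) = (\<Union>k\<in>{n1..n2}. A k)"
      using n1(5) by (intro SUP_cong) (auto simp: A_def)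
    finally have PA: "1 - \<eta> / 2 \<le> prob (\<Union>k\<in>{n1..n2}. A k)" .
    have "1 - \<eta> \<le> (1 - \<eta> / 2) * (1 - \<eta> / 2)" using \<eta> by (simp add: algebra_simps)
    also have "\<dots> \<le> (1 - \<eta> / 2) * prob (\<Union>k\<in>{n1..n2}. A k)"
      using PA \<eta> by (intro mult_left_mono) auto
    also have "\<dots> \<le> prob (\<Union>k\<in>{n1..n2}. A k \<inter> D k)"
    proof (rule prob_UN_inter_ge[OF A D _ PD])
      fix k assume k: "n1 \<le> k" "k \<le> n2"
      define P where "P z \<longleftrightarrow> z k \<in> B k \<and> (\<forall>l\<in>{n1..<k}. z l \<notin> B l)" for z :: "nat \<Rightarrow> real"
      define R' where "R' z \<longleftrightarrow> \<not> (\<exists>m\<in>{k..N k}. y k < \<bar>\<Sum>i\<in>{k<..m}. (z i - drift (ty i) (y k))\<bar>)" for z :: "nat \<Rightarrow> real"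
      have k1: "1 \<le> k" and n11: "1 \<le> n1" using n1(5)[of k] n1(5)[of n1] k by auto
      have P_meas: "Measurable.pred (\<Pi>\<^sub>M i\<in>{1..k}. (borel :: real measure)) P"
      proof -
        have comp: "Measurable.pred (\<Pi>\<^sub>M i\<in>{1..k}. (borel :: real measure)) (\<lambda>z. z l \<in> B l)" if "l \<in> {1..k}" for l
        proof -
          have [measurable]: "(\<lambda>z. z l) \<in> borel_measurable (\<Pi>\<^sub>M i\<in>{1..k}. (borel :: real measure))"
            using that by (rule measurable_component_singleton)
          show ?thesis by measurable
        qed
        show ?thesis
          unfolding P_def using k1 n11
          by (intro pred_intros_logic pred_intros_finite comp) auto
      qed
      have R_meas: "Measurable.pred (\<Pi>\<^sub>M i\<in>{k<..N k}. (borel :: real measure)) R'"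
      proof -
        have comp: "(\<lambda>z. \<Sum>i\<in>{k<..m}. (z i - drift (ty i) (y k))) \<in> borel_measurable (\<Pi>\<^sub>M i\<in>{k<..N k}. (borel :: real measure))"
          if "m \<in> {k..N k}" for m
          using that by (intro borel_measurable_sum borel_measurable_diff measurable_component_singleton) auto
        show ?thesis
          unfolding R'_def
        proof (intro pred_intros_logic pred_intros_finite)
          fix m assume "m \<in> {k..N k}"
          note [measurable] = comp[OF this]
          show "Measurable.pred (\<Pi>\<^sub>M i\<in>{k<..N k}. (borel :: real measure))
             (\<lambda>z. y k < \<bar>\<Sum>i\<in>{k<..m}. (z i - drift (ty i) (y k))\<bar>)" by measurable
        qed auto
      qed
      have Pr: "P (restrict z {1..k}) \<longleftrightarrow> P z" for z
        unfolding P_def using k1 n11 by auto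
      have Rr: "R' (restrict z {k<..N k}) \<longleftrightarrow> R' z" for z
      proof -
        have "(\<Sum>i\<in>{k<..m}. (restrict z {k<..N k} i - drift (ty i) (y k)))
            = (\<Sum>i\<in>{k<..m}. (z i - drift (ty i) (y k)))" if "m \<in> {k..N k}" for m
          by (intro sum.cong) (use that in auto)
        then show ?thesis unfolding R'_def by simp
      qed
      have 1: "A k - (\<Union>l\<in>{n1..<k}. A l) = {\<omega>\<in>space M. P (\<lambda>i. X i \<omega>)}"
        using k1 n11 by (auto simp: A_def P_def)
      have 2: "D k = {\<omega>\<in>space M. R' (\<lambda>i. X i \<omega>)}" by (auto simp: D_def R'_def)
      show "prob ((A k - (\<Union>l\<in>{n1..<k}. A l)) \<inter> D k) = prob (A k - (\<Union>l\<in>{n1..<k}. A l)) * prob (D k)"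
        unfolding 1 2
      proof (rule prob_indep_restrict[OF indep _ _ _ P_meas R_meas])
        show "P (restrict z {1..k}) \<longleftrightarrow> P z" for z by (rule Pr)
        show "R' (restrict z {k<..N k}) \<longleftrightarrow> R' z" for z by (rule Rr)
      qed auto
    qed
    also have "\<dots> \<le> prob (\<Union>n\<in>{n0..}. Gd n)"
    proof (rule finite_measure_mono)
      show "(\<Union>k\<in>{n1..n2}. A k \<inter> D k) \<subseteq> (\<Union>n\<in>{n0..}. Gd n)"
        using sub n1(4) by fastforce
    qed auto
    finally show ?thesis .
  qed
  have "AE \<omega> in M. \<omega> \<in> (\<Union>n\<in>{n0..}. Gd n)" for n0
  proof -
    have "1 \<le> prob (\<Union>n\<in>{n0..}. Gd n)"
    proof (rule field_le_epsilon)
      fix \<eta> :: real assume "0 < \<eta>"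
      then have "1 - min \<eta> (1/2) \<le> prob (\<Union>n\<in>{n0..}. Gd n)" by (intro main) auto
      then show "1 \<le> prob (\<Union>n\<in>{n0..}. Gd n) + \<eta>" by linarith
    qed
    then have "prob (\<Union>n\<in>{n0..}. Gd n) = 1" by (intro antisym) auto
    then show ?thesis by (subst (asm) prob_eq_1) auto
  qed
  then have "AE \<omega> in M. \<forall>n0. \<omega> \<in> (\<Union>n\<in>{n0..}. Gd n)" by (simp add: AE_all_countable)
  then show ?thesis
  proof eventually_elim
    case (elim \<omega>)
    then show ?case
      unfolding frequently_def eventually_sequentially
      by (auto simp: Gd_def t_def p_def)
  qed
qed

end

section \<open>The integral test and upper limits\<close>

lemma dyadic_block_sum:
  fixes c :: "nat \<Rightarrow> ennreal"
  shows "x < 1 \<Longrightarrow> (\<Sum>l. c l * indicator {2 ^ l..<2 ^ Suc l::real} (x::real)) = 0"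
    and "2 ^ k \<le> x \<Longrightarrow> x < 2 ^ Suc k \<Longrightarrow> (\<Sum>l. c l * indicator {2 ^ l..<2 ^ Suc l::real} (x::real)) = c k"
proof -
  assume x: "x < 1"
  have "indicator {2 ^ l..<2 ^ Suc l::real} x = (0::ennreal)" for l
  proof -
    have "(1::real) \<le> 2 ^ l" by simp
    then have "\<not> 2 ^ l \<le> x" using x by linarith
    then show ?thesis by (simp add: indicator_def)
  qed
  then show "(\<Sum>l. c l * indicator {2 ^ l..<2 ^ Suc l::real} x) = 0" by simp
next
  assume x: "2 ^ k \<le> x" "x < 2 ^ Suc k"
  have "c l * indicator {2 ^ l..<2 ^ Suc l::real} x = 0" if "l \<noteq> k" for l
  proof (cases "l < k")
    case True
    then have "(2::real) ^ Suc l \<le> 2 ^ k" by (intro power_increasing) auto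
    then show ?thesis using x by (auto simp: indicator_def)
  next
    case False
    then have "(2::real) ^ Suc k \<le> 2 ^ l" using that by (intro power_increasing) auto
    then show ?thesis using x by (auto simp: indicator_def)
  qed
  then have "(\<Sum>l. c l * indicator {2 ^ l..<2 ^ Suc l::real} x) = (\<Sum>l\<in>{k}. c l * indicator {2 ^ l..<2 ^ Suc l::real} x)"
    by (intro suminf_finite) auto
  also have "\<dots> = c k" using x by (simp add: indicator_def)
  finally show "(\<Sum>l. c l * indicator {2 ^ l..<2 ^ Suc l::real} x) = c k" .
qed

lemma dyadic_block_exists:
  fixes x :: real
  assumes "1 \<le> x"
  obtains k where "2 ^ k \<le> x" "x < 2 ^ Suc k"
proof -
  define k where "k = nat \<lfloor>log 2 x\<rfloor>"
  have l: "0 \<le> log 2 x" using assms by simp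
  have "real k \<le> log 2 x" "log 2 x < real (Suc k)"
    using l unfolding k_def by (simp_all add: of_nat_nat; linarith)+
  then have "2 powr real k \<le> x" "x < 2 powr real (Suc k)"
    using assms by (simp_all add: le_log_iff log_less_iff)
  then show ?thesis using that[of k] by (simp only: powr_realpow zero_less_numeral)
qed

lemma nn_integral_dyadic_step:
  fixes u :: "nat \<Rightarrow> real"
  assumes u: "\<And>k. 0 \<le> u k"
  shows "(\<integral>\<^sup>+x. (\<Sum>l. ennreal (u l / 2 ^ l) * indicator {2 ^ l..<2 ^ Suc l::real} x) \<partial>lborel) = (\<Sum>l. ennreal (u l))"
proof -
  have "(\<integral>\<^sup>+x. (\<Sum>l. ennreal (u l / 2 ^ l) * indicator {2 ^ l..<2 ^ Suc l::real} x) \<partial>lborel)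
     = (\<Sum>l. \<integral>\<^sup>+x. ennreal (u l / 2 ^ l) * indicator {2 ^ l..<2 ^ Suc l::real} x \<partial>lborel)"
    by (rule nn_integral_suminf) measurable
  also have "\<dots> = (\<Sum>l. ennreal (u l))"
  proof (rule suminf_cong)
    fix l
    have "(\<integral>\<^sup>+x. ennreal (u l / 2 ^ l) * indicator {2 ^ l..<2 ^ Suc l::real} x \<partial>lborel)
        = ennreal (u l / 2 ^ l) * ennreal (2 ^ Suc l - 2 ^ l)"
      by (subst nn_integral_cmult_indicator) auto
    also have "\<dots> = ennreal (u l)"
      using u[of l] by (subst ennreal_mult[symmetric]) auto
    finally show "(\<integral>\<^sup>+x. ennreal (u l / 2 ^ l) * indicator {2 ^ l..<2 ^ Suc l::real} x \<partial>lborel) = ennreal (u l)" .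
  qed
  finally show ?thesis .
qed

text \<open>On \<open>[2\<^sup>k, 2\<^bsup>k+1\<^esup>)\<close> monotonicity puts \<open>1 / (x f x)\<close> between \<open>1 / (2\<^bsup>k+1\<^esup> f(2\<^bsup>k+1\<^esup>))\<close> and
\<open>1 / (2\<^sup>k f(2\<^sup>k))\<close>, and the interval has length \<open>2\<^sup>k\<close>.\<close>

lemma log_integral_finite_iff:
  assumes f_pos: "\<And>x. 1 \<le> x \<Longrightarrow> 0 < f x" and f_mono: "mono_on {1..} f"
  shows "log_integral f < \<infinity> \<longleftrightarrow> summable (\<lambda>k. 1 / f (2 ^ k))"
proof
  have F: "0 < f (2 ^ k)" for k by (rule f_pos) simp
  have blk: "2 ^ Suc k * f (2 ^ Suc k) \<ge> x * f x" "2 ^ k * f (2 ^ k) \<le> x * f x" "0 < x * f x"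
    if "2 ^ k \<le> x" "x < 2 ^ Suc k" for x k
  proof -
    have k1: "(1::real) \<le> 2 ^ k" by simp
    have x1: "1 \<le> x" using that(1) k1 by linarith
    show "0 < x * f x" using f_pos[OF x1] x1 by simp
    show "2 ^ k * f (2 ^ k) \<le> x * f x"
      using that k1 x1 F[of k] by (intro mult_mono mono_onD[OF f_mono]) auto
    show "x * f x \<le> 2 ^ Suc k * f (2 ^ Suc k)"
    proof (rule mult_mono)
      show "f x \<le> f (2 ^ Suc k)" by (rule mono_onD[OF f_mono]) (use that x1 in auto)
    qed (use that x1 f_pos[OF x1] in auto)
  qed
  {
    assume sum: "summable (\<lambda>k. 1 / f (2 ^ k))"
    have "log_integral f \<le> (\<integral>\<^sup>+x. (\<Sum>l. ennreal (1 / f (2 ^ l) / 2 ^ l) * indicator {2 ^ l..<2 ^ Suc l::real} x) \<partial>lborel)"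
      unfolding log_integral_def
    proof (rule nn_integral_mono)
      fix x :: real
      show "ennreal (1 / (x * f x)) * indicator {1..} x
          \<le> (\<Sum>l. ennreal (1 / f (2 ^ l) / 2 ^ l) * indicator {2 ^ l..<2 ^ Suc l::real} x)"
      proof (cases "1 \<le> x")
        case True
        then obtain k where k: "2 ^ k \<le> x" "x < 2 ^ Suc k" by (rule dyadic_block_exists)
        have "1 / (x * f x) \<le> 1 / (2 ^ k * f (2 ^ k))"
          by (rule divide_left_mono[OF blk(2)[OF k] _ mult_pos_pos[OF blk(3)[OF k]]]) (use F[of k] in auto)
        then show ?thesis
          unfolding dyadic_block_sum(2)[OF k] using True by (simp add: ennreal_leI mult.commute)
      qed simp
    qed
    also have "\<dots> = (\<Sum>l. ennreal (1 / f (2 ^ l)))"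
      by (rule nn_integral_dyadic_step) (use F in \<open>auto intro: less_imp_le\<close>)
    also have "\<dots> = ennreal (\<Sum>l. 1 / f (2 ^ l))"
      by (rule suminf_ennreal2[OF _ sum]) (use F in \<open>auto intro: less_imp_le\<close>)
    also have "\<dots> < \<infinity>" by simp
    finally show "log_integral f < \<infinity>" .
  }
  {
    assume fin: "log_integral f < \<infinity>"
    have "(\<Sum>l. ennreal (1 / (2 * f (2 ^ Suc l))))
       = (\<integral>\<^sup>+x. (\<Sum>l. ennreal (1 / (2 * f (2 ^ Suc l)) / 2 ^ l) * indicator {2 ^ l..<2 ^ Suc l::real} x) \<partial>lborel)"
      by (rule nn_integral_dyadic_step[symmetric]) (use F[of "Suc _"] in \<open>auto intro: less_imp_le\<close>)
    also have "\<dots> \<le> log_integral f"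
      unfolding log_integral_def
    proof (rule nn_integral_mono)
      fix x :: real
      show "(\<Sum>l. ennreal (1 / (2 * f (2 ^ Suc l)) / 2 ^ l) * indicator {2 ^ l..<2 ^ Suc l::real} x)
          \<le> ennreal (1 / (x * f x)) * indicator {1..} x"
      proof (cases "1 \<le> x")
        case True
        then obtain k where k: "2 ^ k \<le> x" "x < 2 ^ Suc k" by (rule dyadic_block_exists)
        have "1 / (2 ^ Suc k * f (2 ^ Suc k)) \<le> 1 / (x * f x)"
          by (rule divide_left_mono[OF blk(1)[OF k] _ mult_pos_pos[OF _ blk(3)[OF k]]]) (use F[of "Suc k"] in auto)
        then show ?thesis
          unfolding dyadic_block_sum(2)[OF k] using True by (simp add: ennreal_leI ac_simps)
      next
        case False
        then show ?thesis by (subst dyadic_block_sum(1)) auto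
      qed
    qed
    finally have "(\<Sum>l. ennreal (1 / (2 * f (2 ^ Suc l)))) \<noteq> top" using fin by (auto simp: top_unique)
    then have "summable (\<lambda>l. 1 / (2 * f (2 ^ Suc l)))"
      by (intro summable_suminf_not_top) (use F[of "Suc _"] in \<open>auto intro: less_imp_le\<close>)
    then have "summable (\<lambda>l. 2 * (1 / (2 * f (2 ^ Suc l))))" by (rule summable_mult)
    then have "summable (\<lambda>l. 1 / f (2 ^ Suc l))" by simp
    then show "summable (\<lambda>k. 1 / f (2 ^ k))" by (subst (asm) summable_Suc_iff[of "\<lambda>k. 1 / f (2 ^ k)"])
  }
qed

lemma limsup_ereal_eq_0:
  fixes u :: "nat \<Rightarrow> real"
  assumes "\<And>n. 0 \<le> u n" and "\<And>\<epsilon>. 0 < \<epsilon> \<Longrightarrow> \<forall>\<^sub>F n in sequentially. u n \<le> \<epsilon>"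
  shows "limsup (\<lambda>n. ereal (u n)) = 0"
proof -
  have "u \<longlonglongrightarrow> 0"
  proof (rule tendstoI)
    fix e :: real assume "0 < e"
    then show "\<forall>\<^sub>F n in sequentially. dist (u n) 0 < e"
      using assms(2)[of "e/2"] by (auto elim!: eventually_mono simp: assms(1))
  qed
  then have "(\<lambda>n. ereal (u n)) \<longlonglongrightarrow> ereal 0" by simp
  then show ?thesis by (intro lim_imp_Limsup) (auto simp: zero_ereal_def)
qed

lemma limsup_ereal_finiteD:
  fixes u :: "nat \<Rightarrow> real"
  assumes "limsup (\<lambda>n. ereal (u n)) < \<infinity>"
  obtains K :: nat where "\<forall>\<^sub>F n in sequentially. u n < real K"
proof -
  obtain K :: nat where "limsup (\<lambda>n. ereal (u n)) < ereal (real K)"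
    using assms less_PInf_Ex_of_nat[of "limsup (\<lambda>n. ereal (u n))"] by auto
  then have "\<forall>\<^sub>F n in sequentially. ereal (u n) < ereal (real K)" by (rule Limsup_lessD)
  then have "\<forall>\<^sub>F n in sequentially. u n < real K" by eventually_elim simp
  then show ?thesis by (rule that)
qed

lemma limsup_ereal_eq_PInf:
  fixes u :: "nat \<Rightarrow> real"
  assumes "\<And>K::nat. \<exists>\<^sub>F n in sequentially. real K \<le> u n"
  shows "limsup (\<lambda>n. ereal (u n)) = \<infinity>"
proof (rule ccontr)
  assume "limsup (\<lambda>n. ereal (u n)) \<noteq> \<infinity>"
  then have "limsup (\<lambda>n. ereal (u n)) < \<infinity>" by simp
  then obtain K :: nat where "\<forall>\<^sub>F n in sequentially. u n < real K" by (rule limsup_ereal_finiteD)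
  then show False using assms[of K] by (simp add: frequently_def not_le)
qed

context two_type_sequence
begin

lemma random_increment_eq: "random_increment X a n \<omega> = S (n + a n \<omega>) \<omega> - S n \<omega>"
proof -
  have "{0<..m} = {1..m}" for m :: nat by auto
  then show ?thesis by (simp add: random_increment_def partial_sum_def S_def)
qed

section \<open>The dichotomy for random lengths\<close>

text \<open>The lengths \<open>a n\<close> are random and bounded only by a horizon \<open>H C\<close> with a random \<open>C\<close>.  The two preceding theorems
hold almost surely for all natural \<open>C\<close> at once and uniformly in the end point, so on almost
every path they may be applied with the \<open>C\<close> and the lengths of that path.\<close>

theorem increment_dichotomy:
  fixes f :: "real \<Rightarrow> real" and H :: "nat \<Rightarrow> nat \<Rightarrow> nat" and a :: "nat \<Rightarrow> 'a \<Rightarrow> nat"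
    and B :: "nat \<Rightarrow> real" and \<mu> :: "nat \<Rightarrow> real"
  assumes i: "i \<in> {1, 2}" and top: "filterlim (cnt i) at_top sequentially"
    and H_mono: "\<And>C. mono (H C)"
    and cnt_H: "\<And>C. \<exists>\<kappa>>0. \<forall>j\<in>{1, 2}. \<forall>\<^sub>F n in sequentially.
      real (cnt j (H C n)) \<le> \<kappa> * real (cnt i n) powr (\<alpha> j / \<alpha> i) * ln (real n) powr - \<mu> j"
    and \<mu>: "\<And>j. j \<in> {1, 2} \<Longrightarrow> 0 \<le> \<mu> j"
    and \<mu>_cases: "\<And>j. j \<in> {1, 2} \<Longrightarrow> (\<alpha> i \<le> \<alpha> j \<and> \<mu> j = 0) \<or> 1 < \<mu> j + \<alpha> j / \<alpha> i"
    and poly: "\<forall>\<^sub>F n in sequentially. n \<le> cnt i n ^ q"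
    and b: "0 < b"
    and upper_tail: "\<And>k x. 1 \<le> k \<Longrightarrow> ty k = i \<Longrightarrow> x0 \<le> x \<Longrightarrow> b * x powr - \<alpha> i \<le> \<P>(\<omega> in M. x \<le> X k \<omega>)"
    and lower_tail: "\<And>k x. 1 \<le> k \<Longrightarrow> ty k = i \<Longrightarrow> x0 \<le> x \<Longrightarrow> b * x powr - \<alpha> i \<le> \<P>(\<omega> in M. X k \<omega> \<le> - x)"
    and f: "growth_fun f"
    and B: "0 < lo" "0 < hi" "\<forall>\<^sub>F n in sequentially.
      lo * real (cnt i n) powr (1 / \<alpha> i) \<le> B n \<and> B n \<le> hi * real (cnt i n) powr (1 / \<alpha> i)"
    and B0: "\<And>n. 0 \<le> B n"
    and a_pos: "\<And>n \<omega>. 1 \<le> n \<Longrightarrow> \<omega> \<in> space M \<Longrightarrow> 0 < a n \<omega>"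
    and a_bound: "AE \<omega> in M. \<exists>C. \<forall>\<^sub>F n in sequentially. n + a n \<omega> \<le> H C n"
  shows "AE \<omega> in M.
      (limsup (\<lambda>n. ereal (\<bar>random_increment X a n \<omega>\<bar> / (B n * f (real n) powr (1 / \<alpha> i)))) = 0
         \<longleftrightarrow> log_integral f < \<infinity>) \<and>
      (limsup (\<lambda>n. ereal (\<bar>random_increment X a n \<omega>\<bar> / (B n * f (real n) powr (1 / \<alpha> i)))) = \<infinity>
         \<longleftrightarrow> log_integral f = \<infinity>)"
proof -
  have f_pos: "0 < f x" if "1 \<le> x" for x using f that by (auto simp: growth_fun_def)
  have f_mono: "mono_on {1..} f" using f by (simp add: growth_fun_def)
  have p: "0 < \<alpha> i" by (rule \<alpha>_pos[OF i])
  define t where "t n = (real (cnt i n) * f (real n)) powr (1 / \<alpha> i)" for n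
  define r where "r n \<omega> = \<bar>random_increment X a n \<omega>\<bar> / (B n * f (real n) powr (1 / \<alpha> i))" for n \<omega>
  have r0: "0 \<le> r n \<omega>" for n \<omega> using B0 by (simp add: r_def)
  have Bt: "\<forall>\<^sub>F n in sequentially. 0 < t n \<and> lo * t n \<le> B n * f (real n) powr (1 / \<alpha> i)
      \<and> B n * f (real n) powr (1 / \<alpha> i) \<le> hi * t n"
  proof -
    have "\<forall>\<^sub>F n in sequentially. 1 \<le> cnt i n" using top by (simp add: filterlim_at_top)
    then show ?thesis using B(3) eventually_ge_at_top[of 1]
    proof eventually_elim
      case (elim n)
      have fn: "0 < f (real n)" using elim by (intro f_pos) auto
      have "t n = real (cnt i n) powr (1 / \<alpha> i) * f (real n) powr (1 / \<alpha> i)"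
        using fn by (simp add: t_def powr_mult)
      moreover have "lo * real (cnt i n) powr (1 / \<alpha> i) * f (real n) powr (1 / \<alpha> i) \<le> B n * f (real n) powr (1 / \<alpha> i)"
        "B n * f (real n) powr (1 / \<alpha> i) \<le> hi * real (cnt i n) powr (1 / \<alpha> i) * f (real n) powr (1 / \<alpha> i)"
        using elim by (intro mult_right_mono; simp)+
      moreover have "0 < t n" using fn elim by (simp add: t_def)
      ultimately show ?case by (simp add: ac_simps)
    qed
  qed
  show ?thesis
  proof (cases "summable (\<lambda>k. 1 / f (2 ^ k))")
    case True
    have fin: "log_integral f < \<infinity>" using True log_integral_finite_iff[of f] f_pos f_mono by blast
    have "AE \<omega> in M. \<forall>\<^sub>F n in sequentially. \<forall>m\<in>{n..H C n}. \<bar>S m \<omega> - S n \<omega>\<bar> \<le> 1 / real (Suc K) * t n" for C K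
    proof -
      obtain \<kappa> where \<kappa>: "0 < \<kappa>" "\<And>j. j \<in> {1, 2} \<Longrightarrow> \<forall>\<^sub>F n in sequentially.
          real (cnt j (H C n)) \<le> \<kappa> * real (cnt i n) powr (\<alpha> j / \<alpha> i) * ln (real n) powr - \<mu> j"
        using cnt_H[of C] by blast
      show ?thesis unfolding t_def
        by (rule eventually_small_increments[OF i top H_mono \<kappa> \<mu> \<mu>_cases f_pos f_mono True]) auto
    qed
    then have "AE \<omega> in M. \<forall>C K. \<forall>\<^sub>F n in sequentially. \<forall>m\<in>{n..H C n}. \<bar>S m \<omega> - S n \<omega>\<bar> \<le> 1 / real (Suc K) * t n"
      by (simp add: AE_all_countable)
    then show ?thesis using a_bound
    proof eventually_elim
      case (elim \<omega>)
      obtain C where C: "\<forall>\<^sub>F n in sequentially. n + a n \<omega> \<le> H C n" using elim(2) by blast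
      have "limsup (\<lambda>n. ereal (r n \<omega>)) = 0"
      proof (rule limsup_ereal_eq_0[OF r0])
        fix \<epsilon> :: real assume \<epsilon>: "0 < \<epsilon>"
        obtain K where K: "inverse (real (Suc K)) < lo * \<epsilon>"
          using reals_Archimedean[of "lo * \<epsilon>"] B(1) \<epsilon> by auto
        from elim(1) have "\<forall>\<^sub>F n in sequentially. \<forall>m\<in>{n..H C n}. \<bar>S m \<omega> - S n \<omega>\<bar> \<le> 1 / real (Suc K) * t n" by blast
        then show "\<forall>\<^sub>F n in sequentially. r n \<omega> \<le> \<epsilon>" using C Bt
        proof eventually_elim
          case (elim n)
          have "\<bar>random_increment X a n \<omega>\<bar> \<le> 1 / real (Suc K) * t n"
            unfolding random_increment_eq using elim by auto
          also have "\<dots> \<le> lo * \<epsilon> * t n"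
            using K elim by (intro mult_right_mono) (auto simp: inverse_eq_divide)
          also have "\<dots> \<le> \<epsilon> * (B n * f (real n) powr (1 / \<alpha> i))"
            using mult_left_mono[of "lo * t n" "B n * f (real n) powr (1 / \<alpha> i)" \<epsilon>] elim \<epsilon> by (simp add: ac_simps)
          moreover have "0 < B n * f (real n) powr (1 / \<alpha> i)"
            using elim B(1) by (smt (verit) mult_pos_pos)
          ultimately show ?case unfolding r_def by (simp add: divide_le_eq)
        qed
      qed
      then show ?case using fin by (simp add: r_def)
    qed
  next
    case False
    have inf: "log_integral f = \<infinity>"
      using False log_integral_finite_iff[of f] f_pos f_mono by (simp add: less_top[symmetric])
    have "AE \<omega> in M. \<exists>\<^sub>F n in sequentially. \<forall>m\<in>{n..H C n}. real (Suc K) * t n \<le> \<bar>S m \<omega> - S (n - 1) \<omega>\<bar>" for C K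
    proof -
      obtain \<kappa> where \<kappa>: "0 < \<kappa>" "\<And>j. j \<in> {1, 2} \<Longrightarrow> \<forall>\<^sub>F n in sequentially.
          real (cnt j (H C n)) \<le> \<kappa> * real (cnt i n) powr (\<alpha> j / \<alpha> i) * ln (real n) powr - \<mu> j"
        using cnt_H[of C] by blast
      have "\<forall>\<^sub>F n in sequentially. real (cnt j (H C n)) \<le> \<kappa> * real (cnt i n) powr (\<alpha> j / \<alpha> i)" if j: "j \<in> {1, 2}" for j
      proof -
        have "\<forall>\<^sub>F n in sequentially. 1 \<le> ln (real n)" by real_asymp
        with \<kappa>(2)[OF j] show ?thesis
        proof eventually_elim
          case (elim n)
          have "ln (real n) powr - \<mu> j \<le> 1"
            using powr_mono[of "- \<mu> j" 0 "ln (real n)"] \<mu>[OF j] elim by simp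
          then have "\<kappa> * real (cnt i n) powr (\<alpha> j / \<alpha> i) * ln (real n) powr - \<mu> j \<le> \<kappa> * real (cnt i n) powr (\<alpha> j / \<alpha> i)"
            using \<kappa>(1) by (intro mult_left_le) auto
          then show ?case using elim by linarith
        qed
      qed
      note io = infinitely_often_large_increments[OF i top \<kappa>(1) this poly b upper_tail lower_tail f_pos f_mono False]
      show ?thesis unfolding t_def by (rule io) auto
    qed
    then have "AE \<omega> in M. \<forall>C K. \<exists>\<^sub>F n in sequentially. \<forall>m\<in>{n..H C n}. real (Suc K) * t n \<le> \<bar>S m \<omega> - S (n - 1) \<omega>\<bar>"
      by (simp add: AE_all_countable)
    then show ?thesis using a_bound AE_space
    proof eventually_elim
      case (elim \<omega>)
      obtain C where C: "\<forall>\<^sub>F n in sequentially. n + a n \<omega> \<le> H C n" using elim(2) by blast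
      have "limsup (\<lambda>n. ereal (r n \<omega>)) = \<infinity>"
      proof (rule limsup_ereal_eq_PInf)
        fix L :: nat
        obtain K where K: "hi * real L \<le> real (Suc K)"
          using real_arch_simple[of "hi * real L"] by (metis le_SucI of_nat_le_iff order_trans of_nat_mono lessI less_imp_le_nat)
        define good where "good n \<longleftrightarrow> 1 \<le> n \<and> n + a n \<omega> \<le> H C n \<and> 0 < t n
            \<and> B n * f (real n) powr (1 / \<alpha> i) \<le> hi * t n \<and> lo * t n \<le> B n * f (real n) powr (1 / \<alpha> i)" for n
        have "\<forall>\<^sub>F n in sequentially. good n"
          using C Bt eventually_ge_at_top[of 1] by eventually_elim (auto simp: good_def)
        then obtain n1 where n1: "\<forall>n\<ge>n1. good n"
          by (auto simp: eventually_sequentially)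
        show "\<exists>\<^sub>F n in sequentially. real L \<le> r n \<omega>"
          unfolding frequently_sequentially
        proof
          fix n0
          have "\<exists>\<^sub>F n in sequentially. \<forall>m\<in>{n..H C n}. real (Suc K) * t n \<le> \<bar>S m \<omega> - S (n - 1) \<omega>\<bar>"
            using elim(1) by blast
          then obtain n where n: "Suc (max n0 n1) \<le> n" "\<forall>m\<in>{n..H C n}. real (Suc K) * t n \<le> \<bar>S m \<omega> - S (n - 1) \<omega>\<bar>"
            unfolding frequently_sequentially by blast
          define k where "k = n - 1"
          have k: "n = Suc k" "n0 \<le> k" "n1 \<le> k" using n(1) by (auto simp: k_def)
          have k1: "1 \<le> k" "k + a k \<omega> \<le> H C k" "0 < t k" "B k * f (real k) powr (1 / \<alpha> i) \<le> hi * t k"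
              "lo * t k \<le> B k * f (real k) powr (1 / \<alpha> i)"
            using n1 k(3) unfolding good_def by blast+
          have "k + a k \<omega> \<in> {n..H C n}"
            using a_pos[OF k1(1) elim(3)] k1(2) monoD[OF H_mono, of k n C] k(1) by auto
          then have "real (Suc K) * t n \<le> \<bar>random_increment X a k \<omega>\<bar>"
            using n(2) unfolding random_increment_eq k_def[symmetric] by blast
          moreover have "t k \<le> t n"
            unfolding t_def
          proof (intro powr_mono2 mult_mono)
            show "real (cnt i k) \<le> real (cnt i n)" using monoD[OF mono_cnt, of k n i] k(1) by simp
            show "f (real k) \<le> f (real n)" by (rule mono_onD[OF f_mono]) (use k1 k in auto)
            show "0 \<le> f (real k)" "0 \<le> real (cnt i k) * f (real k)" using f_pos[of "real k"] k1 by auto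
          qed (use p in auto)
          then have "real (Suc K) * t k \<le> real (Suc K) * t n" by (intro mult_left_mono) auto
          moreover have "real L * (B k * f (real k) powr (1 / \<alpha> i)) \<le> real L * (hi * t k)"
            by (intro mult_left_mono k1) auto
          moreover have "real L * (hi * t k) = hi * real L * t k" by simp
          moreover have "hi * real L * t k \<le> real (Suc K) * t k" using k1 K by (intro mult_right_mono) auto
          ultimately have "real L * (B k * f (real k) powr (1 / \<alpha> i)) \<le> \<bar>random_increment X a k \<omega>\<bar>"
            by linarith
          moreover have "0 < B k * f (real k) powr (1 / \<alpha> i)"
            using k1 B(1) by (smt (verit) mult_pos_pos)
          ultimately have "real L \<le> r k \<omega>" unfolding r_def by (simp add: le_divide_eq)
          then show "\<exists>n\<ge>n0. real L \<le> r n \<omega>" using k(2) by blast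
        qed
      qed
      then show ?case using inf by (simp add: r_def)
    qed
  qed
qed

end

lemma powr_le_imp_le_powr:
  fixes x y :: real
  assumes "0 \<le> x" "0 \<le> y" "0 < a" "0 \<le> K" "x powr a \<le> K * y powr b"
  shows "x \<le> K powr (1 / a) * y powr (b / a)"
proof -
  have "x = (x powr a) powr (1 / a)" using assms by (simp add: powr_powr)
  also have "\<dots> \<le> (K * y powr b) powr (1 / a)" using assms by (intro powr_mono2) auto
  also have "\<dots> = K powr (1 / a) * y powr (b / a)" using assms by (simp add: powr_mult powr_powr)
  finally show ?thesis .
qed

lemma linear_horizon:
  assumes "\<forall>\<^sub>F n in sequentially. real n \<le> K * z n"
  shows "\<forall>\<^sub>F n in sequentially. real (n + C * n) \<le> real (C + 1) * K * z n"
    and "filterlim (\<lambda>n. n + C * n) at_top sequentially"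
proof -
  show "\<forall>\<^sub>F n in sequentially. real (n + C * n) \<le> real (C + 1) * K * z n"
    using assms
  proof eventually_elim
    case (elim n)
    have "real (n + C * n) = real (C + 1) * real n" by (simp add: algebra_simps)
    also have "\<dots> \<le> real (C + 1) * (K * z n)" by (intro mult_left_mono elim) simp
    finally show ?case by simp
  qed
  show "filterlim (\<lambda>n. n + C * n) at_top sequentially"
    by (rule filterlim_at_top_mono[OF filterlim_ident]) (auto intro: always_eventually)
qed

context two_type_sequence
begin

section \<open>Growth of the two counts\<close>

lemma cnt_1_plus_cnt_2: "cnt 1 n + cnt 2 n = n"
proof (induction n)
  case (Suc n)
  then show ?case using ty[of "Suc n"] by (auto simp: cnt_Suc)
qed simp

lemma cnt_add_le: "cnt j (n + k) \<le> cnt j n + k"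
  by (induction k) (auto simp: cnt_Suc)

lemma polynomial_growth:
  assumes top: "filterlim (cnt i) at_top sequentially"
    and le: "\<forall>\<^sub>F n in sequentially. real n \<le> K * real (cnt i n) powr s"
  shows "\<exists>q. \<forall>\<^sub>F n in sequentially. n \<le> cnt i n ^ q"
proof -
  define q where "q = nat \<lceil>s\<rceil> + 1"
  have q: "s < real q" unfolding q_def by linarith
  have "\<forall>\<^sub>F z in at_top. K * z powr s \<le> z powr real q" using q by real_asymp
  from eventually_compose_filterlim[OF this filterlim_compose[OF filterlim_real_sequentially top]]
  have "\<forall>\<^sub>F n in sequentially. K * real (cnt i n) powr s \<le> real (cnt i n) powr real q" .
  moreover have "\<forall>\<^sub>F n in sequentially. 1 \<le> cnt i n" using top by (simp add: filterlim_at_top)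
  ultimately have "\<forall>\<^sub>F n in sequentially. n \<le> cnt i n ^ q"
    using le
  proof eventually_elim
    case (elim n)
    have "real n \<le> real (cnt i n) powr real q" using elim by linarith
    also have "\<dots> = real (cnt i n ^ q)" using elim by (simp add: powr_realpow)
    finally show ?case by (simp only: of_nat_le_iff)
  qed
  then show ?thesis by blast
qed

context
  fixes \<Lambda> :: ereal
  assumes top: "\<And>j. j \<in> {1, 2} \<Longrightarrow> filterlim (cnt j) at_top sequentially"
    and \<alpha>_less: "\<alpha> 1 < \<alpha> 2"
    and lim: "(\<lambda>n. ereal (real (cnt 1 n) powr \<alpha> 2 / real (cnt 2 n) powr \<alpha> 1)) \<longlonglongrightarrow> \<Lambda>"
begin

lemma cnt_pos: "\<forall>\<^sub>F n in sequentially. 1 \<le> cnt 1 n \<and> 1 \<le> cnt 2 n"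
  using top[OF type_cases(1)] top[OF type_cases(2)] by (auto simp: filterlim_at_top eventually_conj_iff)

lemma \<alpha>12_pos: "0 < \<alpha> 1" "0 < \<alpha> 2"
  using \<alpha>_pos by auto

text \<open>The limit \<open>\<Lambda>\<close> enters through two one-sided comparisons that \<open>\<Lambda> > 0\<close> and \<open>\<Lambda> < \<infinity>\<close>
give.\<close>

lemma cnt_2_le:
  assumes "0 < \<Lambda>"
  obtains K where "1 \<le> K" "\<forall>\<^sub>F n in sequentially. real (cnt 2 n) \<le> K * real (cnt 1 n) powr (\<alpha> 2 / \<alpha> 1)"
proof -
  obtain \<delta> where \<delta>: "0 < ereal \<delta>" "ereal \<delta> < \<Lambda>"
    using ereal_dense2[OF assms] by auto
  define K where "K = max 1 ((1 / \<delta>) powr (1 / \<alpha> 1))"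
  have "\<forall>\<^sub>F n in sequentially. ereal \<delta> < ereal (real (cnt 1 n) powr \<alpha> 2 / real (cnt 2 n) powr \<alpha> 1)"
    by (rule order_tendstoD(1)[OF lim \<delta>(2)])
  then have "\<forall>\<^sub>F n in sequentially. real (cnt 2 n) \<le> K * real (cnt 1 n) powr (\<alpha> 2 / \<alpha> 1)"
    using cnt_pos
  proof eventually_elim
    case (elim n)
    have "real (cnt 2 n) powr \<alpha> 1 \<le> 1 / \<delta> * real (cnt 1 n) powr \<alpha> 2"
      using elim \<delta>(1) by (simp add: field_simps)
    then have "real (cnt 2 n) \<le> (1 / \<delta>) powr (1 / \<alpha> 1) * real (cnt 1 n) powr (\<alpha> 2 / \<alpha> 1)"
      using \<delta>(1) \<alpha>12_pos by (intro powr_le_imp_le_powr) auto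
    also have "\<dots> \<le> K * real (cnt 1 n) powr (\<alpha> 2 / \<alpha> 1)"
      unfolding K_def by (intro mult_right_mono) auto
    finally show ?case .
  qed
  then show ?thesis by (intro that[of K]) (auto simp: K_def)
qed

lemma cnt_1_le:
  assumes "\<Lambda> < \<infinity>"
  obtains K where "1 \<le> K" "\<forall>\<^sub>F n in sequentially. real (cnt 1 n) \<le> K * real (cnt 2 n) powr (\<alpha> 1 / \<alpha> 2)"
proof -
  obtain \<delta> :: nat where \<delta>: "\<Lambda> < ereal (real \<delta>)" using less_PInf_Ex_of_nat[of \<Lambda>] assms by auto
  define K where "K = max 1 (real \<delta> powr (1 / \<alpha> 2))"
  have "\<forall>\<^sub>F n in sequentially. ereal (real (cnt 1 n) powr \<alpha> 2 / real (cnt 2 n) powr \<alpha> 1) < ereal (real \<delta>)"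
    by (rule order_tendstoD(2)[OF lim \<delta>])
  then have "\<forall>\<^sub>F n in sequentially. real (cnt 1 n) \<le> K * real (cnt 2 n) powr (\<alpha> 1 / \<alpha> 2)"
    using cnt_pos
  proof eventually_elim
    case (elim n)
    have "real (cnt 1 n) powr \<alpha> 2 \<le> real \<delta> * real (cnt 2 n) powr \<alpha> 1"
      using elim by (simp add: field_simps)
    then have "real (cnt 1 n) \<le> real \<delta> powr (1 / \<alpha> 2) * real (cnt 2 n) powr (\<alpha> 1 / \<alpha> 2)"
      using \<alpha>12_pos by (intro powr_le_imp_le_powr) auto
    also have "\<dots> \<le> K * real (cnt 2 n) powr (\<alpha> 1 / \<alpha> 2)"
      unfolding K_def by (intro mult_right_mono) auto
    finally show ?case .
  qed
  then show ?thesis by (intro that[of K]) (auto simp: K_def)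
qed

lemma index_le_cnt_1:
  assumes "0 < \<Lambda>"
  obtains K where "1 \<le> K" "\<forall>\<^sub>F n in sequentially. real n \<le> K * real (cnt 1 n) powr (\<alpha> 2 / \<alpha> 1)"
proof -
  obtain K where K: "1 \<le> K" "\<forall>\<^sub>F n in sequentially. real (cnt 2 n) \<le> K * real (cnt 1 n) powr (\<alpha> 2 / \<alpha> 1)"
    by (rule cnt_2_le[OF assms])
  have "\<forall>\<^sub>F n in sequentially. real n \<le> (K + 1) * real (cnt 1 n) powr (\<alpha> 2 / \<alpha> 1)"
    using K(2) cnt_pos
  proof eventually_elim
    case (elim n)
    have "real (cnt 1 n) powr 1 \<le> real (cnt 1 n) powr (\<alpha> 2 / \<alpha> 1)"
      using elim \<alpha>_less \<alpha>12_pos by (intro powr_mono) auto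
    then have "real (cnt 1 n) + real (cnt 2 n) \<le> (K + 1) * real (cnt 1 n) powr (\<alpha> 2 / \<alpha> 1)"
      using elim by (simp add: algebra_simps)
    then show ?case using cnt_1_plus_cnt_2[of n] by (metis of_nat_add)
  qed
  then show ?thesis using K(1) by (intro that[of "K + 1"]) auto
qed

lemma index_le_cnt_2:
  assumes "\<Lambda> < \<infinity>"
  obtains K where "1 \<le> K" "\<forall>\<^sub>F n in sequentially. real n \<le> K * real (cnt 2 n)"
proof -
  obtain K where K: "1 \<le> K" "\<forall>\<^sub>F n in sequentially. real (cnt 1 n) \<le> K * real (cnt 2 n) powr (\<alpha> 1 / \<alpha> 2)"
    by (rule cnt_1_le[OF assms])
  have "\<forall>\<^sub>F n in sequentially. real n \<le> (K + 1) * real (cnt 2 n)"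
    using K(2) cnt_pos
  proof eventually_elim
    case (elim n)
    have "real (cnt 2 n) powr (\<alpha> 1 / \<alpha> 2) \<le> real (cnt 2 n) powr 1"
      using elim \<alpha>_less \<alpha>12_pos by (intro powr_mono) auto
    then have "K * real (cnt 2 n) powr (\<alpha> 1 / \<alpha> 2) \<le> K * real (cnt 2 n)"
      using K(1) elim by (intro mult_left_mono) auto
    then have "real (cnt 1 n) + real (cnt 2 n) \<le> (K + 1) * real (cnt 2 n)"
      using elim by (simp add: algebra_simps)
    then show ?case using cnt_1_plus_cnt_2[of n] by (metis of_nat_add)
  qed
  then show ?thesis using K(1) by (intro that[of "K + 1"]) auto
qed

lemma ln_powr_0: "\<forall>\<^sub>F n in sequentially. ln (real n) powr - 0 = 1"
proof -
  have "\<forall>\<^sub>F n in sequentially. 0 < ln (real n)" by real_asymp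
  then show ?thesis by eventually_elim simp
qed

text \<open>The next three lemmas check the growth hypothesis of \<open>increment_dichotomy\<close> in the three regimes.  For
\<open>0 < \<Lambda> < \<infinity>\<close> both \<open>n\<close> and \<open>cnt 2 n\<close> are of the order \<open>(cnt 1 n)\<^bsup>\<alpha>\<^sub>2/\<alpha>\<^sub>1\<^esup>\<close>, so a horizon linear in \<open>n\<close>
multiplies both counts by constants.\<close>

lemma horizon_linear:
  assumes "0 < \<Lambda>" "\<Lambda> < \<infinity>"
  shows "\<exists>\<kappa>>0. \<forall>j\<in>{1, 2}. \<forall>\<^sub>F n in sequentially.
    real (cnt j (n + C * n)) \<le> \<kappa> * real (cnt 1 n) powr (\<alpha> j / \<alpha> 1) * ln (real n) powr - 0"
proof -
  define r where "r = \<alpha> 1 / \<alpha> 2"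
  have r: "0 < r" using \<alpha>12_pos by (simp add: r_def)
  obtain K1 where K1: "1 \<le> K1" "\<forall>\<^sub>F n in sequentially. real (cnt 1 n) \<le> K1 * real (cnt 2 n) powr r"
    using cnt_1_le[OF assms(2)] unfolding r_def by blast
  obtain K where K: "1 \<le> K" "\<forall>\<^sub>F n in sequentially. real n \<le> K * real (cnt 1 n) powr (\<alpha> 2 / \<alpha> 1)"
    by (rule index_le_cnt_1[OF assms(1)])
  define D where "D = real (C + 1) * K"
  have D: "0 < D" using K(1) by (simp add: D_def)
  note lin = linear_horizon(1)[OF K(2), of C, folded D_def] and far = linear_horizon(2)[OF K(2), of C]
  define \<kappa> where "\<kappa> = max D (K1 * D powr r)"
  have 1: "\<forall>\<^sub>F n in sequentially. real (cnt 1 (n + C * n)) \<le> \<kappa> * real (cnt 1 n) powr (\<alpha> 1 / \<alpha> 1) * ln (real n) powr - 0"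
    using lin eventually_compose_filterlim[OF K1(2) far] cnt_pos ln_powr_0
  proof eventually_elim
    case (elim n)
    have "real (cnt 1 (n + C * n)) \<le> K1 * real (cnt 2 (n + C * n)) powr r" using elim by simp
    also have "\<dots> \<le> K1 * (D * real (cnt 1 n) powr (\<alpha> 2 / \<alpha> 1)) powr r"
    proof (intro mult_left_mono powr_mono2)
      show "real (cnt 2 (n + C * n)) \<le> D * real (cnt 1 n) powr (\<alpha> 2 / \<alpha> 1)"
        using elim(1) cnt_le[of 2 "n + C * n"] by linarith
    qed (use r K1 in auto)
    also have "\<dots> = K1 * D powr r * real (cnt 1 n) powr (\<alpha> 1 / \<alpha> 1)"
      using D \<alpha>12_pos by (simp add: powr_mult powr_powr r_def)
    also have "\<dots> \<le> \<kappa> * real (cnt 1 n) powr (\<alpha> 1 / \<alpha> 1)"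
      unfolding \<kappa>_def by (intro mult_right_mono) auto
    finally show ?case using elim by simp
  qed
  have 2: "\<forall>\<^sub>F n in sequentially. real (cnt 2 (n + C * n)) \<le> \<kappa> * real (cnt 1 n) powr (\<alpha> 2 / \<alpha> 1) * ln (real n) powr - 0"
    using lin ln_powr_0
  proof eventually_elim
    case (elim n)
    have "real (cnt 2 (n + C * n)) \<le> D * real (cnt 1 n) powr (\<alpha> 2 / \<alpha> 1)"
      using elim(1) cnt_le[of 2 "n + C * n"] by linarith
    also have "\<dots> \<le> \<kappa> * real (cnt 1 n) powr (\<alpha> 2 / \<alpha> 1)"
      unfolding \<kappa>_def by (intro mult_right_mono) auto
    finally show ?case using elim by simp
  qed
  show ?thesis using 1 2 D by (intro exI[of _ \<kappa>]) (auto simp: \<kappa>_def)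
qed

text \<open>Type 1 dominates the normalization but may be rare among the indices, so \<open>cnt 1 (2 n)\<close> need not be
comparable with \<open>cnt 1 n\<close>; with a horizon of \<open>C * cnt 1 n\<close> further indices, the counts grow by no more than that.\<close>

lemma horizon_rare:
  assumes "\<Lambda> = \<infinity>"
  shows "\<exists>\<kappa>>0. \<forall>j\<in>{1, 2}. \<forall>\<^sub>F n in sequentially.
    real (cnt j (n + C * cnt 1 n)) \<le> \<kappa> * real (cnt 1 n) powr (\<alpha> j / \<alpha> 1) * ln (real n) powr - 0"
proof -
  have "0 < \<Lambda>" using assms by simp
  then obtain K where K: "1 \<le> K" "\<forall>\<^sub>F n in sequentially. real (cnt 2 n) \<le> K * real (cnt 1 n) powr (\<alpha> 2 / \<alpha> 1)"
    by (rule cnt_2_le)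
  define \<kappa> where "\<kappa> = K + real C"
  have 1: "\<forall>\<^sub>F n in sequentially. real (cnt 1 (n + C * cnt 1 n)) \<le> \<kappa> * real (cnt 1 n) powr (\<alpha> 1 / \<alpha> 1) * ln (real n) powr - 0"
    using cnt_pos ln_powr_0
  proof eventually_elim
    case (elim n)
    have "real (cnt 1 (n + C * cnt 1 n)) \<le> real (cnt 1 n + C * cnt 1 n)"
      using cnt_add_le[of 1 n "C * cnt 1 n"] by (simp only: of_nat_le_iff)
    also have "\<dots> = (1 + real C) * real (cnt 1 n)" by (simp add: algebra_simps)
    also have "\<dots> \<le> \<kappa> * real (cnt 1 n)"
      unfolding \<kappa>_def using K(1) by (intro mult_right_mono) auto
    finally show ?case using elim \<alpha>12_pos by simp
  qed
  have 2: "\<forall>\<^sub>F n in sequentially. real (cnt 2 (n + C * cnt 1 n)) \<le> \<kappa> * real (cnt 1 n) powr (\<alpha> 2 / \<alpha> 1) * ln (real n) powr - 0"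
    using K(2) cnt_pos ln_powr_0
  proof eventually_elim
    case (elim n)
    have "real (cnt 1 n) powr 1 \<le> real (cnt 1 n) powr (\<alpha> 2 / \<alpha> 1)"
      using elim \<alpha>_less \<alpha>12_pos by (intro powr_mono) auto
    then have "real C * real (cnt 1 n) \<le> real C * real (cnt 1 n) powr (\<alpha> 2 / \<alpha> 1)"
      by (intro mult_left_mono) auto
    moreover have "real (cnt 2 (n + C * cnt 1 n)) \<le> real (cnt 2 n + C * cnt 1 n)"
      using cnt_add_le[of 2 n "C * cnt 1 n"] by (simp only: of_nat_le_iff)
    ultimately have "real (cnt 2 (n + C * cnt 1 n)) \<le> \<kappa> * real (cnt 1 n) powr (\<alpha> 2 / \<alpha> 1)"
      using elim(1) by (simp add: \<kappa>_def algebra_simps)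
    then show ?case using elim by simp
  qed
  show ?thesis using 1 2 K(1) by (intro exI[of _ \<kappa>]) (auto simp: \<kappa>_def)
qed

text \<open>Type 2 fills a positive fraction of the indices.  The logarithmic factor in the assumption on \<open>cnt 1\<close>
is carried along, because the convergent case depends on it.\<close>

lemma horizon_sparse:
  assumes "\<Lambda> = 0" and m: "0 \<le> m"
    and few: "\<forall>\<^sub>F n in sequentially. real (cnt 1 n) < real n powr (\<alpha> 1 / \<alpha> 2) * ln (real n) powr - m"
  shows "\<exists>\<kappa>>0. \<forall>j\<in>{1, 2}. \<forall>\<^sub>F n in sequentially.
    real (cnt j (n + C * n)) \<le> \<kappa> * real (cnt 2 n) powr (\<alpha> j / \<alpha> 2) * ln (real n) powr - (if j = 1 then m else 0)"
proof -
  have "\<Lambda> < \<infinity>" using assms by simp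
  then obtain K where K: "1 \<le> K" "\<forall>\<^sub>F n in sequentially. real n \<le> K * real (cnt 2 n)"
    by (rule index_le_cnt_2)
  define D where "D = real (C + 1) * K"
  have D: "0 < D" using K(1) by (simp add: D_def)
  note lin = linear_horizon(1)[OF K(2), of C, folded D_def] and far = linear_horizon(2)[OF K(2), of C]
  define r where "r = \<alpha> 1 / \<alpha> 2"
  have r: "0 < r" using \<alpha>12_pos by (simp add: r_def)
  define \<kappa> where "\<kappa> = max D (D powr r)"
  have 1: "\<forall>\<^sub>F n in sequentially. real (cnt 1 (n + C * n)) \<le> \<kappa> * real (cnt 2 n) powr r * ln (real n) powr - m"
    using lin eventually_compose_filterlim[OF few far] eventually_ge_at_top[of 2]
  proof eventually_elim
    case (elim n)
    have "0 < ln (real n)" using elim by simp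
    have "real (cnt 1 (n + C * n)) \<le> real (n + C * n) powr r * ln (real (n + C * n)) powr - m"
      using elim by (simp add: r_def)
    also have "\<dots> \<le> (D * real (cnt 2 n)) powr r * ln (real n) powr - m"
    proof (rule mult_mono)
      show "real (n + C * n) powr r \<le> (D * real (cnt 2 n)) powr r"
        using elim r by (intro powr_mono2) auto
      have "real n \<le> real (n + C * n)" by simp
      then have "ln (real n) \<le> ln (real (n + C * n))" using elim(3) by (subst ln_le_cancel_iff) (auto intro: add_pos_nonneg)
      then show "ln (real (n + C * n)) powr - m \<le> ln (real n) powr - m"
        using m \<open>0 < ln (real n)\<close> by (intro powr_mono2') auto
    qed auto
    also have "\<dots> = D powr r * real (cnt 2 n) powr r * ln (real n) powr - m" by (simp add: powr_mult)
    also have "\<dots> \<le> \<kappa> * real (cnt 2 n) powr r * ln (real n) powr - m"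
      unfolding \<kappa>_def by (intro mult_right_mono) auto
    finally show ?case .
  qed
  have 2: "\<forall>\<^sub>F n in sequentially. real (cnt 2 (n + C * n)) \<le> \<kappa> * real (cnt 2 n) powr (\<alpha> 2 / \<alpha> 2) * ln (real n) powr - 0"
    using lin ln_powr_0 cnt_pos
  proof eventually_elim
    case (elim n)
    have "real (cnt 2 (n + C * n)) \<le> D * real (cnt 2 n)"
      using elim(1) cnt_le[of 2 "n + C * n"] by linarith
    also have "\<dots> \<le> \<kappa> * real (cnt 2 n)"
      unfolding \<kappa>_def by (intro mult_right_mono) auto
    finally show ?case using elim \<alpha>12_pos by simp
  qed
  show ?thesis using 1 2 D by (intro exI[of _ \<kappa>]) (auto simp: \<kappa>_def r_def)
qed

lemma norming_comparable:
  assumes "0 < \<Lambda>" "\<Lambda> < \<infinity>"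
  obtains lo hi where "0 < lo" "0 < hi" "\<forall>\<^sub>F n in sequentially.
    lo * real (cnt 1 n) powr (1 / \<alpha> 1) \<le> real (cnt 2 n) powr (1 / \<alpha> 2) \<and>
    real (cnt 2 n) powr (1 / \<alpha> 2) \<le> hi * real (cnt 1 n) powr (1 / \<alpha> 1)"
proof -
  obtain K1 where K1: "1 \<le> K1" "\<forall>\<^sub>F n in sequentially. real (cnt 1 n) \<le> K1 * real (cnt 2 n) powr (\<alpha> 1 / \<alpha> 2)"
    by (rule cnt_1_le[OF assms(2)])
  obtain K2 where K2: "1 \<le> K2" "\<forall>\<^sub>F n in sequentially. real (cnt 2 n) \<le> K2 * real (cnt 1 n) powr (\<alpha> 2 / \<alpha> 1)"
    by (rule cnt_2_le[OF assms(1)])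
  define lo where "lo = 1 / K1 powr (1 / \<alpha> 1)"
  define hi where "hi = K2 powr (1 / \<alpha> 2)"
  have "\<forall>\<^sub>F n in sequentially.
    lo * real (cnt 1 n) powr (1 / \<alpha> 1) \<le> real (cnt 2 n) powr (1 / \<alpha> 2) \<and>
    real (cnt 2 n) powr (1 / \<alpha> 2) \<le> hi * real (cnt 1 n) powr (1 / \<alpha> 1)"
    using K1(2) K2(2)
  proof eventually_elim
    case (elim n)
    have "real (cnt 1 n) powr (1 / \<alpha> 1) \<le> (K1 * real (cnt 2 n) powr (\<alpha> 1 / \<alpha> 2)) powr (1 / \<alpha> 1)"
      using elim(1) \<alpha>12_pos by (intro powr_mono2) auto
    also have "\<dots> = K1 powr (1 / \<alpha> 1) * real (cnt 2 n) powr (1 / \<alpha> 2)"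
      using K1(1) \<alpha>12_pos by (simp add: powr_mult powr_powr)
    finally have "lo * real (cnt 1 n) powr (1 / \<alpha> 1) \<le> real (cnt 2 n) powr (1 / \<alpha> 2)"
      using K1(1) by (simp add: lo_def divide_le_eq mult.commute)
    moreover have "real (cnt 2 n) powr (1 / \<alpha> 2) \<le> (K2 * real (cnt 1 n) powr (\<alpha> 2 / \<alpha> 1)) powr (1 / \<alpha> 2)"
      using elim(2) \<alpha>12_pos by (intro powr_mono2) auto
    then have "real (cnt 2 n) powr (1 / \<alpha> 2) \<le> hi * real (cnt 1 n) powr (1 / \<alpha> 1)"
      using K2(1) \<alpha>12_pos by (simp add: hi_def powr_mult powr_powr)
    ultimately show ?case ..
  qed
  then show ?thesis using K1(1) K2(1) by (intro that[of lo hi]) (auto simp: lo_def hi_def)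
qed

end

end

section \<open>The theorem\<close>

theorem theorem4p2:
  fixes M :: "'a measure"
    and X :: "nat \<Rightarrow> 'a \<Rightarrow> real"
    and G :: "nat \<Rightarrow> real \<Rightarrow> real"
    and \<alpha> l c1 c2 :: "nat \<Rightarrow> real"
    and \<theta> \<beta> :: "nat \<Rightarrow> real \<Rightarrow> real"
    and L :: "nat \<Rightarrow> real measure"
    and d :: "nat \<Rightarrow> nat \<Rightarrow> real"
    and \<Lambda> :: ereal
    and f :: "real \<Rightarrow> real"
    and a :: "nat \<Rightarrow> 'a \<Rightarrow> nat"
  assumes "prob_space M"
    and "0 < \<alpha> 1" "\<alpha> 1 < \<alpha> 2" "\<alpha> 2 < 2"
    and "prob_space.indep_vars M (\<lambda>_. borel) X {1..}"
    and "\<And>k. 1 \<le> k \<Longrightarrow> distr_fun M X k \<in> {G 1, G 2}"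
    and "\<And>j. j \<in> {1, 2} \<Longrightarrow> 0 < l j"
    and "\<And>j. j \<in> {1, 2} \<Longrightarrow> sym_stable_law (L j) (\<alpha> j) (l j)"
    and "\<And>j. j \<in> {1, 2} \<Longrightarrow> normal_attraction (G j) (\<alpha> j) (L j)"
    and "\<And>j. j \<in> {1, 2} \<Longrightarrow> 0 < c1 j \<and> 0 < c2 j"
    and "\<And>j x. j \<in> {1, 2} \<Longrightarrow> 0 < x \<Longrightarrow> 1 - G j x = (c1 j + \<theta> j x) / x powr \<alpha> j"
    and "\<And>j x. j \<in> {1, 2} \<Longrightarrow> 0 < x \<Longrightarrow> G j (- x) = (c2 j + \<beta> j (- x)) / x powr \<alpha> j"
    and "\<And>j. j \<in> {1, 2} \<Longrightarrow> (\<theta> j \<longlongrightarrow> 0) at_top"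
    and "\<And>j. j \<in> {1, 2} \<Longrightarrow> ((\<lambda>x. \<beta> j (- x)) \<longlongrightarrow> 0) at_top"
    and "\<And>j. j \<in> {1, 2} \<Longrightarrow> filterlim (tau M X (G j)) at_top sequentially"
    and "\<And>j. j \<in> {1, 2} \<Longrightarrow> centering (\<alpha> j) (d j)"
    and "\<And>j. j \<in> {1, 2} \<Longrightarrow>
           weak_conv_m
             (\<lambda>n. distr M borel
                (\<lambda>\<omega>. (sum_of M X (G j) n \<omega> - d j (tau M X (G j) n))
                       / real (tau M X (G j) n) powr (1 / \<alpha> j)))
             (L j)"
    and "\<exists>A B :: nat \<Rightarrow> real. (\<forall>n. 0 < B n) \<and>
           conv_to_proper M (\<lambda>n \<omega>. (partial_sum X n \<omega> - A n) / B n)"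
    and "0 \<le> \<Lambda>"
    and "(\<lambda>n. ereal (real (tau M X (G 1) n) powr \<alpha> 2 / real (tau M X (G 2) n) powr \<alpha> 1))
           \<longlonglongrightarrow> \<Lambda>"
    and "growth_fun f"
    and "\<And>n. 1 \<le> n \<Longrightarrow> a n \<in> measurable M (count_space UNIV)"
    and "\<And>n \<omega>. 1 \<le> n \<Longrightarrow> \<omega> \<in> space M \<Longrightarrow> 0 < a n \<omega>"
    and "\<And>n. 1 \<le> n \<Longrightarrow> indep_of_seq M (a n) X"
  shows
    "(0 < \<Lambda> \<longrightarrow>
        (\<Lambda> < \<infinity> \<longrightarrow> (AE \<omega> in M. limsup (\<lambda>n. ereal (real (a n \<omega>) / real n)) < \<infinity>)) \<longrightarrow>
        (\<Lambda> = \<infinity> \<longrightarrow> (AE \<omega> in M. limsup (\<lambda>n. ereal (real (a n \<omega>) / real (tau M X (G 1) n))) < \<infinity>)) \<longrightarrow>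
        (AE \<omega> in M.
           (limsup (\<lambda>n. ereal (\<bar>random_increment X a n \<omega>\<bar>
                                 / (norming M X G \<alpha> \<Lambda> n * f (real n) powr (1 / \<alpha> 1)))) = 0
              \<longleftrightarrow> log_integral f < \<infinity>) \<and>
           (limsup (\<lambda>n. ereal (\<bar>random_increment X a n \<omega>\<bar>
                                 / (norming M X G \<alpha> \<Lambda> n * f (real n) powr (1 / \<alpha> 1)))) = \<infinity>
              \<longleftrightarrow> log_integral f = \<infinity>)))
     \<and>
     (\<Lambda> = 0 \<longrightarrow>
        (AE \<omega> in M. limsup (\<lambda>n. ereal (real (a n \<omega>) / real n)) < \<infinity>) \<longrightarrow>
        (\<exists>\<mu> > (\<alpha> 2 - \<alpha> 1) / \<alpha> 2. \<forall>\<^sub>F n in sequentially.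
           real (tau M X (G 1) n) < real n powr (\<alpha> 1 / \<alpha> 2) * ln (real n) powr (- \<mu>)) \<longrightarrow>
        (AE \<omega> in M.
           (limsup (\<lambda>n. ereal (\<bar>random_increment X a n \<omega>\<bar>
                                 / (norming M X G \<alpha> \<Lambda> n * f (real n) powr (1 / \<alpha> 2)))) = 0
              \<longleftrightarrow> log_integral f < \<infinity>) \<and>
           (limsup (\<lambda>n. ereal (\<bar>random_increment X a n \<omega>\<bar>
                                 / (norming M X G \<alpha> \<Lambda> n * f (real n) powr (1 / \<alpha> 2)))) = \<infinity>
              \<longleftrightarrow> log_integral f = \<infinity>)))"
proof -
  interpret prob_space M by (rule assms(1))
  note \<alpha>1 = assms(2) and \<alpha>12 = assms(3) and \<alpha>2 = assms(4)
  note indep = assms(5) and law = assms(6) and L = assms(8) and c = assms(10)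
  note right = assms(11) and left = assms(12) and \<theta> = assms(13) and \<beta> = assms(14)
  note tau_top = assms(15) and centering = assms(16) and wc = assms(17)
  note lim = assms(20) and f = assms(21) and a_pos = assms(23)
  have \<alpha>_pos: "0 < \<alpha> j" and \<alpha>_less_2: "\<alpha> j < 2" if "j \<in> {1, 2}" for j
    using that \<alpha>1 \<alpha>12 \<alpha>2 by auto
  have rvX: "random_variable borel (X k)" if "1 \<le> k" for k
    using indep that by (auto simp: indep_vars_def2)

  \<comment> \<open>tails of different exponents belong to different laws, so the two types are disjoint\<close>
  have G_neq: "G 1 \<noteq> G 2"
  proof
    assume eq: "G 1 = G 2"
    have "\<forall>\<^sub>F x in at_top. (c1 1 + \<theta> 1 x) * x powr (\<alpha> 2 - \<alpha> 1) = c1 2 + \<theta> 2 x"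
      using eventually_gt_at_top[of 0]
    proof eventually_elim
      case (elim x)
      then have "(c1 1 + \<theta> 1 x) / x powr \<alpha> 1 = (c1 2 + \<theta> 2 x) / x powr \<alpha> 2"
        using right[of 1 x] right[of 2 x] eq by simp
      then show ?case using elim by (simp add: powr_diff field_simps)
    qed
    moreover have "((\<lambda>x. c1 2 + \<theta> 2 x) \<longlongrightarrow> c1 2 + 0) at_top"
      by (intro tendsto_intros \<theta>) simp
    moreover have "filterlim (\<lambda>x. (c1 1 + \<theta> 1 x) * x powr (\<alpha> 2 - \<alpha> 1)) at_top at_top"
    proof (rule filterlim_tendsto_pos_mult_at_top)
      show "((\<lambda>x. c1 1 + \<theta> 1 x) \<longlongrightarrow> c1 1 + 0) at_top" by (intro tendsto_intros \<theta>) simp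
      show "0 < c1 1 + 0" using c[of 1] by simp
      show "filterlim (\<lambda>x. x powr (\<alpha> 2 - \<alpha> 1)) at_top at_top" using \<alpha>12 by real_asymp
    qed
    ultimately have "filterlim (\<lambda>x. c1 2 + \<theta> 2 x) at_top at_top"
      by (subst (asm) filterlim_cong[OF refl refl]) auto
    then show False
      using \<open>((\<lambda>x. c1 2 + \<theta> 2 x) \<longlongrightarrow> c1 2 + 0) at_top\<close> not_tendsto_and_filterlim_at_infinity
      by (metis filterlim_at_top_imp_at_infinity trivial_limit_at_top_linorder)
  qed

  define ty :: "nat \<Rightarrow> nat" where "ty k = (if distr_fun M X k = G 1 then 1 else 2)" for k
  have ty12: "ty k \<in> {1, 2}" for k by (simp add: ty_def)
  have ty_iff: "distr_fun M X k = G j \<longleftrightarrow> ty k = j" if "1 \<le> k" "j \<in> {1, 2}" for k j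
    using law[OF that(1)] that(2) G_neq by (auto simp: ty_def)
  have idx: "idx_of M X (G j) n = {k \<in> {1..n}. ty k = j}" if "j \<in> {1, 2}" for j n
    using ty_iff that by (auto simp: idx_of_def)
  have cdfX: "cdf (distr M borel (X k)) = G (ty k)" if "1 \<le> k" for k
    using ty_iff[OF that ty12] by (simp add: distr_fun_def)

  define tail_const where "tail_const j Q b x0 \<longleftrightarrow> 0 < Q \<and> 0 < b
      \<and> (\<forall>k\<ge>1. ty k = j \<longrightarrow> power_tails (\<alpha> j) Q b x0 (X k))" for j Q b x0
  have "\<exists>Q b x0. tail_const j Q b x0" if j: "j \<in> {1, 2}" for j
  proof -
    obtain Q b x0 where Qb: "0 < Q" "0 < b"
      and tails: "\<And>Y. random_variable borel Y \<Longrightarrow> cdf (distr M borel Y) = G j \<Longrightarrow> power_tails (\<alpha> j) Q b x0 Y"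
      using power_tail_bounds[OF \<alpha>_pos[OF j] conjunct1[OF c[OF j]] conjunct2[OF c[OF j]]
            right[OF j] left[OF j] \<theta>[OF j] \<beta>[OF j]] by metis
    then have "tail_const j Q b x0" unfolding tail_const_def using rvX cdfX by blast
    then show ?thesis by blast
  qed
  then obtain Qt b x0 where T: "\<And>j. j \<in> {1, 2} \<Longrightarrow> tail_const j (Qt j) (b j) (x0 j)"
    by metis
  have Qt: "0 < Qt j" and b: "0 < b j"
    and tail: "1 \<le> k \<Longrightarrow> ty k = j \<Longrightarrow> 0 < x \<Longrightarrow> \<P>(\<omega> in M. x < \<bar>X k \<omega>\<bar>) \<le> Qt j * x powr - \<alpha> j"
    and upper: "1 \<le> k \<Longrightarrow> ty k = j \<Longrightarrow> x0 j \<le> x \<Longrightarrow> b j * x powr - \<alpha> j \<le> \<P>(\<omega> in M. x \<le> X k \<omega>)"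
    and lower: "1 \<le> k \<Longrightarrow> ty k = j \<Longrightarrow> x0 j \<le> x \<Longrightarrow> b j * x powr - \<alpha> j \<le> \<P>(\<omega> in M. X k \<omega> \<le> - x)"
    if "j \<in> {1, 2}" for j k x
    using T[OF that] by (simp_all add: tail_const_def power_tails_def)

  have "\<exists>k. 1 \<le> k \<and> ty k = j" if j: "j \<in> {1, 2}" for j
  proof -
    have "\<forall>\<^sub>F n in sequentially. 1 \<le> tau M X (G j) n"
      using tau_top[OF j] by (simp add: filterlim_at_top)
    then obtain n where "1 \<le> tau M X (G j) n" by (auto simp: eventually_sequentially)
    then have "1 \<le> card {k \<in> {1..n}. ty k = j}" by (simp only: tau_def idx[OF j])
    then have "{k \<in> {1..n}. ty k = j} \<noteq> {}" by (metis card.empty not_one_le_zero)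
    then show ?thesis by auto
  qed
  then obtain rep where rep: "\<And>j. j \<in> {1, 2} \<Longrightarrow> 1 \<le> rep j" "\<And>j. j \<in> {1, 2} \<Longrightarrow> ty (rep j) = j"
    by metis
  \<comment> \<open>the truncated mean depends on the law alone, so any one summand of the type may represent it\<close>
  define drift where "drift j x = expectation (\<lambda>\<omega>. trunc x (X (rep j) \<omega>))" for j x
  have drift: "expectation (\<lambda>\<omega>. trunc x (X k \<omega>)) = drift (ty k) x" if k: "1 \<le> k" for k x
  proof -
    let ?r = "rep (ty k)"
    note rk = rep(1)[OF ty12[of k]] rep(2)[OF ty12[of k]]
    have "distr M borel (X k) = distr M borel (X ?r)"
      by (rule cdf_unique) (use rvX[OF k] rvX[OF rk(1)] cdfX[OF k] cdfX[OF rk(1)] rk(2) in \<open>auto intro: real_distribution_distr\<close>)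
    then have "integral\<^sup>L (distr M borel (X k)) (trunc x) = integral\<^sup>L (distr M borel (X ?r)) (trunc x)" by simp
    then show ?thesis using rvX[OF k] rvX[OF rk(1)] by (simp add: integral_distr drift_def)
  qed

  define moment_const where "moment_const j Q \<longleftrightarrow> 0 < Q
      \<and> (\<forall>k x. 1 \<le> k \<longrightarrow> ty k = j \<longrightarrow> 0 < x \<longrightarrow> \<P>(\<omega> in M. x < \<bar>X k \<omega>\<bar>) \<le> Q * x powr - \<alpha> j)
      \<and> (\<forall>k x. 1 \<le> k \<longrightarrow> ty k = j \<longrightarrow> 0 < x \<longrightarrow> expectation (\<lambda>\<omega>. (trunc x (X k \<omega>))\<^sup>2) \<le> Q * x powr (2 - \<alpha> j))
      \<and> (\<forall>x. \<alpha> j \<noteq> 1 \<longrightarrow> 0 < x \<longrightarrow> \<bar>drift j x\<bar> \<le> Q * x powr (1 - \<alpha> j))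
      \<and> (\<forall>x. \<alpha> j = 1 \<longrightarrow> 1 \<le> x \<longrightarrow> \<bar>drift j x\<bar> \<le> Q * (1 + ln x))" for j Q
  have "\<exists>Q. moment_const j Q"
    if j: "j \<in> {1, 2}" for j
  proof -
    define V where "V = Qt j * 2 powr \<alpha> j / (1 - 2 powr (\<alpha> j - 2))"
    have V: "expectation (\<lambda>\<omega>. (trunc x (X k \<omega>))\<^sup>2) \<le> V * x powr (2 - \<alpha> j)" if k: "1 \<le> k" "ty k = j" "0 < x" for k x
      using truncated_moment_bound[OF rvX[OF k(1)] tail[OF j k(1,2)] \<alpha>_less_2[OF j] _ _ k(3)] Qt[OF j]
      by (simp add: V_def)
    define Q0 where "Q0 = max (Qt j) V"
    have Q0: "0 < Q0" "Qt j \<le> Q0" "V \<le> Q0" using Qt[OF j] by (auto simp: Q0_def)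
    have V0: "expectation (\<lambda>\<omega>. (trunc x (X k \<omega>))\<^sup>2) \<le> Q0 * x powr (2 - \<alpha> j)" if k: "1 \<le> k" "ty k = j" "0 < x" for k x
      using V[OF k] mult_right_mono[OF Q0(3), of "x powr (2 - \<alpha> j)"] by simp
    have T0: "\<P>(\<omega> in M. x < \<bar>X k \<omega>\<bar>) \<le> Q0 * x powr - \<alpha> j" if k: "1 \<le> k" "ty k = j" "0 < x" for k x
      using tail[OF j k] mult_right_mono[OF Q0(2), of "x powr - \<alpha> j"] by simp
    note r = rep(1)[OF j] rep(2)[OF j]
    \<comment> \<open>below exponent 1 from the first absolute moment, above it because the mean vanishes\<close>
    have "\<exists>W. \<forall>x. 0 < x \<longrightarrow> \<bar>drift j x\<bar> \<le> W * x powr (1 - \<alpha> j)" if "\<alpha> j \<noteq> 1"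
    proof (cases "\<alpha> j < 1")
      case True
      have "\<bar>drift j x\<bar> \<le> Qt j * 2 powr \<alpha> j / (1 - 2 powr (\<alpha> j - 1)) * x powr (1 - \<alpha> j)" if x: "0 < x" for x
      proof -
        have "\<bar>drift j x\<bar> \<le> expectation (\<lambda>\<omega>. \<bar>trunc x (X (rep j) \<omega>)\<bar>)"
          unfolding drift_def by (rule integral_abs_bound)
        also have "\<dots> \<le> Qt j * 2 powr \<alpha> j / (1 - 2 powr (\<alpha> j - 1)) * x powr (1 - \<alpha> j)"
          using truncated_moment_bound[OF rvX[OF r(1)] tail[OF j r] True _ _ x] Qt[OF j] by simp
        finally show ?thesis .
      qed
      then show ?thesis by blast
    next
      case False
      then have \<alpha>: "1 < \<alpha> j" using that by simp
      have d0: "d j m = 0" for m using centering[OF j] that by (simp add: centering_def)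
      have "(drift j \<longlongrightarrow> 0) at_top"
      proof (rule truncated_mean_tendsto_0[OF indep _ _ \<alpha> Q0(1), where J="{k. ty k = j}"])
        show "filterlim (\<lambda>n. card {k \<in> {1..n}. k \<in> {k. ty k = j}}) at_top sequentially"
          using tau_top[OF j] by (simp add: tau_def[abs_def] idx[OF j])
        show "weak_conv_m (\<lambda>n. distr M borel (\<lambda>\<omega>. (\<Sum>k\<in>{k \<in> {1..n}. k \<in> {k. ty k = j}}. X k \<omega>)
            / real (card {k \<in> {1..n}. k \<in> {k. ty k = j}}) powr (1 / \<alpha> j))) (L j)"
          using wc[OF j] by (simp add: sum_of_def tau_def idx[OF j] d0)
        show "real_distribution (L j)" using L[OF j] by (simp add: sym_stable_law_def)
      qed (use T0 V0 drift in auto)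
      then have "((\<lambda>x. expectation (\<lambda>\<omega>. trunc x (X (rep j) \<omega>))) \<longlongrightarrow> 0) at_top"
        by (simp add: drift_def[abs_def])
      note truncated_mean_le_of_tendsto_0[OF rvX[OF r(1)] tail[OF j r] this \<alpha>]
      then show ?thesis using Qt[OF j] unfolding drift_def by (blast intro: less_imp_le)
    qed
    then obtain W where W: "\<And>x. \<alpha> j \<noteq> 1 \<Longrightarrow> 0 < x \<Longrightarrow> \<bar>drift j x\<bar> \<le> W * x powr (1 - \<alpha> j)" by blast
    have W1: "\<bar>drift j x\<bar> \<le> (1 + 4 * Qt j) * (1 + ln x)" if "\<alpha> j = 1" "1 \<le> x" for x
      unfolding drift_def
      by (rule truncated_mean_le_log[OF rvX[OF r(1)] _ _ that(2)]) (use tail[OF j r] Qt[OF j] that in auto)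
    define Q where "Q = max (max Q0 W) (1 + 4 * Qt j)"
    have Q: "0 < Q" "Q0 \<le> Q" "W \<le> Q" "1 + 4 * Qt j \<le> Q" using Q0 by (auto simp: Q_def)
    show ?thesis unfolding moment_const_def
    proof (rule exI[of _ Q], intro conjI allI impI Q(1))
      fix k x assume k: "1 \<le> k" "ty k = j" and x: "(0::real) < x"
      show "\<P>(\<omega> in M. x < \<bar>X k \<omega>\<bar>) \<le> Q * x powr - \<alpha> j"
        using T0[OF k x] mult_right_mono[OF Q(2), of "x powr - \<alpha> j"] by simp
      show "expectation (\<lambda>\<omega>. (trunc x (X k \<omega>))\<^sup>2) \<le> Q * x powr (2 - \<alpha> j)"
        using V0[OF k x] mult_right_mono[OF Q(2), of "x powr (2 - \<alpha> j)"] by simp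
    next
      fix x assume "\<alpha> j \<noteq> 1" "(0::real) < x"
      then show "\<bar>drift j x\<bar> \<le> Q * x powr (1 - \<alpha> j)"
        using W[of x] mult_right_mono[OF Q(3), of "x powr (1 - \<alpha> j)"]
        by (meson order_trans powr_ge_zero)
    next
      fix x assume x: "\<alpha> j = 1" "(1::real) \<le> x"
      then show "\<bar>drift j x\<bar> \<le> Q * (1 + ln x)"
        using W1[OF x] mult_right_mono[OF Q(4), of "1 + ln x"] ln_ge_zero[OF x(2)] by linarith
    qed
  qed
  then obtain Qj where Qm: "\<And>j. j \<in> {1, 2} \<Longrightarrow> moment_const j (Qj j)"
    by metis
  have Qj: "0 < Qj j"
      "1 \<le> k \<Longrightarrow> ty k = j \<Longrightarrow> 0 < x \<Longrightarrow> \<P>(\<omega> in M. x < \<bar>X k \<omega>\<bar>) \<le> Qj j * x powr - \<alpha> j"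
      "1 \<le> k \<Longrightarrow> ty k = j \<Longrightarrow> 0 < x \<Longrightarrow> expectation (\<lambda>\<omega>. (trunc x (X k \<omega>))\<^sup>2) \<le> Qj j * x powr (2 - \<alpha> j)"
      "\<alpha> j \<noteq> 1 \<Longrightarrow> 0 < x \<Longrightarrow> \<bar>drift j x\<bar> \<le> Qj j * x powr (1 - \<alpha> j)"
      "\<alpha> j = 1 \<Longrightarrow> 1 \<le> x \<Longrightarrow> \<bar>drift j x\<bar> \<le> Qj j * (1 + ln x)"
    if "j \<in> {1, 2}" for j k x
    using Qm[OF that] by (simp_all add: moment_const_def)
  define Q where "Q = max (Qj 1) (Qj 2)"
  have le_Q: "Qj j * z \<le> Q * z" if "j \<in> {1, 2}" "0 \<le> z" for j z
    using that by (intro mult_right_mono) (auto simp: Q_def)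

  interpret two_type_sequence M X ty \<alpha> drift Q
  proof
    show "indep_vars (\<lambda>_. borel) X {1..}" by (rule indep)
    show "ty k \<in> {1, 2}" for k by (rule ty12)
    show "0 < \<alpha> j" if "j \<in> {1, 2}" for j by (rule \<alpha>_pos[OF that])
    show "\<alpha> 1 \<noteq> \<alpha> 2" using \<alpha>12 by simp
    show "0 < Q" using Qj(1)[of 1] by (simp add: Q_def)
  next
    fix k :: nat and x :: real assume k: "1 \<le> k" and x: "0 < x"
    show "\<P>(\<omega> in M. x < \<bar>X k \<omega>\<bar>) \<le> Q * x powr - \<alpha> (ty k)"
      using Qj(2)[OF ty12 k refl x] by (rule order_trans) (intro le_Q ty12, simp)
    show "expectation (\<lambda>\<omega>. (trunc x (X k \<omega>))\<^sup>2) \<le> Q * x powr (2 - \<alpha> (ty k))"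
      using Qj(3)[OF ty12 k refl x] by (rule order_trans) (intro le_Q ty12, simp)
    show "expectation (\<lambda>\<omega>. trunc x (X k \<omega>)) = drift (ty k) x" by (rule drift[OF k])
  next
    fix j :: nat and x :: real assume j: "j \<in> {1, 2}" "\<alpha> j \<noteq> 1" and x: "0 < x"
    show "\<bar>drift j x\<bar> \<le> Q * x powr (1 - \<alpha> j)"
      using Qj(4)[OF j x] by (rule order_trans) (intro le_Q j, simp)
  next
    fix j :: nat and x :: real assume j: "j \<in> {1, 2}" "\<alpha> j = 1" and x: "1 \<le> x"
    show "\<bar>drift j x\<bar> \<le> Q * (1 + ln x)"
      using Qj(5)[OF j x] by (rule order_trans) (intro le_Q j, use x in auto)
  qed

  have tau_cnt: "tau M X (G j) n = cnt j n" if "j \<in> {1, 2}" for j n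
    by (simp add: tau_def idx[OF that] cnt_def)
  have top: "filterlim (cnt j) at_top sequentially" if j: "j \<in> {1, 2}" for j
  proof -
    have "tau M X (G j) = cnt j" by (rule ext) (rule tau_cnt[OF j])
    with tau_top[OF j] show ?thesis by simp
  qed
  have lim_cnt: "(\<lambda>n. ereal (real (cnt 1 n) powr \<alpha> 2 / real (cnt 2 n) powr \<alpha> 1)) \<longlonglongrightarrow> \<Lambda>"
    using lim by (simp only: tau_cnt[OF type_cases(1)] tau_cnt[OF type_cases(2)])
  note regime = top \<alpha>12 lim_cnt
  have norming_eq: "norming M X G \<alpha> \<Lambda> n =
      (if \<Lambda> = \<infinity> then real (cnt 1 n) powr (1 / \<alpha> 1) else real (cnt 2 n) powr (1 / \<alpha> 2))" for n
    by (simp only: norming_def tau_cnt[OF type_cases(1)] tau_cnt[OF type_cases(2)])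
  have norming_nonneg: "0 \<le> norming M X G \<alpha> \<Lambda> n" for n by (simp add: norming_def)
  have linear: "\<exists>C. \<forall>\<^sub>F n in sequentially. n + a n \<omega> \<le> n + C * m n"
    if l: "limsup (\<lambda>n. ereal (real (a n \<omega>) / real (m n))) < \<infinity>" and m: "\<forall>\<^sub>F n in sequentially. 1 \<le> m n"
    for \<omega> and m :: "nat \<Rightarrow> nat"
  proof -
    obtain C where "\<forall>\<^sub>F n in sequentially. real (a n \<omega>) / real (m n) < real C"
      by (rule limsup_ereal_finiteD[OF l])
    with m have "\<forall>\<^sub>F n in sequentially. n + a n \<omega> \<le> n + C * m n"
    proof eventually_elim
      case (elim n)
      then have "real (a n \<omega>) \<le> real (C * m n)" by (simp add: divide_less_eq)
      then show ?case by (simp only: of_nat_le_iff add_left_mono)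
    qed
    then show ?thesis by blast
  qed

  let ?dichotomy = "\<lambda>p. AE \<omega> in M.
      (limsup (\<lambda>n. ereal (\<bar>random_increment X a n \<omega>\<bar> / (norming M X G \<alpha> \<Lambda> n * f (real n) powr (1 / p)))) = 0
        \<longleftrightarrow> log_integral f < \<infinity>) \<and>
      (limsup (\<lambda>n. ereal (\<bar>random_increment X a n \<omega>\<bar> / (norming M X G \<alpha> \<Lambda> n * f (real n) powr (1 / p)))) = \<infinity>
        \<longleftrightarrow> log_integral f = \<infinity>)"
  show ?thesis
  proof (intro conjI impI)
    assume pos: "0 < \<Lambda>"
      and fin_bound: "\<Lambda> < \<infinity> \<longrightarrow> (AE \<omega> in M. limsup (\<lambda>n. ereal (real (a n \<omega>) / real n)) < \<infinity>)"
      and inf_bound: "\<Lambda> = \<infinity> \<longrightarrow> (AE \<omega> in M. limsup (\<lambda>n. ereal (real (a n \<omega>) / real (tau M X (G 1) n))) < \<infinity>)"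
    \<comment> \<open>\<open>\<Lambda> > 0\<close>: type 1 governs, and \<open>\<alpha> 1 \<le> \<alpha> j\<close> for both types\<close>
    obtain K where "\<forall>\<^sub>F n in sequentially. real n \<le> K * real (cnt 1 n) powr (\<alpha> 2 / \<alpha> 1)"
      by (rule index_le_cnt_1[OF regime pos])
    then obtain q where q: "\<forall>\<^sub>F n in sequentially. n \<le> cnt 1 n ^ q"
      using polynomial_growth[OF top[OF type_cases(1)]] by blast
    have \<mu>_cases: "\<alpha> 1 \<le> \<alpha> j \<and> (0::real) = 0 \<or> 1 < (0::real) + \<alpha> j / \<alpha> 1" if "j \<in> {1, 2}" for j
      using that \<alpha>12 by auto
    show "?dichotomy (\<alpha> 1)"
    proof (cases "\<Lambda> = \<infinity>")
      case True
      have bound: "AE \<omega> in M. \<exists>C. \<forall>\<^sub>F n in sequentially. n + a n \<omega> \<le> n + C * cnt 1 n"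
      proof -
        have "AE \<omega> in M. limsup (\<lambda>n. ereal (real (a n \<omega>) / real (cnt 1 n))) < \<infinity>"
          using inf_bound[rule_format, OF True] by (simp only: tau_cnt[OF type_cases(1)])
        then show ?thesis
          by eventually_elim (rule linear, use top[OF type_cases(1)] in \<open>auto simp: filterlim_at_top\<close>)
      qed
      have mono: "mono (\<lambda>n. n + C * cnt 1 n)" for C
        using mono_cnt[of 1] by (auto simp: mono_def intro!: add_mono mult_left_mono)
      have B: "\<forall>\<^sub>F n in sequentially. 1 * real (cnt 1 n) powr (1 / \<alpha> 1) \<le> norming M X G \<alpha> \<Lambda> n
          \<and> norming M X G \<alpha> \<Lambda> n \<le> 1 * real (cnt 1 n) powr (1 / \<alpha> 1)"
        unfolding norming_eq using True by simp
      show ?thesis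
        by (rule increment_dichotomy[OF type_cases(1) top[OF type_cases(1)] mono horizon_rare[OF regime True]
              order_refl \<mu>_cases q b[OF type_cases(1)] upper[OF type_cases(1)] lower[OF type_cases(1)] f
              zero_less_one zero_less_one B norming_nonneg a_pos bound])
    next
      case False
      then have fin: "\<Lambda> < \<infinity>" by simp
      have bound: "AE \<omega> in M. \<exists>C. \<forall>\<^sub>F n in sequentially. n + a n \<omega> \<le> n + C * n"
        using fin_bound[rule_format, OF fin]
        by eventually_elim (rule linear, use eventually_ge_at_top in auto)
      have mono: "mono (\<lambda>n. n + C * n)" for C :: nat
        by (auto simp: mono_def intro!: add_mono mult_left_mono)
      obtain lo hi where B: "0 < lo" "0 < hi" "\<forall>\<^sub>F n in sequentially.
          lo * real (cnt 1 n) powr (1 / \<alpha> 1) \<le> real (cnt 2 n) powr (1 / \<alpha> 2) \<and>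
          real (cnt 2 n) powr (1 / \<alpha> 2) \<le> hi * real (cnt 1 n) powr (1 / \<alpha> 1)"
        by (rule norming_comparable[OF regime pos fin])
      have norm_bounds: "\<forall>\<^sub>F n in sequentially. lo * real (cnt 1 n) powr (1 / \<alpha> 1) \<le> norming M X G \<alpha> \<Lambda> n
          \<and> norming M X G \<alpha> \<Lambda> n \<le> hi * real (cnt 1 n) powr (1 / \<alpha> 1)"
        unfolding norming_eq using B(3) False by simp
      show ?thesis
        by (rule increment_dichotomy[OF type_cases(1) top[OF type_cases(1)] mono horizon_linear[OF regime pos fin]
              order_refl \<mu>_cases q b[OF type_cases(1)] upper[OF type_cases(1)] lower[OF type_cases(1)] f
              B(1,2) norm_bounds norming_nonneg a_pos bound])
    qed
  next
    assume zero: "\<Lambda> = 0"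
      and fin_bound: "AE \<omega> in M. limsup (\<lambda>n. ereal (real (a n \<omega>) / real n)) < \<infinity>"
      and few: "\<exists>\<mu> > (\<alpha> 2 - \<alpha> 1) / \<alpha> 2. \<forall>\<^sub>F n in sequentially.
           real (tau M X (G 1) n) < real n powr (\<alpha> 1 / \<alpha> 2) * ln (real n) powr (- \<mu>)"
    obtain m where m: "(\<alpha> 2 - \<alpha> 1) / \<alpha> 2 < m"
      "\<forall>\<^sub>F n in sequentially. real (cnt 1 n) < real n powr (\<alpha> 1 / \<alpha> 2) * ln (real n) powr - m"
      using few by (auto simp only: tau_cnt[OF type_cases(1)])
    \<comment> \<open>\<open>\<Lambda> = 0\<close>: type 2 governs, and the exponent \<open>m\<close> makes up for \<open>\<alpha> 1 < \<alpha> 2\<close>\<close>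
    have "0 < (\<alpha> 2 - \<alpha> 1) / \<alpha> 2" using \<alpha>1 \<alpha>12 by simp
    then have m0: "0 \<le> m" using m(1) by simp
    have m1: "1 < m + \<alpha> 1 / \<alpha> 2" using m(1) \<alpha>1 \<alpha>12 by (simp add: field_simps)
    have fin: "\<Lambda> < \<infinity>" using zero by simp
    obtain K where "\<forall>\<^sub>F n in sequentially. real n \<le> K * real (cnt 2 n)"
      by (rule index_le_cnt_2[OF regime fin])
    then have "\<forall>\<^sub>F n in sequentially. real n \<le> K * real (cnt 2 n) powr 1" by simp
    then obtain q where q: "\<forall>\<^sub>F n in sequentially. n \<le> cnt 2 n ^ q"
      using polynomial_growth[OF top[OF type_cases(2)]] by blast
    have bound: "AE \<omega> in M. \<exists>C. \<forall>\<^sub>F n in sequentially. n + a n \<omega> \<le> n + C * n"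
      using fin_bound by eventually_elim (rule linear, use eventually_ge_at_top in auto)
    have mono: "mono (\<lambda>n. n + C * n)" for C :: nat
      by (auto simp: mono_def intro!: add_mono mult_left_mono)
    have \<mu>: "0 \<le> (if j = 1 then m else 0)"
      and \<mu>_cases: "\<alpha> 2 \<le> \<alpha> j \<and> (if j = 1 then m else 0) = 0 \<or> 1 < (if j = 1 then m else 0) + \<alpha> j / \<alpha> 2"
      if "j \<in> {1, 2}" for j :: nat
      using that m0 m1 by auto
    have B: "\<forall>\<^sub>F n in sequentially. 1 * real (cnt 2 n) powr (1 / \<alpha> 2) \<le> norming M X G \<alpha> \<Lambda> n
        \<and> norming M X G \<alpha> \<Lambda> n \<le> 1 * real (cnt 2 n) powr (1 / \<alpha> 2)"
      unfolding norming_eq using zero by simp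
    show "?dichotomy (\<alpha> 2)"
      by (rule increment_dichotomy[OF type_cases(2) top[OF type_cases(2)] mono horizon_sparse[OF regime zero m0 m(2)]
            \<mu> \<mu>_cases q b[OF type_cases(2)] upper[OF type_cases(2)] lower[OF type_cases(2)] f
            zero_less_one zero_less_one B norming_nonneg a_pos bound])
  qed
qed

end
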